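(* Let $n\ge 2$ be an integer. The maximal homogeneous ideal $J$ of $\widetilde W(A_{n-1})$ intersecting the local part trivially is generated by the relations $$[f_{0a},f_{0b}]=0\qquad (a,b\in\{0,2,3,\dots,n-1\}),$$ $$[f_{0i},[f_1,f_{0j}]]=0\qquad (i,j\ge 3),$$ $$[(f_{02}-f_{00}),[f_1,f_{0i}]]=0\qquad (i\ge 3),$$ i.e. $J$ is the ideal of $\widetilde W(A_{n-1})$ generated by the left-hand sides of these relations.
   Context: The base field $\mathbb K$ is $\mathbb R$ or $\mathbb C$. Let $B=(B_{ab})_{0\le a,b\le n-1}$ be the symmetric matrix with $B_{00}=0$, $B_{aa}=2$ for $a\ge1$, $B_{ab}=-1$ if $|a-b|=1$, and $B_{ab}=0$ otherwise. $\widetilde W=\widetilde W(A_{n-1})$ is the Lie superalgebra over $\mathbb K$ generated by odd generators $e_0$ and $f_{0a}$ ($a\in\{0,2,3,\dots,n-1\}$) and even generators $e_a,f_a$ ($1\le a\le n-1$), modulo the following relations, where $h_a:=[e_0,f_{0a}]$ for $a\ne1$ and $h_1:=[e_1,f_1]$; whenever $f_a$ appears $a\neq 0$ is understood, and whenever $f_{0a}$ appears $a\ne 1$ is understood; otherwise $a,b$ run over $0,\dots,n-1$: (R1) $[h_a,e_b]=B_{ab}e_b$, $[h_a,f_b]=-B_{ab}f_b$, $[e_a,f_b]=\delta_{ab}h_b$; (R2) $(\mathrm{ad}\,e_a)^{1-B_{ab}}(e_b)=0$ and $(\mathrm{ad}\,f_a)^{1-B_{ab}}(f_b)=0$ for $a\ne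 b$; (R3) $[e_0,f_{0a}]=h_a$; (R4) $[h_a,f_{0b}]=-B_{a0}f_{0b}$; (R5) $[e_1,f_{0a}]=0$; (R6) $[e_a,[e_a,f_{0b}]]=0$ and $[f_a,[f_a,f_{0b}]]=0$; (R7) $[e_i,[f_j,f_{0a}]]=\delta_{ij}B_{aj}f_{0j}$ for $i,j=2,3,\dots,n-1$. $\widetilde W$ has a $\mathbb Z$-grading $\widetilde W=\bigoplus_k\widetilde W_k$ in which $e_0$ has degree $1$, every $f_{0a}$ has degree $-1$, and all other generators have degree $0$. $J$ is the maximal homogeneous ideal of $\widetilde W$ intersecting the local part $\widetilde W_{-1}\oplus\widetilde W_0\oplus\widetilde W_1$ trivially. *)

theory Defs
  imports Complex_Main "HOL-Library.Z2"
begin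

section \<open>Subspaces and ideals of algebras with an explicit carrier\<close>

record ('a, 'k) bracket_algebra =
  carrier :: "'a set"
  zero :: 'a
  add :: "'a \<Rightarrow> 'a \<Rightarrow> 'a"
  scale :: "'k \<Rightarrow> 'a \<Rightarrow> 'a"
  bracket :: "'a \<Rightarrow> 'a \<Rightarrow> 'a"

definition linear_subspace :: "('a, 'k) bracket_algebra \<Rightarrow> 'a set \<Rightarrow> bool" where
  "linear_subspace L V \<longleftrightarrow> V \<subseteq> carrier L \<and> zero L \<in> V \<and>
     (\<forall>x\<in>V. \<forall>y\<in>V. add L x y \<in> V) \<and> (\<forall>c. \<forall>x\<in>V. scale L c x \<in> V)"

definition linear_span :: "('a, 'k) bracket_algebra \<Rightarrow> 'a set \<Rightarrow> 'a set" where
  "linear_span L S = \<Inter>{V. linear_subspace L V \<and> S \<subseteq> V}"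

definition lie_ideal :: "('a, 'k) bracket_algebra \<Rightarrow> 'a set \<Rightarrow> bool" where
  "lie_ideal L I \<longleftrightarrow> linear_subspace L I \<and>
     (\<forall>x\<in>carrier L. \<forall>y\<in>I. bracket L x y \<in> I \<and> bracket L y x \<in> I)"

definition ideal_generated :: "('a, 'k) bracket_algebra \<Rightarrow> 'a set \<Rightarrow> 'a set" where
  "ideal_generated L S = \<Inter>{I. lie_ideal L I \<and> S \<subseteq> I}"

text \<open>In the following, \<open>G k\<close> is the component of degree \<open>k\<close> of a \<open>\<int>\<close>-grading of \<open>L\<close>.\<close>

definition local_part :: "('a, 'k) bracket_algebra \<Rightarrow> (int \<Rightarrow> 'a set) \<Rightarrow> 'a set" where
  "local_part L G = {add L (add L x y) z | x y z. x \<in> G (- 1) \<and> y \<in> G 0 \<and> z \<in> G 1}"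

definition homogeneous_ideal ::
  "('a, 'k) bracket_algebra \<Rightarrow> (int \<Rightarrow> 'a set) \<Rightarrow> 'a set \<Rightarrow> bool" where
  "homogeneous_ideal L G I \<longleftrightarrow> lie_ideal L I \<and> I = linear_span L (\<Union>k. I \<inter> G k)"

text \<open>
  ``The maximal'' ideal is read as the greatest one with respect to inclusion, as opposed to
  an ideal that is merely not properly contained in another one.
\<close>

definition is_maximal_homogeneous_ideal ::
  "('a, 'k) bracket_algebra \<Rightarrow> (int \<Rightarrow> 'a set) \<Rightarrow> 'a set \<Rightarrow> bool" where
  "is_maximal_homogeneous_ideal L G J \<longleftrightarrow>
     homogeneous_ideal L G J \<and> J \<inter> local_part L G = {zero L} \<and>
     (\<forall>I. homogeneous_ideal L G I \<and> I \<inter> local_part L G = {zero L} \<longrightarrow> I \<subseteq> J)"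


section \<open>Lie superalgebras given by generators and relations\<close>

datatype (gens: 'g, scalars: 'k) lie_term =
    Gen 'g
  | Zero
  | Plus "('g, 'k) lie_term" "('g, 'k) lie_term"
  | Scale 'k "('g, 'k) lie_term"
  | Br "('g, 'k) lie_term" "('g, 'k) lie_term"

definition lie_terms :: "'g set \<Rightarrow> ('g, 'k) lie_term set" where
  "lie_terms X = {t. gens t \<subseteq> X}"

text \<open>
  Homogeneity with respect to an assignment \<open>w\<close> of weights to the generators. It is used with
  weights in \<open>\<int>/2\<close> (type \<open>bit\<close>) for the parity and with weights in \<open>\<int>\<close> for
  the \<open>\<int>\<close>-grading.
\<close>

inductive homogeneous :: "('g \<Rightarrow> 'w::comm_monoid_add) \<Rightarrow> 'w \<Rightarrow> ('g, 'k) lie_term \<Rightarrow> bool"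
  for w where
  Gen: "homogeneous w (w g) (Gen g)"
| Zero: "homogeneous w d Zero"
| Plus: "homogeneous w d x \<Longrightarrow> homogeneous w d y \<Longrightarrow> homogeneous w d (Plus x y)"
| Scale: "homogeneous w d x \<Longrightarrow> homogeneous w d (Scale c x)"
| Br: "homogeneous w d x \<Longrightarrow> homogeneous w d' y \<Longrightarrow> homogeneous w (d + d') (Br x y)"

definition koszul_sign :: "bit \<Rightarrow> bit \<Rightarrow> 'k::ring_1" where
  "koszul_sign p q = (if p = 1 \<and> q = 1 then - 1 else 1)"

text \<open>
  Equality of the elements denoted by two terms in the Lie superalgebra with generators \<open>X\<close>
  of parity \<open>par\<close> and defining relations \<open>l = r\<close> for \<open>(l, r) \<in> R\<close>: the least
  congruence containing the vector space axioms, bilinearity of the bracket, super-skewsymmetry,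
  the super Jacobi identity and \<open>R\<close>.
\<close>

inductive lie_eq ::
  "'g set \<Rightarrow> ('g \<Rightarrow> bit) \<Rightarrow> (('g, 'k::field) lie_term \<times> ('g, 'k) lie_term) set \<Rightarrow>
   ('g, 'k) lie_term \<Rightarrow> ('g, 'k) lie_term \<Rightarrow> bool"
  for X par R where
  refl: "x \<in> lie_terms X \<Longrightarrow> lie_eq X par R x x"
| sym: "lie_eq X par R x y \<Longrightarrow> lie_eq X par R y x"
| trans: "lie_eq X par R x y \<Longrightarrow> lie_eq X par R y z \<Longrightarrow> lie_eq X par R x z"
| cong_Plus: "lie_eq X par R x x' \<Longrightarrow> lie_eq X par R y y' \<Longrightarrow>
    lie_eq X par R (Plus x y) (Plus x' y')"
| cong_Scale: "lie_eq X par R x x' \<Longrightarrow> lie_eq X par R (Scale c x) (Scale c x')"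
| cong_Br: "lie_eq X par R x x' \<Longrightarrow> lie_eq X par R y y' \<Longrightarrow>
    lie_eq X par R (Br x y) (Br x' y')"
| add_assoc: "x \<in> lie_terms X \<Longrightarrow> y \<in> lie_terms X \<Longrightarrow> z \<in> lie_terms X \<Longrightarrow>
    lie_eq X par R (Plus (Plus x y) z) (Plus x (Plus y z))"
| add_commute: "x \<in> lie_terms X \<Longrightarrow> y \<in> lie_terms X \<Longrightarrow>
    lie_eq X par R (Plus x y) (Plus y x)"
| add_zero: "x \<in> lie_terms X \<Longrightarrow> lie_eq X par R (Plus x Zero) x"
| add_inverse: "x \<in> lie_terms X \<Longrightarrow> lie_eq X par R (Plus x (Scale (- 1) x)) Zero"
| scale_add: "x \<in> lie_terms X \<Longrightarrow> y \<in> lie_terms X \<Longrightarrow>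
    lie_eq X par R (Scale c (Plus x y)) (Plus (Scale c x) (Scale c y))"
| add_scale: "x \<in> lie_terms X \<Longrightarrow>
    lie_eq X par R (Scale (c + d) x) (Plus (Scale c x) (Scale d x))"
| scale_scale: "x \<in> lie_terms X \<Longrightarrow> lie_eq X par R (Scale c (Scale d x)) (Scale (c * d) x)"
| scale_one: "x \<in> lie_terms X \<Longrightarrow> lie_eq X par R (Scale 1 x) x"
| Br_add_left: "x \<in> lie_terms X \<Longrightarrow> y \<in> lie_terms X \<Longrightarrow> z \<in> lie_terms X \<Longrightarrow>
    lie_eq X par R (Br (Plus x y) z) (Plus (Br x z) (Br y z))"
| Br_add_right: "x \<in> lie_terms X \<Longrightarrow> y \<in> lie_terms X \<Longrightarrow> z \<in> lie_terms X \<Longrightarrow>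
    lie_eq X par R (Br x (Plus y z)) (Plus (Br x y) (Br x z))"
| Br_scale_left: "x \<in> lie_terms X \<Longrightarrow> y \<in> lie_terms X \<Longrightarrow>
    lie_eq X par R (Br (Scale c x) y) (Scale c (Br x y))"
| Br_scale_right: "x \<in> lie_terms X \<Longrightarrow> y \<in> lie_terms X \<Longrightarrow>
    lie_eq X par R (Br x (Scale c y)) (Scale c (Br x y))"
| skew: "x \<in> lie_terms X \<Longrightarrow> y \<in> lie_terms X \<Longrightarrow>
    homogeneous par p x \<Longrightarrow> homogeneous par q y \<Longrightarrow>
    lie_eq X par R (Br x y) (Scale (- koszul_sign p q) (Br y x))"
| jacobi: "x \<in> lie_terms X \<Longrightarrow> y \<in> lie_terms X \<Longrightarrow> z \<in> lie_terms X \<Longrightarrow>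
    homogeneous par p x \<Longrightarrow> homogeneous par q y \<Longrightarrow> homogeneous par r z \<Longrightarrow>
    lie_eq X par R (Br x (Br y z))
      (Plus (Br (Br x y) z) (Scale (koszul_sign p q) (Br y (Br x z))))"
| relation: "(x, y) \<in> R \<Longrightarrow> x \<in> lie_terms X \<Longrightarrow> y \<in> lie_terms X \<Longrightarrow> lie_eq X par R x y"

definition lie_class ::
  "'g set \<Rightarrow> ('g \<Rightarrow> bit) \<Rightarrow> (('g, 'k::field) lie_term \<times> ('g, 'k) lie_term) set \<Rightarrow>
   ('g, 'k) lie_term \<Rightarrow> ('g, 'k) lie_term set" where
  "lie_class X par R x = {(x, y). lie_eq X par R x y} `` {x}"

definition presented_lie_superalgebra ::
  "'g set \<Rightarrow> ('g \<Rightarrow> bit) \<Rightarrow> (('g, 'k::field) lie_term \<times> ('g, 'k) lie_term) set \<Rightarrow>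
   (('g, 'k) lie_term set, 'k) bracket_algebra" where
  "presented_lie_superalgebra X par R =
    \<lparr> carrier = lie_terms X // {(x, y). lie_eq X par R x y},
      zero = lie_class X par R Zero,
      add = (\<lambda>A B. \<Union>x\<in>A. \<Union>y\<in>B. lie_class X par R (Plus x y)),
      scale = (\<lambda>c A. \<Union>x\<in>A. lie_class X par R (Scale c x)),
      bracket = (\<lambda>A B. \<Union>x\<in>A. \<Union>y\<in>B. lie_class X par R (Br x y)) \<rparr>"

lemma lie_eq_imp_lie_terms:
  "lie_eq X par R x y \<Longrightarrow> x \<in> lie_terms X \<and> y \<in> lie_terms X"
  by (induction rule: lie_eq.induct) (auto simp: lie_terms_def)

lemma equiv_lie_eq: "equiv (lie_terms X) {(x, y). lie_eq X par R x y}"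
  by (rule equivI)
     (auto simp: refl_on_def sym_def trans_def
       intro: lie_eq.refl lie_eq.sym lie_eq.trans dest: lie_eq_imp_lie_terms)

lemma lie_class_eq_iff:
  assumes "x \<in> lie_terms X" "y \<in> lie_terms X"
  shows "lie_class X par R x = lie_class X par R y \<longleftrightarrow> lie_eq X par R x y"
  unfolding lie_class_def using eq_equiv_class_iff[OF equiv_lie_eq assms] by auto

text \<open>The operations on classes are induced by the term constructors.\<close>

lemma presented_operations:
  fixes R :: "(('g, 'k::field) lie_term \<times> ('g, 'k) lie_term) set"
    and par :: "'g \<Rightarrow> bit"
  assumes x: "x \<in> lie_terms X" and y: "y \<in> lie_terms X"
  defines "L \<equiv> presented_lie_superalgebra X par R" and "cls \<equiv> lie_class X par R"
  shows "cls x \<in> carrier L"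
    and "add L (cls x) (cls y) = cls (Plus x y)"
    and "scale L c (cls x) = cls (Scale c x)"
    and "bracket L (cls x) (cls y) = cls (Br x y)"
proof -
  have self: "z \<in> cls z" if "z \<in> lie_terms X" for z
    using that by (simp add: cls_def lie_class_def lie_eq.refl)
  have eq: "cls a = cls b" if "lie_eq X par R a b" for a b
    using that lie_eq_imp_lie_terms[OF that] by (simp add: cls_def lie_class_eq_iff)
  have mem: "lie_eq X par R a b" if "b \<in> cls a" for a b
    using that by (simp add: cls_def lie_class_def)
  show "cls x \<in> carrier L"
    using x by (auto simp: L_def cls_def lie_class_def presented_lie_superalgebra_def quotient_def)
  have const2: "(\<Union>a\<in>cls x. \<Union>b\<in>cls y. cls (g a b)) = cls (g x y)"
    if "\<And>a b. a \<in> cls x \<Longrightarrow> b \<in> cls y \<Longrightarrow> cls (g a b) = cls (g x y)" for g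
  proof (rule subset_antisym)
    show "(\<Union>a\<in>cls x. \<Union>b\<in>cls y. cls (g a b)) \<subseteq> cls (g x y)"
      by (intro UN_least) (simp add: that)
    show "cls (g x y) \<subseteq> (\<Union>a\<in>cls x. \<Union>b\<in>cls y. cls (g a b))"
      using self[OF x] self[OF y] by blast
  qed
  have "cls (Plus a b) = cls (Plus x y)" if "a \<in> cls x" "b \<in> cls y" for a b
    by (rule eq[OF lie_eq.sym[OF lie_eq.cong_Plus[OF mem[OF that(1)] mem[OF that(2)]]]])
  from const2[of Plus, OF this] show "add L (cls x) (cls y) = cls (Plus x y)"
    by (simp add: L_def presented_lie_superalgebra_def cls_def)
  have "cls (Br a b) = cls (Br x y)" if "a \<in> cls x" "b \<in> cls y" for a b
    by (rule eq[OF lie_eq.sym[OF lie_eq.cong_Br[OF mem[OF that(1)] mem[OF that(2)]]]])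
  from const2[of Br, OF this] show "bracket L (cls x) (cls y) = cls (Br x y)"
    by (simp add: L_def presented_lie_superalgebra_def cls_def)
  have "cls (Scale c a) = cls (Scale c x)" if "a \<in> cls x" for a
    by (rule eq[OF lie_eq.sym[OF lie_eq.cong_Scale[OF mem[OF that]]]])
  then have "(\<Union>a\<in>cls x. cls (Scale c a)) = cls (Scale c x)"
    using self[OF x] by blast
  then show "scale L c (cls x) = cls (Scale c x)"
    by (simp add: L_def presented_lie_superalgebra_def cls_def)
qed


section \<open>The Lie superalgebra \<open>W\<close> tilde of type \<open>A\<^bsub>n-1\<^esub>\<close>\<close>

definition B_mat :: "nat \<Rightarrow> nat \<Rightarrow> int" where
  "B_mat a b = (if a = b then (if a = 0 then 0 else 2)
            else if \<bar>int a - int b\<bar> = 1 then - 1 else 0)"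

datatype w_gen = E_gen nat | F_gen nat | F0_gen nat

definition e_index :: "nat \<Rightarrow> nat set" where "e_index n = {0..<n}"
definition f_index :: "nat \<Rightarrow> nat set" where "f_index n = {1..<n}"
definition f0_index :: "nat \<Rightarrow> nat set" where "f0_index n = {0..<n} - {1}"

definition w_gens :: "nat \<Rightarrow> w_gen set" where
  "w_gens n = E_gen ` e_index n \<union> F_gen ` f_index n \<union> F0_gen ` f0_index n"

fun w_parity :: "w_gen \<Rightarrow> bit" where
  "w_parity (E_gen a) = (if a = 0 then 1 else 0)"
| "w_parity (F_gen a) = 0"
| "w_parity (F0_gen a) = 1"

fun w_degree :: "w_gen \<Rightarrow> int" where
  "w_degree (E_gen a) = (if a = 0 then 1 else 0)"
| "w_degree (F_gen a) = 0"
| "w_degree (F0_gen a) = - 1"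

abbreviation gen_e :: "nat \<Rightarrow> (w_gen, 'k) lie_term" where "gen_e a \<equiv> Gen (E_gen a)"
abbreviation gen_f :: "nat \<Rightarrow> (w_gen, 'k) lie_term" where "gen_f a \<equiv> Gen (F_gen a)"
abbreviation gen_f0 :: "nat \<Rightarrow> (w_gen, 'k) lie_term" where "gen_f0 a \<equiv> Gen (F0_gen a)"

definition elem_h :: "nat \<Rightarrow> (w_gen, 'k) lie_term" where
  "elem_h a = (if a = 1 then Br (gen_e 1) (gen_f 1) else Br (gen_e 0) (gen_f0 a))"

inductive_set w_relations :: "nat \<Rightarrow> ((w_gen, 'k::field) lie_term \<times> (w_gen, 'k) lie_term) set"
  for n where
  R1_he: "a \<in> e_index n \<Longrightarrow> b \<in> e_index n \<Longrightarrow>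
    (Br (elem_h a) (gen_e b), Scale (of_int (B_mat a b)) (gen_e b)) \<in> w_relations n"
| R1_hf: "a \<in> e_index n \<Longrightarrow> b \<in> f_index n \<Longrightarrow>
    (Br (elem_h a) (gen_f b), Scale (- of_int (B_mat a b)) (gen_f b)) \<in> w_relations n"
| R1_ef: "a \<in> e_index n \<Longrightarrow> b \<in> f_index n \<Longrightarrow>
    (Br (gen_e a) (gen_f b), if a = b then elem_h b else Zero) \<in> w_relations n"
| R2_e: "a \<in> e_index n \<Longrightarrow> b \<in> e_index n \<Longrightarrow> a \<noteq> b \<Longrightarrow>
    ((Br (gen_e a) ^^ nat (1 - B_mat a b)) (gen_e b), Zero) \<in> w_relations n"
| R2_f: "a \<in> f_index n \<Longrightarrow> b \<in> f_index n \<Longrightarrow> a \<noteq> b \<Longrightarrow>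
    ((Br (gen_f a) ^^ nat (1 - B_mat a b)) (gen_f b), Zero) \<in> w_relations n"
| R3: "a \<in> f0_index n \<Longrightarrow> (Br (gen_e 0) (gen_f0 a), elem_h a) \<in> w_relations n"
| R4: "a \<in> e_index n \<Longrightarrow> b \<in> f0_index n \<Longrightarrow>
    (Br (elem_h a) (gen_f0 b), Scale (- of_int (B_mat a 0)) (gen_f0 b)) \<in> w_relations n"
| R5: "a \<in> f0_index n \<Longrightarrow> (Br (gen_e 1) (gen_f0 a), Zero) \<in> w_relations n"
| R6_e: "a \<in> e_index n \<Longrightarrow> b \<in> f0_index n \<Longrightarrow>
    (Br (gen_e a) (Br (gen_e a) (gen_f0 b)), Zero) \<in> w_relations n"
| R6_f: "a \<in> f_index n \<Longrightarrow> b \<in> f0_index n \<Longrightarrow>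
    (Br (gen_f a) (Br (gen_f a) (gen_f0 b)), Zero) \<in> w_relations n"
| R7: "i \<in> {2..<n} \<Longrightarrow> j \<in> {2..<n} \<Longrightarrow> a \<in> f0_index n \<Longrightarrow>
    (Br (gen_e i) (Br (gen_f j) (gen_f0 a)), if i = j then Scale (of_int (B_mat a j)) (gen_f0 j) else Zero)
      \<in> w_relations n"

text \<open>The side conditions in the rule \<open>relation\<close> of \<^const>\<open>lie_eq\<close> discard none of these.\<close>

lemma w_relations_lie_terms:
  assumes "n \<ge> 2" and "r \<in> w_relations n"
  shows "r \<in> lie_terms (w_gens n) \<times> lie_terms (w_gens n)"
proof -
  have ad: "gens ((Br x ^^ k) y) \<subseteq> gens x \<union> gens y" for x y :: "(w_gen, 'k) lie_term" and k
    by (induction k) auto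
  have h: "gens (elem_h a) \<subseteq> w_gens n" if "a \<in> e_index n" for a
    using that \<open>n \<ge> 2\<close>
    by (auto simp: elem_h_def w_gens_def e_index_def f_index_def f0_index_def)
  have e: "E_gen a \<in> w_gens n" if "a \<in> e_index n" for a using that by (auto simp: w_gens_def)
  have f: "F_gen a \<in> w_gens n" if "a \<in> f_index n" for a using that by (auto simp: w_gens_def)
  have f0: "F0_gen a \<in> w_gens n" if "a \<in> f0_index n" for a using that by (auto simp: w_gens_def)
  have index: "0 \<in> e_index n" "1 \<in> e_index n"
    "\<And>a. a \<in> f_index n \<Longrightarrow> a \<in> e_index n" "\<And>a. a \<in> f0_index n \<Longrightarrow> a \<in> e_index n"
    "\<And>a. a \<in> {2..<n} \<Longrightarrow> a \<in> e_index n \<and> a \<in> f_index n \<and> a \<in> f0_index n"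
    using \<open>n \<ge> 2\<close> by (auto simp: e_index_def f_index_def f0_index_def)
  obtain l r' where r: "r = (l, r')" by force
  have "(l, r') \<in> w_relations n" using assms(2) r by simp
  then have "gens l \<subseteq> w_gens n \<and> gens r' \<subseteq> w_gens n"
  proof cases
    case (R2_e a b)
    then show ?thesis
      using ad[of "nat (1 - B_mat a b)" "gen_e a" "gen_e b"] e[of a] e[of b] by auto
  next
    case (R2_f a b)
    then show ?thesis
      using ad[of "nat (1 - B_mat a b)" "gen_f a" "gen_f b"] f[of a] f[of b] by auto
  next
    case (R1_ef a b)
    then show ?thesis using h[of b] e[of a] f[of b] index by (cases "a = b") simp_all
  next
    case (R3 a)
    then show ?thesis using h[of a] e[of 0] f0[of a] index by simp
  next
    case (R1_he a b)
    then show ?thesis using h[of a] e[of b] index by simp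
  next
    case (R1_hf a b)
    then show ?thesis using h[of a] f[of b] index by simp
  next
    case (R4 a b)
    then show ?thesis using h[of a] f0[of b] index by simp
  next
    case (R5 a)
    then show ?thesis using e[of 1] f0[of a] index by simp
  next
    case (R6_e a b)
    then show ?thesis using e[of a] f0[of b] index by simp
  next
    case (R6_f a b)
    then show ?thesis using f[of a] f0[of b] index by simp
  next
    case (R7 i j a)
    then show ?thesis
      using e[of i] f[of j] f0[of a] f0[of j] index(5)[of i] index(5)[of j]
      by (cases "i = j") simp_all
  qed
  then show ?thesis by (simp add: r lie_terms_def)
qed

definition W :: "nat \<Rightarrow> ((w_gen, 'k::field) lie_term set, 'k) bracket_algebra" where
  "W n = presented_lie_superalgebra (w_gens n) w_parity (w_relations n)"

definition W_class :: "nat \<Rightarrow> (w_gen, 'k::field) lie_term \<Rightarrow> (w_gen, 'k) lie_term set" where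
  "W_class n = lie_class (w_gens n) w_parity (w_relations n)"

definition W_grade :: "nat \<Rightarrow> int \<Rightarrow> (w_gen, 'k::field) lie_term set set" where
  "W_grade n k = W_class n ` {t \<in> lie_terms (w_gens n). homogeneous w_degree k t}"

inductive_set J_generators :: "nat \<Rightarrow> (w_gen, 'k::field) lie_term set"
  for n where
  "a \<in> f0_index n \<Longrightarrow> b \<in> f0_index n \<Longrightarrow> Br (gen_f0 a) (gen_f0 b) \<in> J_generators n"
| "i \<in> {3..<n} \<Longrightarrow> j \<in> {3..<n} \<Longrightarrow> Br (gen_f0 i) (Br (gen_f 1) (gen_f0 j)) \<in> J_generators n"
| "i \<in> {3..<n} \<Longrightarrow>
     Br (Plus (gen_f0 2) (Scale (- 1) (gen_f0 0))) (Br (gen_f 1) (gen_f0 i)) \<in> J_generators n"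

end

theory Submission
  imports Defs "HOL-Library.Multiset" "HOL-Library.Product_Plus"
begin

text \<open>The algebra \<open>W\<close> modulo the three families of relations is the Lie superalgebra of vector fields on
  the Grassmann algebra in \<open>\<theta>\<^sub>0, \<dots>, \<theta>\<^bsub>n-1\<^esub>\<close>, where \<open>e\<^sub>0\<close> is \<open>\<partial>\<^sub>0\<close>, \<open>e\<^sub>a\<close> is
  \<open>\<theta>\<^bsub>a-1\<^esub> \<partial>\<^sub>a\<close>, \<open>f\<^sub>a\<close> is \<open>\<theta>\<^sub>a \<partial>\<^bsub>a-1\<^esub>\<close> and \<open>f\<^bsub>0a\<^esub>\<close> is \<open>\<theta>\<^sub>0 h\<^sub>a\<close>. Already in \<open>W\<close> the local part
  is spanned by elements \<open>d i\<close>, \<open>E i j\<close>, \<open>M i j k\<close> that multiply like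
  \<open>\<partial>\<^sub>i\<close>, \<open>\<theta>\<^sub>i \<partial>\<^sub>j\<close>, \<open>\<theta>\<^sub>i \<theta>\<^sub>j \<partial>\<^sub>k\<close>, and an ideal containing a nonzero combination of them contains
  \<open>e\<^sub>0\<close>. Under the relations, the negative part of the quotient is spanned by iterated brackets of the
  \<open>X a m = M a m m\<close>, which correspond to \<open>\<theta>\<^sub>a \<theta>\<^sub>m \<partial>\<^sub>m\<close>, applied to the \<open>E i j\<close>, and iterated brackets
  with the \<open>d i\<close> read off the coefficients of such a combination. Hence the quotient is transitive as
  soon as \<open>e\<^sub>0\<close> is nonzero in it, which the action on the Grassmann algebra shows; and
  transitivity forces every homogeneous ideal with trivial local part to vanish in the quotient.\<close>


section \<open>Chains of type \<open>A\<close> in Lie superalgebras\<close>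

text \<open>Neither W nor its quotient comes with a basis, so the formulas for the local part must
  be forced out of the relations. The device used again and again is an sl2 argument: a vector
  killed by \<open>E a b\<close> and by \<open>E b a\<close> is killed by
  \<open>E a a - E b b\<close>, hence is 0 if that operator multiplies it by a nonzero scalar. The
  generators provide only the combinations h_a of the diagonal fields and the products \<theta>_0
  h_a; the separate fields \<theta>_i \<partial>_i and \<theta>_0 \<theta>_j \<partial>_j are
  solutions of a linear system in which n - 1 has to be inverted, and other steps divide by 2 and by
  3. Linear independence is never proved in advance: brackets with the \<open>d i\<close> carry
  coefficients into combinations of the \<open>d j\<close>, which are weight vectors. The axioms of
  \<open>w_algebra\<close> leave out the three families because its formulas serve twice: in W, to
  see that the ideal of relations meets the local part trivially, and in the quotient, to compute
  with the negative part.\<close>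

locale lie_superalg = vector_space sc
  for sc :: "'k::field_char_0 \<Rightarrow> 'a::ab_group_add \<Rightarrow> 'a" (infixr "*s" 75) +
  fixes br :: "'a \<Rightarrow> 'a \<Rightarrow> 'a" and hom :: "bit \<Rightarrow> 'a set"
  assumes subspace_hom: "subspace (hom p)"
    and hom_br: "x \<in> hom p \<Longrightarrow> y \<in> hom q \<Longrightarrow> br x y \<in> hom (p + q)"
    and br_add_left: "br (x + y) z = br x z + br y z"
    and br_add_right: "br x (y + z) = br x y + br x z"
    and br_scale_left: "br (c *s x) y = c *s br x y"
    and br_scale_right: "br x (c *s y) = c *s br x y"
    and skew: "x \<in> hom p \<Longrightarrow> y \<in> hom q \<Longrightarrow> br x y = (- koszul_sign p q) *s br y x"
    and jacobi: "x \<in> hom p \<Longrightarrow> y \<in> hom q \<Longrightarrow> z \<in> hom r \<Longrightarrow>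
      br x (br y z) = br (br x y) z + koszul_sign p q *s br y (br x z)"
begin

lemma additive_br_left: "additive (\<lambda>x. br x y)" and additive_br_right: "additive (br x)"
  by (unfold_locales) (simp_all add: br_add_left br_add_right)

lemma br_simps [simp]:
  "br 0 x = 0" "br x 0 = 0" "br (- x) y = - br x y" "br x (- y) = - br x y"
  "br (x - y) z = br x z - br y z" "br x (y - z) = br x y - br x z"
  using additive.zero[OF additive_br_left] additive.zero[OF additive_br_right]
    additive.minus[OF additive_br_left] additive.minus[OF additive_br_right]
    additive.diff[OF additive_br_left] additive.diff[OF additive_br_right] by auto

lemmas br_lin [simp] = br_add_left br_add_right br_scale_left br_scale_right

lemma br_if: "br x (if c then y else z) = (if c then br x y else br x z)"
  by simp

lemma br_sum_left: "br (sum g A) y = (\<Sum>a\<in>A. br (g a) y)"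
  and br_sum_right: "br y (sum g A) = (\<Sum>a\<in>A. br y (g a))"
  using additive.sum[OF additive_br_left] additive.sum[OF additive_br_right] by auto

lemma hom_intros [simp, intro]:
  "0 \<in> hom p"
  "x \<in> hom p \<Longrightarrow> y \<in> hom p \<Longrightarrow> x + y \<in> hom p"
  "x \<in> hom p \<Longrightarrow> y \<in> hom p \<Longrightarrow> x - y \<in> hom p"
  "x \<in> hom p \<Longrightarrow> - x \<in> hom p"
  "x \<in> hom p \<Longrightarrow> c *s x \<in> hom p"
  by (simp_all add: subspace_hom subspace_0 subspace_add subspace_diff subspace_neg subspace_scale)

lemma hom_sum: "(\<And>a. a \<in> A \<Longrightarrow> g a \<in> hom p) \<Longrightarrow> sum g A \<in> hom p"
  by (rule subspace_sum[OF subspace_hom])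

lemma hom_br_simps [simp, intro]:
  "x \<in> hom 0 \<Longrightarrow> y \<in> hom q \<Longrightarrow> br x y \<in> hom q"
  "x \<in> hom 1 \<Longrightarrow> y \<in> hom 0 \<Longrightarrow> br x y \<in> hom 1"
  "x \<in> hom 1 \<Longrightarrow> y \<in> hom 1 \<Longrightarrow> br x y \<in> hom 0"
  using hom_br[of x 0 y q, unfolded add_0] hom_br[of x 1 y 0, unfolded add_0_right]
    hom_br[of x 1 y 1] by auto

lemma skew_even: "x \<in> hom 0 \<Longrightarrow> y \<in> hom q \<Longrightarrow> br x y = - br y x"
  and skew_even': "x \<in> hom p \<Longrightarrow> y \<in> hom 0 \<Longrightarrow> br x y = - br y x"
  and skew_odd: "x \<in> hom 1 \<Longrightarrow> y \<in> hom 1 \<Longrightarrow> br x y = br y x"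
  using skew[of x 0 y q] skew[of x p y 0] skew[of x 1 y 1] by (auto simp: koszul_sign_def)

lemma jacobi_even: "x \<in> hom 0 \<Longrightarrow> y \<in> hom q \<Longrightarrow> z \<in> hom r \<Longrightarrow>
    br x (br y z) = br (br x y) z + br y (br x z)"
  and jacobi_even': "x \<in> hom p \<Longrightarrow> y \<in> hom 0 \<Longrightarrow> z \<in> hom r \<Longrightarrow>
    br x (br y z) = br (br x y) z + br y (br x z)"
  and jacobi_odd: "x \<in> hom 1 \<Longrightarrow> y \<in> hom 1 \<Longrightarrow> z \<in> hom r \<Longrightarrow>
    br x (br y z) = br (br x y) z - br y (br x z)"
  using jacobi[of x 0 y q z r] jacobi[of x p y 0 z r] jacobi[of x 1 y 1 z r]
  by (auto simp: koszul_sign_def)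

lemma br_br_even: "x \<in> hom 0 \<Longrightarrow> y \<in> hom q \<Longrightarrow> z \<in> hom r \<Longrightarrow>
    br (br x y) z = br x (br y z) - br y (br x z)"
  and br_br_even': "x \<in> hom p \<Longrightarrow> y \<in> hom 0 \<Longrightarrow> z \<in> hom r \<Longrightarrow>
    br (br x y) z = br x (br y z) - br y (br x z)"
  and br_br_odd: "x \<in> hom 1 \<Longrightarrow> y \<in> hom 1 \<Longrightarrow> z \<in> hom r \<Longrightarrow>
    br (br x y) z = br x (br y z) + br y (br x z)"
  using jacobi_even[of x y q z r] jacobi_even'[of x p y z r] jacobi_odd[of x y z r] by auto

lemma br_self: "x \<in> hom 0 \<Longrightarrow> br x x = 0"
proof -
  assume "x \<in> hom 0"
  then have "br x x = - br x x" by (rule skew_even) fact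
  then have "(2::'k) *s br x x = 0"
    by (metis add.right_inverse one_add_one scale_left_distrib scale_one)
  then show ?thesis by simp
qed

lemma double_eq_0: "x + x = (0::'a) \<Longrightarrow> x = 0"
proof -
  assume "x + x = 0"
  then have "(2::'k) *s x = 0" by (metis one_add_one scale_left_distrib scale_one)
  then show ?thesis by simp
qed

lemma eq_minus_self: "x = - x \<Longrightarrow> x = (0::'a)"
  by (rule double_eq_0) (simp only: eq_neg_iff_add_eq_0)

end

section \<open>Root vectors of gl_n from its Chevalley generators\<close>

primrec chain :: "('a \<Rightarrow> 'a \<Rightarrow> 'a) \<Rightarrow> (nat \<Rightarrow> 'a::zero) \<Rightarrow> nat \<Rightarrow> nat \<Rightarrow> 'a" where
  "chain b e i 0 = 0"
| "chain b e i (Suc j) = (if i = j then e j else if i < j then b (chain b e i j) (e j) else 0)"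

text \<open>The Chevalley-Serre relations of gl_n, node k joining the indices k and k + 1. The
  diagonal elements \<open>N i\<close> are given rather than only the coroots
  \<open>N k - N (Suc k)\<close>, so that the bracket rule for matrix units has one shape for all
  indices. Nothing is said about independence.\<close>

locale gl_chain = lie_superalg sc br hom
  for sc :: "'k::field_char_0 \<Rightarrow> 'a::ab_group_add \<Rightarrow> 'a" (infixr "*s" 75) and br hom +
  fixes n :: nat and e f N :: "nat \<Rightarrow> 'a"
  assumes e_even: "Suc k < n \<Longrightarrow> e k \<in> hom 0"
    and f_even: "Suc k < n \<Longrightarrow> f k \<in> hom 0"
    and N_even: "i < n \<Longrightarrow> N i \<in> hom 0"
    and N_N: "i < n \<Longrightarrow> j < n \<Longrightarrow> br (N i) (N j) = 0"
    and N_e: "i < n \<Longrightarrow> Suc k < n \<Longrightarrow>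
      br (N i) (e k) = (if i = k then e k else if i = Suc k then - e k else 0)"
    and N_f: "i < n \<Longrightarrow> Suc k < n \<Longrightarrow>
      br (N i) (f k) = (if i = k then - f k else if i = Suc k then f k else 0)"
    and e_f: "Suc k < n \<Longrightarrow> Suc l < n \<Longrightarrow>
      br (e k) (f l) = (if k = l then N k - N (Suc k) else 0)"
    and e_e: "Suc k < n \<Longrightarrow> Suc l < n \<Longrightarrow> k \<noteq> Suc l \<Longrightarrow> l \<noteq> Suc k \<Longrightarrow> br (e k) (e l) = 0"
    and f_f: "Suc k < n \<Longrightarrow> Suc l < n \<Longrightarrow> k \<noteq> Suc l \<Longrightarrow> l \<noteq> Suc k \<Longrightarrow> br (f k) (f l) = 0"
    and serre_e: "Suc (Suc k) < n \<Longrightarrow> br (e k) (br (e k) (e (Suc k))) = 0"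
      "Suc (Suc k) < n \<Longrightarrow> br (e (Suc k)) (br (e (Suc k)) (e k)) = 0"
    and serre_f: "Suc (Suc k) < n \<Longrightarrow> br (f k) (br (f k) (f (Suc k))) = 0"
      "Suc (Suc k) < n \<Longrightarrow> br (f (Suc k)) (br (f (Suc k)) (f k)) = 0"
begin

declare e_even [simp] f_even [simp] N_even [simp]

abbreviation "up \<equiv> chain br e"

lemma up_Suc: "up i (Suc i) = e i" "i < j \<Longrightarrow> up i (Suc j) = br (up i j) (e j)"
  by simp_all

lemma up_even: "i < j \<Longrightarrow> j < n \<Longrightarrow> up i j \<in> hom 0"
  by (induction j) (auto simp: less_Suc_eq)

lemma N_up: "l < n \<Longrightarrow> i < j \<Longrightarrow> j < n \<Longrightarrow>
    br (N l) (up i j) = (if l = i then up i j else 0) - (if l = j then up i j else 0)"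
proof (induction j)
  case (Suc j)
  show ?case
  proof (cases "i = j")
    case True
    then show ?thesis using Suc.prems N_e[of l j] by auto
  next
    case False
    then have "i < j" using Suc.prems by simp
    then have "br (N l) (up i (Suc j)) = br (br (N l) (up i j)) (e j) + br (up i j) (br (N l) (e j))"
      using Suc.prems jacobi_even[of "N l" "up i j" 0 "e j" 0] by (simp add: up_even)
    then show ?thesis using Suc \<open>i < j\<close> N_e[of l j] by auto
  qed
qed simp

lemma e_up_far: "i < j \<Longrightarrow> j < k \<Longrightarrow> Suc k < n \<Longrightarrow> br (e k) (up i j) = 0"
proof (induction j)
  case (Suc j)
  show ?case
  proof (cases "i = j")
    case True
    then show ?thesis using Suc.prems e_e[of k j] by simp
  next
    case False
    then have "i < j" "up i j \<in> hom 0" using Suc.prems up_even by auto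
    then show ?thesis
      using Suc e_e[of k j] jacobi_even[of "e k" "up i j" 0 "e j" 0] by simp
  qed
qed simp

text \<open>Induction on the last letter of the left-normed bracket of e_i, ..., e_(j-1). A letter
  away from the chain commutes with it, one next to an end prolongs it, and one that already occurs
  in it gives 0; the last case is where the Serre relations enter.\<close>

lemma e_up: "Suc k < n \<Longrightarrow> i < j \<Longrightarrow> j < n \<Longrightarrow> (k = j \<Longrightarrow> Suc j < n) \<Longrightarrow>
    br (e k) (up i j) = (if Suc k = i then up k j else 0) - (if k = j then up i (Suc j) else 0)"
proof (induction j arbitrary: k)
  case 0
  from \<open>i < 0\<close> show ?case by (rule less_zeroE)
next
  case (Suc j)
  show ?case
  proof (cases "i = j")
    case True
    consider "Suc k = j" | "k = Suc j" | "Suc k \<noteq> j" "k \<noteq> Suc j" by linarith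
    then show ?thesis
    proof cases
      case 1
      then have "up k (Suc j) = br (e k) (e j)" by (metis lessI up_Suc)
      then show ?thesis using 1 True by simp
    next
      case 2
      then show ?thesis using Suc.prems True skew_even[of "e (Suc j)" "e j" 0] by simp
    next
      case 3
      then show ?thesis using Suc.prems True e_e[of k j] br_self[of "e j"] by (cases "k = j") auto
    qed
  next
    case False
    then have ij: "i < j" "Suc j < n" "j < n" using Suc.prems by auto
    define u where "u = up i j"
    have ev [simp]: "u \<in> hom 0" "e j \<in> hom 0" "e k \<in> hom 0"
      using ij Suc.prems up_even by (auto simp: u_def)
    have U: "up i (Suc j) = br u (e j)" using ij by (simp add: u_def)
    obtain j' where j': "j = Suc j'" "i \<le> j'" using ij by (cases j) auto
    define v where "v = up i j'"
    have v: "u = (if i = j' then e j' else br v (e j'))" using j' by (simp add: u_def v_def)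
    have ev' [simp]: "e j' \<in> hom 0" "i \<noteq> j' \<Longrightarrow> v \<in> hom 0"
      using j' ij up_even by (auto simp: v_def)
    have far: "br (e j) v = 0" if "i \<noteq> j'"
      using e_up_far[of i j' j] that j' ij by (simp add: v_def)
    have J: "br (e k) (br u (e j)) = br (br (e k) u) (e j) + br u (br (e k) (e j))"
      by (rule jacobi_even[where q=0 and r=0]) simp_all
    consider "k = Suc j" | "k = j" | "k = j'" | "k < j'" | "k > Suc j"
      using j' by linarith
    then show ?thesis
    proof cases
      case 1
      then have "br (e k) (br u (e j)) = - br (br u (e j)) (e k)"
        using skew_even ev hom_br_simps(1) by blast
      then show ?thesis using 1 ij U by simp
    next
      case 2
      have "br (e j) (br (e j) (e j')) = 0" using serre_e(2)[of j'] j' ij by simp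
      then have "br (e j) (br (e j) u) = 0"
        using far jacobi_even[of "e j" v 0 "e j'" 0] jacobi_even[of "e j" v 0 "br (e j) (e j')" 0]
        by (auto simp: v)
      moreover have "br u (e j) = - br (e j) u" using ev skew_even by blast
      ultimately show ?thesis using 2 U ij by simp
    next
      case 3
      have ku: "br (e k) u = 0" using Suc.IH[of k] 3 j' ij by (auto simp: u_def)
      have s: "br (e k) (br (e k) (e j)) = 0" using serre_e(1)[of j'] j' ij 3 by simp
      have "br (e k) (br u (e j)) = 0"
      proof (cases "i = j'")
        case True
        then show ?thesis using s v 3 by simp
      next
        case False
        have vj: "br v (e j) = 0" using far False skew_even[of v "e j" 0] by simp
        \<comment> \<open>Expanding u as a bracket of v with \<open>e k\<close> and using the Serre
          relation returns minus the original bracket, and 2 is invertible.\<close>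
        let ?y = "br (e k) (br u (e j))"
        have "?y = br u (br (e k) (e j))" using J ku by simp
        also have "\<dots> = br v (br (e k) (br (e k) (e j))) - br (e k) (br v (br (e k) (e j)))"
          using False 3 by (simp add: v br_br_even[where q=0 and r=0])
        also have "br v (br (e k) (e j)) = br u (e j)"
          using False 3 vj jacobi_even[of v "e k" 0 "e j" 0] by (simp add: v)
        finally have "?y = - ?y" using s by simp
        then show ?thesis by (rule eq_minus_self)
      qed
      then show ?thesis using U 3 j' ij by simp
    next
      case 4
      have "br (e k) (e j) = 0" using e_e[of k j] j' 4 ij by auto
      moreover have "br (e k) u = (if Suc k = i then up k j else 0)"
        using Suc.IH[of k] 4 j' ij by (auto simp: u_def)
      ultimately have "br (e k) (up i (Suc j)) = (if Suc k = i then br (up k j) (e j) else 0)"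
        unfolding U J by simp
      then show ?thesis using 4 j' by (simp del: chain.simps add: up_Suc)
    next
      case 5
      then have "br (e k) (e j) = 0" "br (e k) u = 0"
        using e_e[of k j] e_up_far[of i j k] ij Suc.prems by (simp_all add: u_def)
      then have "br (e k) (up i (Suc j)) = 0" unfolding U J by simp
      then show ?thesis using 5 ij by (simp del: chain.simps)
    qed
  qed
qed

lemma f_e: "Suc k < n \<Longrightarrow> Suc l < n \<Longrightarrow>
    br (f k) (e l) = (if k = l then N (Suc k) - N k else 0)"
  using e_f[of l k] skew_even[of "f k" "e l" 0] by auto

lemma f_up: "Suc k < n \<Longrightarrow> i < j \<Longrightarrow> j < n \<Longrightarrow>
    br (f k) (up i j) =
      (if k = i then if Suc i = j then N j else up (Suc i) j else 0) -
      (if Suc k = j then if Suc i = j then N i else up i k else 0)"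
proof (induction j)
  case (Suc j)
  note fe = f_e[OF Suc.prems(1) Suc.prems(3)]
  show ?case
  proof (cases "i = j")
    case True
    then show ?thesis using Suc.prems fe by auto
  next
    case False
    then have ij: "i < j" "Suc j < n" "j < n" using Suc.prems by auto
    have ev [simp]: "up i j \<in> hom 0" "e j \<in> hom 0" "f k \<in> hom 0"
      using ij Suc.prems up_even by auto
    have J: "br (f k) (up i (Suc j)) = br (br (f k) (up i j)) (e j) + br (up i j) (br (f k) (e j))"
      using ij jacobi_even[of "f k" "up i j" 0 "e j" 0] by simp
    note IH = Suc.IH[OF Suc.prems(1) ij(1,3)]
    consider "k = j" | "k \<noteq> j" "Suc k = j" | "k \<noteq> j" "Suc k \<noteq> j" by linarith
    then show ?thesis
    proof cases
      case 1
      have "br (up i j) (N l) = - br (N l) (up i j)" if "l < n" for l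
        using that skew_even[of "up i j" "N l" 0] by simp
      then have "br (up i j) (br (f k) (e j)) = - br (N (Suc j)) (up i j) + br (N j) (up i j)"
        using fe 1 ij by simp
      also have "\<dots> = - up i j" using N_up[of "Suc j" i j] N_up[of j i j] ij by simp
      finally show ?thesis using J IH 1 ij by simp
    next
      case 2
      show ?thesis
      proof (cases "k = i")
        case True
        then show ?thesis using J IH 2 ij fe N_e[of j j] N_e[of i j] by simp
      next
        case False
        then have "br (up i k) (e j) = 0"
          using 2 e_up_far[of i k j] ij up_even[of i k] skew_even[of "up i k" "e j" 0] by simp
        then show ?thesis using J IH 2 ij fe False by simp
      qed
    next
      case 3
      then show ?thesis using J IH ij fe by (cases "k = i") simp_all
    qed
  qed
qed simp

text \<open>The Chevalley involution. Facts about raising chains become facts about lowering chains,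
  so the lower triangle needs no second round of inductions.\<close>

lemma dual: "gl_chain sc br hom n (\<lambda>k. - f k) (\<lambda>k. - e k) (\<lambda>i. - N i)"
  by unfold_locales
    (use f_f e_e serre_e serre_f in \<open>auto simp: N_N N_e N_f f_e\<close>)

text \<open>The matrix unit \<theta>_i \<partial>_j. Below the diagonal it is minus a raising chain
  of the dual system, because the involution sends \<open>E j i\<close> to \<open>- E i j\<close>;
  this gives \<open>E (Suc i) i = f i\<close>.\<close>

definition E :: "nat \<Rightarrow> nat \<Rightarrow> 'a" where
  "E i j = (if i < j then up i j else if i = j then N i else - chain br (\<lambda>k. - f k) j i)"

lemma E_Suc: "E i (Suc i) = e i" "E (Suc i) i = f i" "E i i = N i"
  by (simp_all add: E_def)

lemma E_even [simp]: "i < n \<Longrightarrow> j < n \<Longrightarrow> E i j \<in> hom 0"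
  using up_even gl_chain.up_even[OF dual] by (auto simp: E_def)

lemma E_step: "i < j \<Longrightarrow> E i (Suc j) = br (E i j) (E j (Suc j))"
  "i < j \<Longrightarrow> E (Suc j) i = br (E (Suc j) j) (E j i)" if "Suc j < n"
proof -
  show "i < j \<Longrightarrow> E i (Suc j) = br (E i j) (E j (Suc j))" by (simp add: E_def)
  assume "i < j"
  moreover from this have "chain br (\<lambda>k. - f k) i j \<in> hom 0"
    using that gl_chain.up_even[OF dual, of i j] by simp
  ultimately show "E (Suc j) i = br (E (Suc j) j) (E j i)"
    using that skew_even[of "f j" "chain br (\<lambda>k. - f k) i j" 0] by (simp add: E_def)
qed

lemma N_E: "l < n \<Longrightarrow> i < n \<Longrightarrow> j < n \<Longrightarrow>
    br (N l) (E i j) = (if l = i then E i j else 0) - (if l = j then E i j else 0)"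
  using N_up[of l i j] gl_chain.N_up[OF dual, of l j i] N_N[of l i] by (auto simp: E_def)

lemma e_E: "Suc k < n \<Longrightarrow> i < n \<Longrightarrow> j < n \<Longrightarrow>
    br (e k) (E i j) = (if Suc k = i then E k j else 0) - (if k = j then E i (Suc k) else 0)"
proof -
  assume *: "Suc k < n" "i < n" "j < n"
  consider "i < j" | "i = j" | "j < i" by linarith
  then show ?thesis
  proof cases
    case 1
    then show ?thesis using * e_up[of k i j] by (auto simp: E_def)
  next
    case 2
    then show ?thesis
      using * N_e[of i k] skew_even[of "e k" "N i" 0] by (auto simp: E_def)
  next
    case 3
    then show ?thesis using * gl_chain.f_up[OF dual, of k j i] by (auto simp: E_def)
  qed
qed

lemma f_E: "Suc k < n \<Longrightarrow> i < n \<Longrightarrow> j < n \<Longrightarrow>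
    br (f k) (E i j) = (if k = i then E (Suc k) j else 0) - (if Suc k = j then E i k else 0)"
proof -
  assume *: "Suc k < n" "i < n" "j < n"
  consider "i < j" | "i = j" | "j < i" by linarith
  then show ?thesis
  proof cases
    case 1
    then show ?thesis using * f_up[of k i j] by (auto simp: E_def)
  next
    case 2
    then show ?thesis
      using * N_f[of i k] skew_even[of "f k" "N i" 0] by (auto simp: E_def)
  next
    case 3
    then show ?thesis using * gl_chain.e_up[OF dual, of k j i] by (auto simp: E_def)
  qed
qed

text \<open>By \<open>E_step\<close> every matrix unit is an iterated commutator of neighbouring
  ones. A formula for an action of the \<open>E i j\<close> therefore has to be checked only on the
  generators and shown to survive commutators; this is used for the adjoint action and for the
  action on the \<open>d k\<close>.\<close>

lemma E_induct [consumes 2, case_names diag e f up down]: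
  assumes "i < n" "j < n"
    and "\<And>i. i < n \<Longrightarrow> P i i"
    and "\<And>k. Suc k < n \<Longrightarrow> P k (Suc k)" "\<And>k. Suc k < n \<Longrightarrow> P (Suc k) k"
    and "\<And>i j. i < j \<Longrightarrow> Suc j < n \<Longrightarrow> P i j \<Longrightarrow> P j (Suc j) \<Longrightarrow> P i (Suc j)"
    and "\<And>i j. i < j \<Longrightarrow> Suc j < n \<Longrightarrow> P j i \<Longrightarrow> P (Suc j) j \<Longrightarrow> P (Suc j) i"
  shows "P i j"
proof -
  have "i < j \<Longrightarrow> j < n \<Longrightarrow> P i j" for i j
    by (induction j) (use assms(4,6) in \<open>auto simp: less_Suc_eq\<close>)
  moreover have "i < j \<Longrightarrow> j < n \<Longrightarrow> P j i" for i j
    by (induction j) (use assms(5,7) in \<open>auto simp: less_Suc_eq\<close>)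
  ultimately show ?thesis using assms(1-3) by (metis linorder_neqE_nat)
qed

lemma E_E: "i < n \<Longrightarrow> j < n \<Longrightarrow> k < n \<Longrightarrow> l < n \<Longrightarrow>
    br (E i j) (E k l) = (if j = k then E i l else 0) - (if i = l then E k j else 0)"
proof (induction i j arbitrary: k l rule: E_induct)
  case (diag i) then show ?case using N_E[of i k l] by (auto simp: E_Suc)
next
  case (e i) then show ?case using e_E[of i k l] by (auto simp: E_Suc)
next
  case (f i) then show ?case using f_E[of i k l] by (auto simp: E_Suc)
next
  case (up i j)
  have "br (E i (Suc j)) (E k l) = br (E i j) (br (E j (Suc j)) (E k l)) - br (E j (Suc j)) (br (E i j) (E k l))"
    using up(1,2,5,6) by (simp add: E_step(1) br_br_even[where q=0 and r=0])
  note eq = this[unfolded up(4)[OF up(5,6)] up(3)[OF up(5,6)]]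
  show ?case
    unfolding eq using up(1,2,5,6) up(3)[of j l] up(3)[of k "Suc j"] up(4)[of i l] up(4)[of k j]
    by (auto simp: br_if)
next
  case (down i j)
  have "br (E (Suc j) i) (E k l) = br (E (Suc j) j) (br (E j i) (E k l)) - br (E j i) (br (E (Suc j) j) (E k l))"
    using down(1,2,5,6) by (simp add: E_step(2) br_br_even[where q=0 and r=0])
  note eq = this[unfolded down(4)[OF down(5,6)] down(3)[OF down(5,6)]]
  show ?case
    unfolding eq using down(1,2,5,6) down(4)[of j l] down(4)[of k i] down(3)[of "Suc j" l] down(3)[of k j]
    by (auto simp: br_if)
qed

end


section \<open>The local part\<close>

text \<open>h_a as a function of the raw generators: the axioms of the next locale mention it, and
  \<open>ev_elem_h\<close> recognises it in evaluated terms. For a \<noteq> 1 the relation R3 is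
  built into it.\<close>

definition cartan :: "('a \<Rightarrow> 'a \<Rightarrow> 'a) \<Rightarrow> (nat \<Rightarrow> 'a) \<Rightarrow> (nat \<Rightarrow> 'a) \<Rightarrow> (nat \<Rightarrow> 'a) \<Rightarrow> nat \<Rightarrow> 'a" where
  "cartan b e f f0 a = (if a = 1 then b (e 1) (f 1) else b (e 0) (f0 a))"

locale w_algebra = lie_superalg sc br hom
  for sc :: "'k::field_char_0 \<Rightarrow> 'a::ab_group_add \<Rightarrow> 'a" (infixr "*s" 75) and br hom +
  fixes n :: nat and e f f0 :: "nat \<Rightarrow> 'a"
  assumes n_ge_2: "2 \<le> n"
    and e0_odd: "e 0 \<in> hom 1"
    and e_even: "a \<in> {1..<n} \<Longrightarrow> e a \<in> hom 0"
    and f_even: "a \<in> {1..<n} \<Longrightarrow> f a \<in> hom 0"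
    and f0_odd: "a < n \<Longrightarrow> a \<noteq> 1 \<Longrightarrow> f0 a \<in> hom 1"
    and R1_he: "a < n \<Longrightarrow> b < n \<Longrightarrow>
      br (cartan br e f f0 a) (e b) = of_int (B_mat a b) *s e b"
    and R1_hf: "a < n \<Longrightarrow> b \<in> {1..<n} \<Longrightarrow>
      br (cartan br e f f0 a) (f b) = (- of_int (B_mat a b)) *s f b"
    and R1_ef: "a < n \<Longrightarrow> b \<in> {1..<n} \<Longrightarrow>
      br (e a) (f b) = (if a = b then cartan br e f f0 b else 0)"
    and R2_e: "a < n \<Longrightarrow> b < n \<Longrightarrow> a \<noteq> b \<Longrightarrow> (br (e a) ^^ nat (1 - B_mat a b)) (e b) = 0"
    and R2_f: "a \<in> {1..<n} \<Longrightarrow> b \<in> {1..<n} \<Longrightarrow> a \<noteq> b \<Longrightarrow>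
      (br (f a) ^^ nat (1 - B_mat a b)) (f b) = 0"
    and R4: "a < n \<Longrightarrow> b < n \<Longrightarrow> b \<noteq> 1 \<Longrightarrow>
      br (cartan br e f f0 a) (f0 b) = (- of_int (B_mat a 0)) *s f0 b"
    and R5: "a < n \<Longrightarrow> a \<noteq> 1 \<Longrightarrow> br (e 1) (f0 a) = 0"
    and R6_e: "a < n \<Longrightarrow> b < n \<Longrightarrow> b \<noteq> 1 \<Longrightarrow> br (e a) (br (e a) (f0 b)) = 0"
    and R6_f: "a \<in> {1..<n} \<Longrightarrow> b < n \<Longrightarrow> b \<noteq> 1 \<Longrightarrow> br (f a) (br (f a) (f0 b)) = 0"
    and R7: "i \<in> {2..<n} \<Longrightarrow> j \<in> {2..<n} \<Longrightarrow> a < n \<Longrightarrow> a \<noteq> 1 \<Longrightarrow>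
      br (e i) (br (f j) (f0 a)) = (if i = j then of_int (B_mat a j) *s f0 j else 0)"
begin

section \<open>The diagonal elements and the matrix B\<close>

abbreviation "h \<equiv> cartan br e f f0"

lemma n_gt [simp]: "0 < n" "Suc 0 < n"
  using n_ge_2 by auto

lemma h_simps: "h 1 = br (e 1) (f 1)" "a \<noteq> 1 \<Longrightarrow> h a = br (e 0) (f0 a)"
  by (simp_all add: cartan_def)

lemma h_even: "a < n \<Longrightarrow> h a \<in> hom 0"
  using e0_odd f0_odd e_even[of 1] f_even[of 1] by (simp add: cartan_def)

text \<open>\<open>lin g\<close> is the solution \<open>x\<^sub>1, \<dots>, x\<^bsub>n-1\<^esub>\<close> of
  \<open>x\<^bsub>a-1\<^esub> - x\<^sub>a = g a\<close> for \<open>a \<ge> 2\<close> and \<open>\<Sum>\<^sub>j x\<^sub>j = g 0\<close>.\<close>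

definition lin :: "(nat \<Rightarrow> 'a) \<Rightarrow> nat \<Rightarrow> 'a" where
  "lin g j = inverse (of_nat (n - 1)) *s (g 0 + (\<Sum>k=2..<n. of_nat (n - k) *s g k)) - (\<Sum>k=2..j. g k)"

lemma lin_diff: "1 \<le> j \<Longrightarrow> lin g j - lin g (Suc j) = g (Suc j)"
  by (simp add: lin_def)

lemma sum_lin: "(\<Sum>j=1..<n. lin g j) = g 0"
proof -
  \<comment> \<open>\<open>g k\<close> enters the partial sums for j = k, ..., m, hence the factor;
    after summation over j it cancels the correction term in \<open>lin\<close>.\<close>
  have *: "(\<Sum>j=1..<Suc m. \<Sum>k=2..j. g k) = (\<Sum>k=2..<Suc m. of_nat (Suc m - k) *s g k)" for m
  proof (induction m)
    case (Suc m)
    have "(\<Sum>k=2..<Suc (Suc m). of_nat (Suc (Suc m) - k) *s g k) =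
        (\<Sum>k=2..<Suc (Suc m). of_nat (Suc m - k) *s g k + g k)"
    proof (rule sum.cong[OF HOL.refl])
      fix k assume "k \<in> {2..<Suc (Suc m)}"
      then have "Suc (Suc m) - k = Suc (Suc m - k)" by (auto simp: Suc_diff_le)
      then show "of_nat (Suc (Suc m) - k) *s g k = of_nat (Suc m - k) *s g k + g k"
        by (simp only: of_nat_Suc scale_left_distrib scale_one add.commute)
    qed
    also have "\<dots> = (\<Sum>k=2..<Suc m. of_nat (Suc m - k) *s g k) + (\<Sum>k=2..Suc m. g k)"
      by (simp add: sum.distrib atLeastLessThanSuc_atLeastAtMost)
    finally show ?case using Suc by simp
  qed simp
  obtain m where m: "n = Suc m" "m \<noteq> 0" using n_ge_2 by (cases n) auto
  define X where "X = (\<Sum>k=2..<n. of_nat (n - k) *s g k)"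
  have "(\<Sum>j=1..<n. inverse (of_nat (n - 1)) *s (g 0 + X)) = g 0 + X"
    using m unfolding sum_constant_scale by simp
  then show ?thesis
    unfolding lin_def sum_subtractf X_def[symmetric] using *[of m] m by (simp add: X_def)
qed

text \<open>Two solutions differ by a constant, and equal sums force the constant to be 0 because n
  - 1 is invertible in characteristic 0.\<close>

lemma lin_unique:
  assumes "\<And>j. 1 \<le> j \<Longrightarrow> Suc j < n \<Longrightarrow> x j - x (Suc j) = g (Suc j)"
    and "(\<Sum>j=1..<n. x j) = g 0" and "1 \<le> j" "j < n"
  shows "lin g j = x j"
proof -
  let ?y = "\<lambda>j. lin g j - x j"
  have const: "?y j = ?y 1" if "j \<ge> 1" "j < n" for j
    using that
  proof (induction j rule: nat_induct_at_least)
    case (Suc j)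
    have "lin g j - lin g (Suc j) = x j - x (Suc j)"
      using Suc.hyps Suc.prems assms(1)[of j] lin_diff[of j g] by simp
    then have "?y j = ?y (Suc j)" by (simp add: algebra_simps)
    then show ?case using Suc by simp
  qed simp
  then have "(\<Sum>j=1..<n. ?y j) = (\<Sum>j=1..<n. ?y 1)"
    by (intro sum.cong HOL.refl const) simp_all
  then have "of_nat (n - 1) *s ?y 1 = 0"
    using assms(2) sum_lin[of g] by (auto simp: sum_subtractf sum_constant_scale)
  then have "?y 1 = 0" using n_ge_2 by simp
  with const[OF assms(3,4)] show ?thesis by simp
qed

lemma lin_hom: "lin g j \<in> hom q" if "\<And>a. a < n \<Longrightarrow> a \<noteq> 1 \<Longrightarrow> g a \<in> hom q" "j < n"
  unfolding lin_def using that by (intro hom_intros(2-5) hom_sum) auto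

lemma br_lin_left: "br (lin g j) y = lin (\<lambda>a. br (g a) y) j"
  and br_lin_right: "br y (lin g j) = lin (\<lambda>a. br y (g a)) j"
  by (simp_all add: lin_def br_sum_left br_sum_right)

lemma lin_cong: "(\<And>a. a < n \<Longrightarrow> a \<noteq> 1 \<Longrightarrow> g a = g' a) \<Longrightarrow> j < n \<Longrightarrow> lin g j = lin g' j"
  unfolding lin_def by (intro arg_cong2[where f="(-)"] arg_cong[where f="(*s) _"]
    arg_cong2[where f="(+)"] sum.cong) auto

lemma lin_zero: "(\<And>a. a < n \<Longrightarrow> a \<noteq> 1 \<Longrightarrow> g a = 0) \<Longrightarrow> j < n \<Longrightarrow> lin g j = 0"
  using lin_cong[of g "\<lambda>_. 0" j] by (simp add: lin_def)

text \<open>Column b of B, solved for the diagonal elements: if the h_a act with the integers B_ab,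
  then the diagonal element with index j acts by the j-th weight of \<theta>_(b-1) \<partial>_b (of
  \<partial>_0 if b = 0). This is how B turns into weights throughout.\<close>

lemma lin_B:
  assumes "\<And>a. a < n \<Longrightarrow> a \<noteq> 1 \<Longrightarrow> g a = of_int (B_mat a b) *s w" "1 \<le> j" "j < n" "b < n"
  shows "lin g j = (if Suc j = b then w else 0) - (if j = b then w else 0)"
proof (rule lin_unique)
  show "((if Suc j = b then w else 0) - (if j = b then w else 0)) -
      ((if Suc (Suc j) = b then w else 0) - (if Suc j = b then w else 0)) = g (Suc j)"
    if "1 \<le> j" "Suc j < n" for j
  proof -
    have "(if Suc j = b then 2 *s w else 0) = (if Suc j = b then w + w else 0)"
      by (metis one_add_one scale_left_distrib scale_one)
    then show ?thesis using that assms(1)[of "Suc j"] by (auto simp: B_mat_def)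
  qed
  have "(\<Sum>j=1..<n. (if Suc j = b then w else 0) - (if j = b then w else 0)) =
    (\<Sum>j\<in>{1..<n}. if j = b - 1 then (if b \<noteq> 0 then w else 0) else 0) - (\<Sum>j\<in>{1..<n}. if j = b then w else 0)"
    unfolding sum_subtractf by (intro arg_cong2[where f="(-)"] sum.cong) auto
  also have "\<dots> = g 0"
    using assms(1)[of 0] assms(4) by (auto simp: B_mat_def)
  finally show "(\<Sum>j=1..<n. (if Suc j = b then w else 0) - (if j = b then w else 0)) = g 0" .
qed (use assms in auto)

text \<open>In the model h_0 is the sum of the \<theta>_i \<partial>_i with i \<ge> 1, and h_a is
  \<theta>_(a-1) \<partial>_(a-1) - \<theta>_a \<partial>_a. The equations for h_0 and for the h_a
  with a \<ge> 2 involve positive indices only and are solved by \<open>lin\<close>; h_1 then fixes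
  \<open>N 0\<close>.\<close>

definition N :: "nat \<Rightarrow> 'a" where
  "N i = (if i = 0 then lin h 1 + h 1 else lin h i)"

lemma N_even: "i < n \<Longrightarrow> N i \<in> hom 0"
  unfolding N_def using lin_hom[of h 0] h_even by auto

lemma N_diff: "Suc k < n \<Longrightarrow> N k - N (Suc k) = h (Suc k)"
  using lin_diff[of k h] by (auto simp: N_def)

lemma N_act:
  assumes "\<And>a. a < n \<Longrightarrow> br (h a) y = of_int (B_mat a b) *s w" "i < n" "b < n"
  shows "br (N i) y = (if Suc i = b then w else 0) - (if i = b then w else 0)"
proof -
  have *: "lin (\<lambda>a. br (h a) y) j = (if Suc j = b then w else 0) - (if j = b then w else 0)"
    if "1 \<le> j" "j < n" for j
    using lin_B[of "\<lambda>a. br (h a) y" b w j] assms that by simp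
  have two: "2 *s w = w + w" by (metis one_add_one scale_left_distrib scale_one)
  show ?thesis
    using *[of i] *[of 1] assms(1)[of 1] assms(2,3) two
    by (auto simp: N_def br_lin_left B_mat_def)
qed

text \<open>\<open>h b\<close> is a bracket of two eigenvectors of \<open>ad (h a)\<close> with
  opposite eigenvalues: e_1 and f_1, or e_0 and f_0b.\<close>

lemma h_h: "a < n \<Longrightarrow> b < n \<Longrightarrow> br (h a) (h b) = 0"
proof (cases "b = 1")
  case True
  assume "a < n" "b < n"
  then show ?thesis
    unfolding True h_simps(1)
    using R1_he[of a 1] R1_hf[of a 1] h_even[of a] e_even[of 1] f_even[of 1]
      jacobi_even[of "h a" "e 1" 0 "f 1" 0] by simp
next
  case False
  assume "a < n" "b < n"
  then show ?thesis
    using False R1_he[of a 0] R4[of a b] h_even[of a] e0_odd f0_odd[of b]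
      jacobi_even[of "h a" "e 0" 1 "f0 b" 1] by (simp add: h_simps(2))
qed

lemma N_N: "i < n \<Longrightarrow> j < n \<Longrightarrow> br (N i) (N j) = 0"
proof -
  assume ij: "i < n" "j < n"
  have "br (N i) (h b) = 0" if "b < n" for b
    using N_act[of "h b" 0 0 i] h_h ij that by simp
  then show ?thesis
    using ij by (auto simp: N_def[of j] br_lin_right intro!: lin_zero)
qed

lemma serre_adjacent:
  "a < n \<Longrightarrow> b < n \<Longrightarrow> b = Suc a \<or> a = Suc b \<Longrightarrow> br (e a) (br (e a) (e b)) = 0"
  "a \<in> {1..<n} \<Longrightarrow> b \<in> {1..<n} \<Longrightarrow> b = Suc a \<or> a = Suc b \<Longrightarrow> br (f a) (br (f a) (f b)) = 0"
  using R2_e[of a b] R2_f[of a b] by (auto simp: B_mat_def numeral_2_eq_2)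

lemma serre_far:
  "a < n \<Longrightarrow> b < n \<Longrightarrow> a \<noteq> b \<Longrightarrow> b \<noteq> Suc a \<Longrightarrow> a \<noteq> Suc b \<Longrightarrow> br (e a) (e b) = 0"
  "a \<in> {1..<n} \<Longrightarrow> b \<in> {1..<n} \<Longrightarrow> a \<noteq> b \<Longrightarrow> b \<noteq> Suc a \<Longrightarrow> a \<noteq> Suc b \<Longrightarrow> br (f a) (f b) = 0"
proof -
  have "\<bar>int a - int b\<bar> \<noteq> 1" if "b \<noteq> Suc a" "a \<noteq> Suc b" using that by linarith
  then have *: "B_mat a b = 0" if "a \<noteq> b" "b \<noteq> Suc a" "a \<noteq> Suc b"
    using that by (simp add: B_mat_def)
  show "a < n \<Longrightarrow> b < n \<Longrightarrow> a \<noteq> b \<Longrightarrow> b \<noteq> Suc a \<Longrightarrow> a \<noteq> Suc b \<Longrightarrow> br (e a) (e b) = 0"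
    using R2_e[of a b] * by simp
  show "a \<in> {1..<n} \<Longrightarrow> b \<in> {1..<n} \<Longrightarrow> a \<noteq> b \<Longrightarrow> b \<noteq> Suc a \<Longrightarrow> a \<noteq> Suc b \<Longrightarrow> br (f a) (f b) = 0"
    using R2_f[of a b] * by simp
qed

text \<open>Node k + 1 of the diagram becomes the simple root between the indices k and k + 1. The n
  - 1 even nodes together with \<open>N\<close> present gl_n; the odd node 0 stays outside.\<close>

sublocale gl: gl_chain sc br hom n "\<lambda>k. e (Suc k)" "\<lambda>k. f (Suc k)" N
proof
  fix i k l assume *: "i < n" "Suc k < n"
  show "br (N i) (e (Suc k)) = (if i = k then e (Suc k) else if i = Suc k then - e (Suc k) else 0)"
    using N_act[of "e (Suc k)" "Suc k" "e (Suc k)" i] R1_he[of _ "Suc k"] * by simp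
  show "br (N i) (f (Suc k)) = (if i = k then - f (Suc k) else if i = Suc k then f (Suc k) else 0)"
    using N_act[of "f (Suc k)" "Suc k" "- f (Suc k)" i] R1_hf[of _ "Suc k"] * by simp
next
  fix k l assume *: "Suc k < n" "Suc l < n"
  show "br (e (Suc k)) (f (Suc l)) = (if k = l then N k - N (Suc k) else 0)"
    using * R1_ef[of "Suc k" "Suc l"] N_diff[of k] by auto
  assume "k \<noteq> Suc l" "l \<noteq> Suc k"
  with * show "br (e (Suc k)) (e (Suc l)) = 0"
    using serre_far(1)[of "Suc k" "Suc l"] br_self[OF e_even, of "Suc k"]
    by (cases "k = l") simp_all
  from * \<open>k \<noteq> Suc l\<close> \<open>l \<noteq> Suc k\<close> show "br (f (Suc k)) (f (Suc l)) = 0"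
    using serre_far(2)[of "Suc k" "Suc l"] br_self[OF f_even, of "Suc k"]
    by (cases "k = l") simp_all
next
  fix k assume *: "Suc (Suc k) < n"
  show "br (e (Suc k)) (br (e (Suc k)) (e (Suc (Suc k)))) = 0"
    by (rule serre_adjacent) (use * in simp_all)
  show "br (e (Suc (Suc k))) (br (e (Suc (Suc k))) (e (Suc k))) = 0"
    by (rule serre_adjacent) (use * in simp_all)
  show "br (f (Suc k)) (br (f (Suc k)) (f (Suc (Suc k)))) = 0"
    by (rule serre_adjacent) (use * in simp_all)
  show "br (f (Suc (Suc k))) (br (f (Suc (Suc k))) (f (Suc k))) = 0"
    by (rule serre_adjacent) (use * in simp_all)
next
  fix k assume *: "Suc k < n"
  show "e (Suc k) \<in> hom 0" by (rule e_even) (use * in simp)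
  show "f (Suc k) \<in> hom 0" by (rule f_even) (use * in simp)
next
  fix i j assume *: "i < n"
  show "N i \<in> hom 0" by (rule N_even) fact
  show "br (N i) (N j) = 0" if "j < n" by (rule N_N) fact+
qed

abbreviation "E \<equiv> gl.E"

lemmas E_Suc = gl.E_Suc and E_E = gl.E_E and E_even = gl.E_even

lemma E_comm: "i < n \<Longrightarrow> j < n \<Longrightarrow> k < n \<Longrightarrow> l < n \<Longrightarrow> x \<in> hom q \<Longrightarrow>
  br (E i j) (br (E k l) x) = br (E k l) (br (E i j) x) +
    ((if j = k then br (E i l) x else 0) - (if i = l then br (E k j) x else 0))"
  using jacobi_even[of "E i j" "E k l" 0 x q] by (simp add: E_E)

section \<open>Degree 1: the elements \<open>d i\<close>\<close>

primrec d :: "nat \<Rightarrow> 'a" where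
  "d 0 = e 0"
| "d (Suc i) = - br (e (Suc i)) (d i)"

lemma d_odd [simp]: "i < n \<Longrightarrow> d i \<in> hom 1"
  by (induction i) (simp_all add: e0_odd e_even)

lemma N_d: "l < n \<Longrightarrow> i < n \<Longrightarrow> br (N l) (d i) = (if l = i then - d i else 0)"
proof (induction i)
  case 0
  then show ?case using N_act[of "e 0" 0 "e 0" l] R1_he by simp
next
  case (Suc i)
  then have "br (N l) (d (Suc i)) = - (br (br (N l) (e (Suc i))) (d i) + br (e (Suc i)) (br (N l) (d i)))"
    using jacobi_even[of "N l" "e (Suc i)" 0 "d i" 1] N_even e_even by simp
  then show ?case using Suc gl.N_e[of l i] by auto
qed

text \<open>The sign in \<open>d\<close> fits the derivation \<partial>_i, since [\<theta>_i
  \<partial>_(i+1), \<partial>_i] = - \<partial>_(i+1). The argument repeats that of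
  \<open>e_up\<close> for a chain that starts with the odd e_0: a letter already used gives 0 by a
  Serre relation.\<close>

lemma e_d: "Suc k < n \<Longrightarrow> i < n \<Longrightarrow> br (e (Suc k)) (d i) = (if k = i then - d (Suc i) else 0)"
proof (induction i arbitrary: k rule: less_induct)
  case (less m)
  show ?case
  proof (cases m)
    case 0
    have "br (e (Suc k)) (e 0) = 0" if "k \<noteq> 0"
      using that serre_far(1)[of "Suc k" 0] less.prems by simp
    then show ?thesis using 0 by auto
  next
    case (Suc i)
    note IH = less.IH[unfolded Suc]
    have i: "Suc i < n" using less.prems Suc by simp
    have ev [simp]: "e (Suc k) \<in> hom 0" "e (Suc i) \<in> hom 0" "d i \<in> hom 1"
      using less.prems i e_even by auto
    have J: "br (e (Suc k)) (br (e (Suc i)) (d i)) =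
        br (br (e (Suc k)) (e (Suc i))) (d i) + br (e (Suc i)) (br (e (Suc k)) (d i))"
      by (rule jacobi_even[where q=0 and r=1]) simp_all
    consider "k = Suc i" | "k = i" | "i = Suc k" | "k \<noteq> i" "k \<noteq> Suc i" "i \<noteq> Suc k" by linarith
    then have "br (e (Suc k)) (d (Suc i)) = (if k = Suc i then - d (Suc (Suc i)) else 0)"
    proof cases
      case 2
      have "br (e (Suc i)) (br (e (Suc i)) (d i)) = 0"
      proof (cases i)
        case 0
        then show ?thesis using serre_adjacent(1)[of 1 0] by simp
      next
        case (Suc i')
        let ?a = "e (Suc i)" and ?b = "e (Suc i')"
        have v: "br ?a (d i') = 0" using IH[of i' i] i Suc by simp
        have ev [simp]: "?b \<in> hom 0" "d i' \<in> hom 1" using i Suc e_even by auto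
        have "br ?a (br ?a (br ?b (d i'))) = br (br ?a (br ?a ?b)) (d i')"
          using v jacobi_even[of ?a ?b 0 "d i'" 1] jacobi_even[of ?a "br ?a ?b" 0 "d i'" 1] by simp
        also have "br ?a (br ?a ?b) = 0" using serre_adjacent(1)[of "Suc i" "Suc i'"] i Suc by simp
        finally show ?thesis using Suc by simp
      qed
      then show ?thesis using 2 by simp
    next
      case 3
      let ?a = "e (Suc k)" and ?b = "e (Suc i)" and ?y = "br (e (Suc k)) (br (e (Suc i)) (d i))"
      have ev' [simp]: "d k \<in> hom 1" using less.prems by simp
      have x: "br ?a (d k) = - d i" using 3 by simp
      have 0: "br ?a (d i) = 0" "br ?b (d k) = 0" using IH[of i k] IH[of k i] 3 i by auto
      have "br ?a (br ?a ?b) = 0" using serre_adjacent(1)[of "Suc k" "Suc i"] 3 i by simp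
      then have c: "br (br ?a ?b) ?a = 0" using skew_even[of "br ?a ?b" ?a 0] by simp
      have w: "br (br ?a ?b) (d k) = br ?b (d i)" using x 0 br_br_even[of ?a ?b 0 "d k" 1] by simp
      have "?y = br (br ?a ?b) (d i)" using J 0 by simp
      also have "\<dots> = - br (br ?a ?b) (br ?a (d k))" using x by simp
      also have "br (br ?a ?b) (br ?a (d k)) = ?y"
        using jacobi_even[of "br ?a ?b" ?a 0 "d k" 1] c w by simp
      finally have "?y = 0" by (rule eq_minus_self)
      then show ?thesis using 3 by simp
    next
      case 4
      then show ?thesis
        using J IH[of i k] less.prems i serre_far(1)[of "Suc k" "Suc i"] by simp
    qed simp
    then show ?thesis using Suc by simp
  qed
qed

lemma f_d: "Suc k < n \<Longrightarrow> i < n \<Longrightarrow> br (f (Suc k)) (d i) = (if Suc k = i then - d k else 0)"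
proof (induction i)
  case 0
  then show ?case
    using R1_ef[of 0 "Suc k"] f_even[of "Suc k"] e0_odd skew_even[of "f (Suc k)" "e 0" 1] by simp
next
  case (Suc i)
  have ev [simp]: "f (Suc k) \<in> hom 0" "e (Suc i) \<in> hom 0" "d i \<in> hom 1"
    using Suc.prems e_even f_even by auto
  have "br (f (Suc k)) (d (Suc i)) =
      - (br (br (f (Suc k)) (e (Suc i))) (d i) + br (e (Suc i)) (br (f (Suc k)) (d i)))"
    using jacobi_even[of "f (Suc k)" "e (Suc i)" 0 "d i" 1] by simp
  then show ?case
    using Suc gl.f_e[of k i] N_d[of i i] N_d[of "Suc i" i] e_d[of i k] by auto
qed

declare d.simps [simp del]

lemma E_d: "i < n \<Longrightarrow> j < n \<Longrightarrow> k < n \<Longrightarrow> br (E i j) (d k) = (if i = k then - d j else 0)"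
proof (induction i j arbitrary: k rule: gl.E_induct)
  case (diag i)
  then show ?case using N_d[of i k] by (simp add: E_Suc)
next
  case (e i)
  then show ?case using e_d[of i k] by (auto simp: E_Suc)
next
  case (f i)
  then show ?case using f_d[of i k] by (auto simp: E_Suc)
next
  case (up i j)
  then show ?case by (auto simp: gl.E_step br_br_even[where q=0 and r=1])
next
  case (down i j)
  then show ?case by (auto simp: gl.E_step br_br_even[where q=0 and r=1])
qed

text \<open>R2 contains [e_0, [e_0, e_1]] = 0 but not [e_0, e_0] = 0. The former says that d_0 and
  d_1 commute; applying E_10 turns it into [d_0, d_0] = 0, and the operators E_0j spread this to all
  pairs.\<close>

lemma d_d: "i < n \<Longrightarrow> j < n \<Longrightarrow> br (d i) (d j) = 0"
proof -
  have 01: "br (d 0) (d (Suc 0)) = 0"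
    using serre_adjacent(1)[of 0 1] e0_odd e_even[of 1] skew_even[of "e (Suc 0)" "e 0" 1]
    by (simp add: d.simps)
  have "br (E 1 0) (br (d 0) (d (Suc 0))) = - br (d 0) (d 0)"
    using jacobi_even[of "E 1 0" "d 0" 1 "d (Suc 0)" 1] E_d[of 1 0 0] E_d[of 1 0 1]
    by simp
  then have 00: "br (d 0) (d 0) = 0" using 01 by simp
  have j0: "br (d j) (d 0) = 0" if "j < n" for j
  proof -
    have "br (E 0 j) (br (d 0) (d 0)) = - (br (d j) (d 0) + br (d 0) (d j))"
      using jacobi_even[of "E 0 j" "d 0" 1 "d 0" 1] E_d[of 0 j 0] that by simp
    then have "br (d j) (d 0) + br (d j) (d 0) = 0"
      using 00 skew_odd[of "d 0" "d j"] that by (simp add: eq_neg_iff_add_eq_0 neg_eq_iff_add_eq_0)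
    then show ?thesis by (rule double_eq_0)
  qed
  assume ij: "i < n" "j < n"
  show ?thesis
  proof (cases "i = 0")
    case True
    then show ?thesis using j0 ij skew_odd[of "d 0" "d j"] by simp
  next
    case False
    then show ?thesis
      using jacobi_even[of "E 0 j" "d i" 1 "d 0" 1] E_d[of 0 j 0] E_d[of 0 j i] j0 ij
      by simp
  qed
qed

section \<open>The fields \<theta>_0 \<theta>_j \<partial>_k with positive j and k\<close>

definition p :: "nat \<Rightarrow> 'a" where "p = lin f0"

lemma p_odd [simp]: "j < n \<Longrightarrow> p j \<in> hom 1"
  unfolding p_def by (rule lin_hom) (auto intro: f0_odd)

lemma p_diff: "0 < j \<Longrightarrow> p j - p (Suc j) = f0 (Suc j)"
  using lin_diff[of j f0] by (simp add: p_def)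

lemma sum_p: "(\<Sum>j=1..<n. p j) = f0 0"
  unfolding p_def by (rule sum_lin)

lemma N_f0: "i < n \<Longrightarrow> a < n \<Longrightarrow> a \<noteq> 1 \<Longrightarrow> br (N i) (f0 a) = (if i = 0 then f0 a else 0)"
  using N_act[of "f0 a" 0 "- f0 a" i] R4[of _ a] by simp

lemma N_p: "i < n \<Longrightarrow> 0 < j \<Longrightarrow> j < n \<Longrightarrow> br (N i) (p j) = (if i = 0 then p j else 0)"
  using lin_cong[of "\<lambda>a. br (N i) (f0 a)" f0 j] lin_zero[of "\<lambda>a. br (N i) (f0 a)" j] N_f0[of i]
  by (auto simp: p_def br_lin_right)

text \<open>R7 controls [e_i, f_0a] only after a further bracket. The vector 2 [e_i, f_0a] - B_ai
  [e_i, f_0i] is killed by e_i because of R6 and by f_i because of R7, hence by h_i, yet its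
  h_i-weight is 2; with f_i in place of e_i the weight is -2.\<close>

lemma e_f0:
  assumes i: "2 \<le> i" "i < n" and a: "a < n" "a \<noteq> 1"
  shows "br (e i) (f0 a) = of_int (B_mat a i) *s (inverse 2 *s br (e i) (f0 i))"
    and "br (f i) (f0 a) = of_int (B_mat a i) *s (inverse 2 *s br (f i) (f0 i))"
proof -
  let ?B = "of_int (B_mat a i) :: 'k"
  have ev [simp]: "e i \<in> hom 0" "f i \<in> hom 0" "f0 a \<in> hom 1" "f0 i \<in> hom 1" "h i \<in> hom 0"
    using i a by (auto simp: e_even f_even f0_odd h_even)
  have B: "B_mat i 0 = 0" "B_mat i i = 2" using i by (auto simp: B_mat_def)
  have hf: "br (h i) (f0 c) = 0" if "c < n" "c \<noteq> 1" for c
    using that i R4[of i c] B by simp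
  have ef: "br (e i) (f i) = h i" using R1_ef[of i i] i by simp
  have fe: "br (f i) (e i) = - h i" using ef skew_even[of "f i" "e i" 0] by simp
  have he: "br (h i) (e i) = 2 *s e i" using R1_he[of i i] i B by simp
  have hf': "br (h i) (f i) = (- 2) *s f i" using R1_hf[of i i] i B by simp
  have eff: "br (e i) (br (f i) (f0 c)) = of_int (B_mat c i) *s f0 i"
    and fef: "br (f i) (br (e i) (f0 c)) = of_int (B_mat c i) *s f0 i"
    and hef: "br (h i) (br (e i) (f0 c)) = 2 *s br (e i) (f0 c)"
    and hff: "br (h i) (br (f i) (f0 c)) = (- 2) *s br (f i) (f0 c)"
    if "c < n" "c \<noteq> 1" for c
  proof -
    have [simp]: "f0 c \<in> hom 1" using that f0_odd by simp
    show eff: "br (e i) (br (f i) (f0 c)) = of_int (B_mat c i) *s f0 i"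
      using R7[of i i c] i that by simp
    show "br (f i) (br (e i) (f0 c)) = of_int (B_mat c i) *s f0 i"
      using jacobi_even[of "f i" "e i" 0 "f0 c" 1] fe hf[OF that] eff by simp
    show "br (h i) (br (e i) (f0 c)) = 2 *s br (e i) (f0 c)"
      using jacobi_even[of "h i" "e i" 0 "f0 c" 1] he hf[OF that] by simp
    show "br (h i) (br (f i) (f0 c)) = (- 2) *s br (f i) (f0 c)"
      using jacobi_even[of "h i" "f i" 0 "f0 c" 1] hf' hf[OF that] by simp
  qed
  have kill: "y = 0" if "y \<in> hom 1" "br (e i) y = 0" "br (f i) y = 0" "br (h i) y = c *s y" "c \<noteq> 0" for y c
  proof -
    have "br (h i) y = 0" using that(1-3) ef br_br_even[of "e i" "f i" 0 y 1] by simp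
    then show ?thesis using that by simp
  qed
  have i1: "i \<noteq> 1" using i by simp
  have "2 *s br (e i) (f0 a) - ?B *s br (e i) (f0 i) = 0"
    by (rule kill[where c=2])
      (use R6_e i a i1 B fef hef in \<open>simp_all add: algebra_simps\<close>)
  then have "inverse 2 *s (2 *s br (e i) (f0 a)) = inverse 2 *s (?B *s br (e i) (f0 i))" by simp
  then show "br (e i) (f0 a) = ?B *s (inverse 2 *s br (e i) (f0 i))" by (simp add: mult.commute)
  have "2 *s br (f i) (f0 a) - ?B *s br (f i) (f0 i) = 0"
    by (rule kill[where c="-2"])
      (use R6_f i a i1 B eff hff in \<open>simp_all add: algebra_simps\<close>)
  then have "inverse 2 *s (2 *s br (f i) (f0 a)) = inverse 2 *s (?B *s br (f i) (f0 i))" by simp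
  then show "br (f i) (f0 a) = ?B *s (inverse 2 *s br (f i) (f0 i))" by (simp add: mult.commute)
qed

text \<open>With \<open>p k\<close> in the role of \<theta>_0 \<theta>_k \<partial>_k, this is
  \<theta>_0 \<theta>_j \<partial>_k.\<close>

definition q :: "nat \<Rightarrow> nat \<Rightarrow> 'a" where
  "q j k = (if j = k then p k else br (E j k) (p k))"

lemma q_odd [simp]: "j < n \<Longrightarrow> k < n \<Longrightarrow> q j k \<in> hom 1"
  by (simp add: q_def)

text \<open>The expected action of one root vector on the fields \<theta>_0 \<theta>_x \<partial>_x.
  The relations give it only for neighbouring j and k; stated as predicates, this rule and the next
  can be handed from root to root by induction on the distance.\<close>

definition E_p_rule :: "nat \<Rightarrow> nat \<Rightarrow> bool" where
  "E_p_rule j k \<longleftrightarrow> (\<forall>x. 0 < x \<longrightarrow> x < n \<longrightarrow>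
     br (E j k) (p x) = (if k = x then q j k else 0) - (if j = x then q j k else 0))"

definition E_q_rules :: "nat \<Rightarrow> nat \<Rightarrow> bool" where
  "E_q_rules j k \<longleftrightarrow> br (E k j) (q j k) = p k - p j \<and> br (E j k) (q j k) = 0"

lemma E_p_ruleD: "E_p_rule j k \<Longrightarrow> 0 < x \<Longrightarrow> x < n \<Longrightarrow>
    br (E j k) (p x) = (if k = x then q j k else 0) - (if j = x then q j k else 0)"
  by (simp add: E_p_rule_def)

lemma adjacent_rules:
  assumes "0 < j" "Suc j < n"
  shows "E_p_rule j (Suc j) \<and> E_q_rules j (Suc j) \<and> E_p_rule (Suc j) j \<and> E_q_rules (Suc j) j"
proof -
  let ?i = "Suc j"
  let ?w = "inverse 2 *s br (e ?i) (f0 ?i)" and ?v = "inverse 2 *s br (f ?i) (f0 ?i)"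
  have i: "2 \<le> ?i" "?i < n" using assms by auto
  have ev [simp]: "e ?i \<in> hom 0" "f ?i \<in> hom 0" using i by (auto simp: e_even f_even)
  have ep: "br (e ?i) (p x) = (if Suc x = ?i then ?w else 0) - (if x = ?i then ?w else 0)"
    and fp: "br (f ?i) (p x) = (if Suc x = ?i then ?v else 0) - (if x = ?i then ?v else 0)"
    and efp: "br (e ?i) (br (f ?i) (p x)) =
      (if Suc x = ?i then f0 ?i else 0) - (if x = ?i then f0 ?i else 0)"
    and eep: "br (e ?i) (br (e ?i) (p x)) = 0" and ffp: "br (f ?i) (br (f ?i) (p x)) = 0"
    if "0 < x" "x < n" for x
  proof -
    have x: "1 \<le> x" using that by simp
    show "br (e ?i) (p x) = (if Suc x = ?i then ?w else 0) - (if x = ?i then ?w else 0)"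
      unfolding p_def br_lin_right by (rule lin_B[OF _ x that(2) i(2)]) (rule e_f0(1)[OF i])
    show "br (f ?i) (p x) = (if Suc x = ?i then ?v else 0) - (if x = ?i then ?v else 0)"
      unfolding p_def br_lin_right by (rule lin_B[OF _ x that(2) i(2)]) (rule e_f0(2)[OF i])
    show "br (e ?i) (br (f ?i) (p x)) =
      (if Suc x = ?i then f0 ?i else 0) - (if x = ?i then f0 ?i else 0)"
      unfolding p_def br_lin_right by (rule lin_B[OF _ x that(2) i(2)]) (use R7[of ?i ?i] i in simp)
    show "br (e ?i) (br (e ?i) (p x)) = 0" "br (f ?i) (br (f ?i) (p x)) = 0"
      unfolding p_def br_lin_right using that i R6_e R6_f by (auto intro!: lin_zero)
  qed
  have hp: "br (f ?i) (br (e ?i) (p x)) = br (e ?i) (br (f ?i) (p x))" if "0 < x" "x < n" for x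
    using jacobi_even[of "f ?i" "e ?i" 0 "p x" 1] that gl.f_e[of j j] i N_p[of j x] N_p[of ?i x] assms
    by simp
  have d: "p j - p ?i = f0 ?i" using p_diff assms by simp
  define w v where "w = ?w" and "v = ?v"
  note ep = ep[folded w_def] and fp = fp[folded v_def]
  have q: "q j ?i = - w" "q ?i j = v"
    using ep[of ?i] fp[of j] assms by (simp_all add: q_def E_Suc)
  have "E_p_rule j ?i" "E_p_rule ?i j"
    using ep fp assms by (auto simp: E_p_rule_def q E_Suc)
  moreover have "br (f ?i) w = f0 ?i" "br (e ?i) w = 0" "br (e ?i) v = f0 ?i" "br (f ?i) v = 0"
    using ep[of j] fp[of j] efp[of j] hp[of j] eep[of j] ffp[of j] assms by simp_all
  then have "E_q_rules j ?i" "E_q_rules ?i j"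
    unfolding E_q_rules_def q E_Suc by (simp_all flip: d)
  ultimately show ?thesis by simp
qed

text \<open>Writing E_jk as the commutator of E_jl and E_lk, its brackets with \<open>p k\<close>,
  \<open>p j\<close> and \<open>p l\<close> are X, Y and - (X + Y), so everything hinges on X + Y =
  0. This vector is killed by E_jl and E_lj, while E_jj - E_ll fixes it.\<close>

lemma E_p_rule_step:
  assumes jkl: "0 < j" "j < n" "0 < k" "k < n" "0 < l" "l < n" "j \<noteq> k" "j \<noteq> l" "k \<noteq> l"
    and r: "E_p_rule j l" "E_p_rule l k" "E_p_rule l j" "E_q_rules j l" "E_q_rules l k"
  shows "E_p_rule j k \<and> br (E j k) (q j k) = 0"
proof -
  let ?a = "E j l" and ?b = "E l k" and ?c = "E l j"
  note [simp] = jkl jkl(7-9)[symmetric]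
  note rl = E_p_ruleD[OF r(1)] E_p_ruleD[OF r(2)] E_p_ruleD[OF r(3)]
  have qr: "br ?c (q j l) = p l - p j" "br ?a (q j l) = 0" "br ?b (q l k) = 0"
    using r(4,5) by (auto simp: E_q_rules_def)
  have ab: "br (E j k) x = br ?a (br ?b x) - br ?b (br ?a x)" if "x \<in> hom 1" for x
    using E_comm[of j l l k x 1] that by simp
  define X where "X = br ?a (q l k)"
  define Y where "Y = br ?b (q j l)"
  have X: "br (E j k) (p k) = X" using ab[of "p k"] rl by (simp add: X_def)
  have Y: "br (E j k) (p j) = Y" using ab[of "p j"] rl by (simp add: Y_def)
  have Z: "br (E j k) (p l) = - (X + Y)" using ab[of "p l"] rl by (simp add: X_def Y_def)
  have odd [simp]: "X \<in> hom 1" "Y \<in> hom 1" by (simp_all add: X_def Y_def)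
  have Np: "br (E i i) (p x) = 0" if "0 < i" "i < n" "0 < x" "x < n" for i x
    using that N_p[of i x] by (simp add: E_Suc)
  have Nq: "br (E l l) (q l k) = q l k" "br (E j j) (q l k) = 0"
    using E_comm[of l l l k "p k" 1] E_comm[of j j l k "p k" 1] Np by (simp_all add: q_def)
  have "br ?c X = q l k"
  proof -
    have "br ?c (q l k) = 0"
      using E_comm[of l j l k "p k" 1] rl(3)[of k] by (simp add: q_def)
    then show ?thesis using E_comm[of l j j l "q l k" 1] Nq by (simp add: X_def)
  qed
  moreover have "br ?c Y = - q l k"
    using E_comm[of l j l k "q j l" 1] qr rl(2) by (simp add: Y_def)
  ultimately have c: "br ?c (X + Y) = 0" by simp
  have aX: "br ?a X = 0"
    using E_comm[of j l j k "p k" 1] X rl(1)[of k] by simp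
  have "br ?a Y = - br ?a Y"
    using E_comm[of j l j k "p j" 1] Y rl(1)[of j] ab[of "q j l"] qr by (simp add: Y_def)
  then have aY: "br ?a Y = 0" by (rule eq_minus_self)
  have "br ?a (br ?c (X + Y)) = br ?c (br ?a (X + Y)) + (br (E j j) (X + Y) - br (E l l) (X + Y))"
    using E_comm[of j l l j "X + Y" 1] by (simp del: br_lin)
  moreover have "br ?a (X + Y) = 0" using aX aY by simp
  ultimately have "br (E j j) (X + Y) - br (E l l) (X + Y) = 0"
    using c by (simp del: br_lin)
  moreover have "br (E j j) X = X" "br (E l l) X = 0" "br (E j j) Y = Y" "br (E l l) Y = 0"
    unfolding X[symmetric] Y[symmetric]
    using E_comm[of j j j k "p k" 1] E_comm[of j j j k "p j" 1]
      E_comm[of l l j k "p k" 1] E_comm[of l l j k "p j" 1] Np by simp_all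
  ultimately have XY: "X + Y = 0" by simp
  have qX: "q j k = X" using X by (simp add: q_def)
  have rule: "E_p_rule j k"
    unfolding E_p_rule_def
  proof (intro allI impI)
    fix x assume x: "0 < x" "x < n"
    consider "x = k" | "x = j" | "x = l" | "x \<noteq> k" "x \<noteq> j" "x \<noteq> l" by blast
    then show "br (E j k) (p x) = (if k = x then q j k else 0) - (if j = x then q j k else 0)"
    proof cases
      case 2
      then show ?thesis using Y XY qX by (simp add: eq_neg_iff_add_eq_0 add.commute)
    next
      case 4
      then show ?thesis using ab[of "p x"] rl x by simp
    qed (use X Z XY qX in simp_all)
  qed
  have "br ?b X = br (E j k) (q l k)"
    using E_comm[of l k j k "p k" 1] X rl(2)[of k] by simp
  also have "\<dots> = - br ?b X" using ab[of "q l k"] qr by (simp add: X_def)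
  finally have "br ?b X = 0" by (rule eq_minus_self)
  then have "br (E j k) (q l k) = 0" using \<open>br ?b X = br (E j k) (q l k)\<close> by simp
  then have "br (E j k) X = 0" using E_comm[of j k j l "q l k" 1] by (simp add: X_def)
  with rule qX show ?thesis by simp
qed

lemma E_rules_step:
  assumes jkl: "0 < j" "j < n" "0 < k" "k < n" "0 < l" "l < n" "j \<noteq> k" "j \<noteq> l" "k \<noteq> l"
    and r: "E_p_rule j l" "E_q_rules j l" "E_p_rule l j" "E_q_rules l j"
      "E_p_rule l k" "E_q_rules l k" "E_p_rule k l" "E_q_rules k l"
  shows "E_p_rule j k \<and> E_q_rules j k"
proof -
  note [simp] = jkl jkl(7-9)[symmetric]
  have jk: "E_p_rule j k" "br (E j k) (q j k) = 0" and kj: "E_p_rule k j"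
    using E_p_rule_step[of j k l] E_p_rule_step[of k j l] jkl r by auto
  have qr: "br (E k l) (q l k) = p k - p l" "br (E j l) (q l j) = p j - p l"
    using r by (auto simp: E_q_rules_def)
  have q: "q j k = br (E j l) (q l k)"
    using E_comm[of j l l k "p k" 1] E_p_ruleD[OF r(1), of k] by (simp add: q_def)
  have "br (E k j) (q l k) = - br (E k j) (br (E l k) (p l))"
    using E_p_ruleD[OF r(5), of l] by simp
  also have "\<dots> = br (E l j) (p l)"
    using E_comm[of k j l k "p l" 1] E_p_ruleD[OF kj, of l] by simp
  also have "\<dots> = - q l j" using E_p_ruleD[OF r(3), of l] by simp
  finally have "br (E k j) (q l k) = - q l j" .
  then have "br (E k j) (q j k) = p k - p j"
    using E_comm[of k j j l "q l k" 1] q qr by simp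
  with jk show ?thesis by (simp add: E_q_rules_def)
qed

lemma E_rules:
  assumes "0 < j" "j < n" "0 < k" "k < n" "j \<noteq> k"
  shows "E_p_rule j k \<and> E_q_rules j k"
proof -
  have "0 < j \<Longrightarrow> j < k \<Longrightarrow> k < n \<Longrightarrow>
    (E_p_rule j k \<and> E_q_rules j k) \<and> (E_p_rule k j \<and> E_q_rules k j)" for j k
  proof (induction k)
    case (Suc k)
    show ?case
    proof (cases "j = k")
      case True
      then show ?thesis using adjacent_rules[of j] Suc.prems by simp
    next
      case False
      then have IH: "j < k" "0 < k" "k < n" "Suc k < n" "0 < j" "j < n"
        "E_p_rule j k" "E_q_rules j k" "E_p_rule k j" "E_q_rules k j"
        using Suc by auto
      have adj: "E_p_rule k (Suc k)" "E_q_rules k (Suc k)" "E_p_rule (Suc k) k" "E_q_rules (Suc k) k"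
        using adjacent_rules[of k] IH by auto
      show ?thesis
        using E_rules_step[of j "Suc k" k] E_rules_step[of "Suc k" j k] IH adj by auto
    qed
  qed simp
  then show ?thesis using assms by (metis linorder_neqE_nat)
qed

lemma E_p: "0 < j \<Longrightarrow> j < n \<Longrightarrow> 0 < k \<Longrightarrow> k < n \<Longrightarrow> 0 < x \<Longrightarrow> x < n \<Longrightarrow>
    br (E j k) (p x) = (if k = x then q j k else 0) - (if j = x then q j k else 0)"
  using E_rules[of j k] N_p[of j x] by (cases "j = k") (auto simp: E_p_rule_def E_Suc)

lemma E_q:
  assumes "0 < i" "i < n" "0 < l" "l < n" "0 < j" "j < n" "0 < k" "k < n"
  shows "br (E i l) (q j k) = (if l = j then q i k else 0) - (if i = k then q j l else 0)"
proof (cases "j = k")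
  case True
  then have "q j k = p k" by (simp add: q_def)
  then show ?thesis using True assms E_p[of i l k] by auto
next
  case False
  \<comment> \<open>\<open>q j k\<close> has two expressions, through \<open>p k\<close> and through
    \<open>p j\<close>; each case below that needs one takes the one whose bracket with E_il is
    already known.\<close>
  have q1: "q j k = br (E j k) (p k)" using False by (simp add: q_def)
  have q2: "q j k = - br (E j k) (p j)" using False E_p[of j k j] assms by simp
  note c1 = E_comm[of i l j k "p k" 1] and c2 = E_comm[of i l j k "p j" 1]
  consider "i = l" | "i = k" "l = j" | "i = j" "l = k"
    | "i \<noteq> l" "i = k" "l \<noteq> j" | "i \<noteq> l" "i \<noteq> k" "l \<noteq> k" | "i \<noteq> l" "i \<noteq> k" "l = k" "i \<noteq> j" by blast
  then show ?thesis
  proof cases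
    case 1
    then show ?thesis using c1 N_p[of l k] assms False by (auto simp: q1 E_Suc)
  next
    case 2
    then show ?thesis using E_rules[of j k] assms False by (simp add: E_q_rules_def q_def)
  next
    case 3
    then show ?thesis using E_rules[of j k] assms False by (simp add: E_q_rules_def)
  next
    case 4
    then show ?thesis unfolding q2 using c2 E_p[of i l j] E_p[of j l j] assms False by simp
  next
    case 5
    then show ?thesis unfolding q1 using c1 E_p[of i l k] E_p[of i k k] assms False by auto
  next
    case 6
    then show ?thesis unfolding q2 using c2 E_p[of i l j] assms False by simp
  qed
qed

lemma N0_q: "0 < j \<Longrightarrow> j < n \<Longrightarrow> 0 < k \<Longrightarrow> k < n \<Longrightarrow> br (E 0 0) (q j k) = q j k"
  using E_comm[of 0 0 j k "p k" 1] N_p[of 0 k] by (auto simp: q_def E_Suc)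

lemma d0_q: "0 < j \<Longrightarrow> j < n \<Longrightarrow> 0 < k \<Longrightarrow> k < n \<Longrightarrow> br (d 0) (q j k) = E j k"
proof -
  assume *: "0 < j" "j < n" "0 < k" "k < n"
  have "br (d 0) (p k) = lin (\<lambda>a. br (e 0) (f0 a)) k" by (simp add: p_def br_lin_right d.simps)
  also have "\<dots> = lin h k" by (rule lin_cong) (use * in \<open>simp_all add: h_simps\<close>)
  also have "\<dots> = E k k" using * by (simp add: E_Suc N_def)
  finally have p: "br (d 0) (p k) = E k k" .
  have "br (E j k) (d 0) = 0" using * E_d[of j k 0] by simp
  then have "br (d 0) (br (E j k) (p k)) = br (E j k) (br (d 0) (p k))"
    using * jacobi_even[of "E j k" "d 0" 1 "p k" 1] by simp
  then show ?thesis using p * E_E[of j k k k] by (auto simp: q_def)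
qed

text \<open>R5 covers only E_01. The vector here equals [E_0l, \<open>p l\<close>]; it is killed by
  E_1l and E_l1, although E_11 - E_ll fixes it.\<close>

lemma E0_p_aux:
  assumes l: "0 < l" "l < n" "l \<noteq> 1"
  shows "br (E 0 1) (q 1 l) = 0"
proof -
  have n1 [simp]: "1 < n" "l < n" using l by auto
  have e1p: "br (E 0 1) (p j) = 0" if "0 < j" "j < n" for j
    using that R5 by (auto simp: E_Suc p_def br_lin_right intro!: lin_zero)
  let ?s = "br (E 0 1) (q 1 l)"
  have s: "?s = br (E 0 l) (p l)"
    using E_comm[of 0 1 1 l "p l" 1] e1p[of l] l by (simp add: q_def)
  have "br (E 1 l) ?s = br (E 0 l) (q 1 l)"
    unfolding s using E_comm[of 1 l 0 l "p l" 1] E_p[of 1 l l] l by simp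
  also have "\<dots> = - br (E 1 l) ?s"
    using E_comm[of 0 1 1 l "q 1 l" 1] E_q[of 1 l 1 l] l
    by (simp add: eq_neg_iff_add_eq_0 add.commute)
  finally have a: "br (E 1 l) ?s = 0" by (rule eq_minus_self)
  have b: "br (E l 1) ?s = 0"
    using E_comm[of l 1 0 1 "q 1 l" 1] E_q[of l 1 1 l] e1p[of 1] e1p[of l] l by (simp add: q_def)
  have "br (E 1 1) ?s - br (E l l) ?s = 0"
    using E_comm[of 1 l l 1 ?s 1] a b l by simp
  moreover have "br (E 1 1) ?s = 0" "br (E l l) ?s = - ?s"
    using E_comm[of 1 1 0 1 "q 1 l" 1] E_comm[of l l 0 1 "q 1 l" 1] E_q[of 1 1 1 l] E_q[of l l 1 l] l
    by simp_all
  ultimately show ?thesis by simp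
qed

lemma E0_q:
  assumes l: "0 < l" "l < n" and jk: "0 < j" "j < n" "0 < k" "k < n"
  shows "br (E 0 l) (q j k) = 0"
proof -
  have e1p: "br (E 0 1) (p j) = 0" if "0 < j" "j < n" for j
    using that R5 by (auto simp: E_Suc p_def br_lin_right intro!: lin_zero)
  have E0p: "br (E 0 l) (p j) = 0" if l: "0 < l" "l < n" and "0 < j" "j < n" for l j
  proof (cases "l = 1")
    case False
    have "br (E 0 1) (br (E 1 l) (p j)) = 0"
      using that False E_p[of 1 l j] E0_p_aux[of l] by (auto simp del: One_nat_def)
    then show ?thesis using E_comm[of 0 1 1 l "p j" 1] e1p[of j] that False by simp
  qed (use e1p that in simp)
  show ?thesis
    using E_comm[of 0 l j k "p k" 1] E0p[of l k] E0p[of k k] assms by (auto simp: q_def)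
qed

section \<open>Removing \<theta>_0 with the operators \<open>E i 0\<close>\<close>

lemma low_comm: "0 < i \<Longrightarrow> i < n \<Longrightarrow> 0 < j \<Longrightarrow> j < n \<Longrightarrow> x \<in> hom c \<Longrightarrow>
    br (E i 0) (br (E j 0) x) = br (E j 0) (br (E i 0) x)"
  using E_comm[of i 0 j 0 x c] by simp

lemma E_low: "0 < a \<Longrightarrow> a < n \<Longrightarrow> 0 < b \<Longrightarrow> b < n \<Longrightarrow> 0 < i \<Longrightarrow> i < n \<Longrightarrow> x \<in> hom c \<Longrightarrow>
    br (E a b) (br (E i 0) x) = br (E i 0) (br (E a b) x) + (if b = i then br (E a 0) x else 0)"
  using E_comm[of a b i 0 x c] by simp

lemma E0_low: "0 < b \<Longrightarrow> b < n \<Longrightarrow> 0 < i \<Longrightarrow> i < n \<Longrightarrow> x \<in> hom c \<Longrightarrow>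
    br (E 0 b) (br (E i 0) x) =
      br (E i 0) (br (E 0 b) x) + ((if b = i then br (E 0 0) x else 0) - br (E i b) x)"
  using E_comm[of 0 b i 0 x c] by simp

lemma low_low_p: "0 < j \<Longrightarrow> j < n \<Longrightarrow> br (E 1 0) (br (E 1 0) (p j)) = 0"
  using R6_f[of 1] by (auto simp: E_Suc p_def br_lin_right intro!: lin_zero)

text \<open>The vector stands for \<theta>_1 \<theta>_1 \<partial>_k. R6 for f_1 makes E_10 kill it,
  E_01 kills it as well, and E_00 - E_11 multiplies it by -2.\<close>

lemma low_q_1:
  assumes k: "1 < k" "k < n"
  shows "br (E 1 0) (q 1 k) = 0"
proof -
  have [simp]: "0 < k" "k \<noteq> Suc 0" "Suc 0 \<noteq> k" "Suc 0 < n" using k by auto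
  note [simp] = k
  let ?x = "br (E 1 0) (q 1 k)"
  have "br (E 1 k) (br (E 1 0) (br (E 1 0) (p k))) = br (E 1 0) ?x"
    using E_low[of 1 k 1 "p k" 1] E_low[of 1 k 1 "br (E 1 0) (p k)" 1] E_p[of 1 k k] by simp
  then have xx: "br (E 1 0) ?x = 0" using low_low_p[of k] by simp
  have "br (E 0 1) ?x = 0"
    using E0_low[of 1 1 "q 1 k" 1] E0_q[of 1 1 k] N0_q[of 1 k] E_q[of 1 1 1 k] by simp
  then have "br (E 0 0) ?x - br (E 1 1) ?x = 0"
    using E0_low[of 1 1 ?x 1] xx by simp
  moreover have "br (E 0 0) ?x = 0"
    using E_comm[of 0 0 1 0 "q 1 k" 1] N0_q[of 1 k] by simp
  moreover have "br (E 1 1) ?x = ?x + ?x"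
    using E_low[of 1 1 1 "q 1 k" 1] E_q[of 1 1 1 k] by simp
  ultimately show ?thesis using double_eq_0[of ?x] by simp
qed

text \<open>Applying E_i1, and in the next lemmas E_j1, polarises \<open>low_q_1\<close>: the
  vanishing square of \<theta>_1 becomes skew-symmetry in two indices. Since each application moves
  an index 1, the cases with indices equal to 1 come as separate lemmas.\<close>

lemma low_q_2:
  assumes "1 < i" "i < n" "1 < k" "k < n"
  shows "br (E i 0) (q 1 k) + br (E 1 0) (q i k) = (if i = k then br (E 1 0) (q 1 1) else 0)"
proof -
  have "0 = br (E i 1) (br (E 1 0) (q 1 k))" using low_q_1 assms by simp
  also have "\<dots> = br (E 1 0) (br (E i 1) (q 1 k)) + br (E i 0) (q 1 k)"
    using assms E_low[of i 1 1 "q 1 k" 1] by simp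
  also have "br (E i 1) (q 1 k) = q i k - (if i = k then q 1 1 else 0)"
    using assms E_q[of i 1 1 k] by simp
  finally show ?thesis by (cases "i = k") (simp_all add: algebra_simps)
qed

lemma low_q_3:
  assumes "1 < i" "i < n" "1 < j" "j < n" "1 < k" "k < n"
  shows "br (E i 0) (q j k) + br (E j 0) (q i k) =
    (if j = k then br (E i 0) (q 1 1) + br (E 1 0) (q i 1) else 0) +
    (if i = k then br (E j 0) (q 1 1) + br (E 1 0) (q j 1) else 0)"
proof -
  have a: "br (E j 1) (br (E i 0) (q 1 k)) =
      br (E i 0) (q j k) - (if j = k then br (E i 0) (q 1 1) else 0)"
    using assms E_low[of j 1 i "q 1 k" 1] E_q[of j 1 1 k] by simp
  have b: "br (E j 1) (br (E 1 0) (q i k)) =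
      br (E j 0) (q i k) - (if j = k then br (E 1 0) (q i 1) else 0)"
    using assms E_low[of j 1 1 "q i k" 1] E_q[of j 1 i k] by simp
  have c: "br (E j 1) (br (E 1 0) (q 1 1)) = br (E 1 0) (q j 1) + br (E j 0) (q 1 1)"
    using assms E_low[of j 1 1 "q 1 1" 1] E_q[of j 1 1 1] by simp
  have "br (E j 1) (br (E i 0) (q 1 k) + br (E 1 0) (q i k)) =
      br (E j 1) (if i = k then br (E 1 0) (q 1 1) else 0)"
    using low_q_2[of i k] assms by simp
  then have "br (E i 0) (q j k) - (if j = k then br (E i 0) (q 1 1) else 0) +
      (br (E j 0) (q i k) - (if j = k then br (E 1 0) (q i 1) else 0)) =
      (if i = k then br (E 1 0) (q j 1) + br (E j 0) (q 1 1) else 0)"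
    unfolding br_add_right a b br_if c by simp
  then show ?thesis by (cases "i = k"; cases "j = k") (simp_all add: algebra_simps)
qed

lemma low_q_4:
  assumes "1 < i" "i < n"
  shows "br (E i 0) (q i i) = br (E i 0) (q 1 1) + br (E 1 0) (q i 1)"
proof -
  let ?l = "br (E i 0) (q i i)" and ?r = "br (E i 0) (q 1 1) + br (E 1 0) (q i 1)"
  have "?l + ?l = ?r + ?r" using low_q_3[of i i i] assms by simp
  then have "(?l - ?r) + (?l - ?r) = 0" by (simp add: algebra_simps)
  then have "?l - ?r = 0" by (rule double_eq_0)
  then show ?thesis by (simp only: right_minus_eq)
qed

lemma low_q_5:
  assumes "1 < i" "i < n" "1 < j" "j < n"
  shows "br (E i 0) (q j 1) + br (E j 0) (q i 1) = 0"
proof (cases "i = j")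
  case True
  let ?x = "br (E i 0) (q i 1)"
  have "br (E i 1) (br (E i 0) (q i i)) = br (E i 1) (br (E i 0) (q 1 1) + br (E 1 0) (q i 1))"
    using low_q_4 assms by simp
  moreover have "br (E i 1) (br (E i 0) (q i i)) = - ?x"
    using assms E_low[of i 1 i "q i i" 1] E_q[of i 1 i i] by simp
  moreover have "br (E i 1) (br (E i 0) (q 1 1)) = ?x"
    using assms E_low[of i 1 i "q 1 1" 1] E_q[of i 1 1 1] by simp
  moreover have "br (E i 1) (br (E 1 0) (q i 1)) = ?x"
    using assms E_low[of i 1 1 "q i 1" 1] E_q[of i 1 i 1] by simp
  \<comment> \<open>The polarised identity with both indices equal yields 3 x = 0, so here 3 is
    divided out.\<close>
  ultimately have "- ?x = ?x + ?x" by simp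
  then have x3: "?x + ?x + ?x = 0" by (metis add.commute add.right_inverse)
  have "(3::'k) *s ?x = ?x + ?x + ?x"
  proof -
    have "(3::'k) = 1 + 1 + 1" by simp
    then show ?thesis by (simp only: scale_left_distrib scale_one)
  qed
  then have "?x = 0" using x3 by simp
  then show ?thesis using True by simp
next
  case False
  have "br (E i 0) (q j j) + br (E j 0) (q i j) = br (E i 0) (q i i)"
    using low_q_3[of i j j] low_q_4[of i] assms False by simp
  then have "br (E j 1) (br (E i 0) (q j j) + br (E j 0) (q i j)) = br (E j 1) (br (E i 0) (q i i))"
    by simp
  moreover have "br (E j 1) (br (E i 0) (q j j)) = - br (E i 0) (q j 1)"
    using assms False E_low[of j 1 i "q j j" 1] E_q[of j 1 j j] by simp
  moreover have "br (E j 1) (br (E j 0) (q i j)) = - br (E j 0) (q i 1)"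
    using assms False E_low[of j 1 j "q i j" 1] E_q[of j 1 i j] by simp
  moreover have "br (E j 1) (br (E i 0) (q i i)) = 0"
    using assms False E_low[of j 1 i "q i i" 1] E_q[of j 1 i i] by simp
  ultimately have "- (br (E i 0) (q j 1) + br (E j 0) (q i 1)) = 0" by simp
  then show ?thesis by (simp only: neg_equal_0_iff_equal)
qed

text \<open>The field \<theta>_0 \<theta>_j \<partial>_0: in the bracket of \<theta>_j \<partial>_0
  with \<theta>_0 \<theta>_j \<partial>_j the term with \<theta>_j \<theta>_j vanishes, and the
  other one carries a minus sign.\<close>

definition z :: "nat \<Rightarrow> 'a" where "z j = - br (E j 0) (q j j)"

lemma z_odd [simp]: "j < n \<Longrightarrow> z j \<in> hom 1"
  by (simp add: z_def)

text \<open>Skew-symmetry of \<theta>_i \<theta>_j \<partial>_k in i and j, before that field is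
  available: [\<theta>_i \<partial>_0, \<theta>_0 \<theta>_j \<partial>_k] differs from it by
  \<theta>_0 \<theta>_j \<partial>_0 if i = k, which explains the right-hand side.\<close>

lemma low_q_skew:
  assumes "0 < i" "i < n" "0 < j" "j < n" "0 < k" "k < n"
  shows "br (E i 0) (q j k) + br (E j 0) (q i k) =
    - (if i = k then z j else 0) - (if j = k then z i else 0)"
proof -
  have gt: "1 < x" if "0 < x" "x \<noteq> 1" for x :: nat using that by linarith
  show ?thesis
  proof (cases "k = 1")
    case k: True
    show ?thesis
    proof (cases "i = 1"; cases "j = 1")
      assume "i = 1" "j = 1"
      then show ?thesis using k by (simp add: z_def)
    next
      assume "i = 1" "j \<noteq> 1"
      then show ?thesis using low_q_4[OF gt, of j] k assms by (simp add: z_def add.commute)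
    next
      assume "i \<noteq> 1" "j = 1"
      then show ?thesis using low_q_4[OF gt, of i] k assms by (simp add: z_def)
    next
      assume "i \<noteq> 1" "j \<noteq> 1"
      then show ?thesis using low_q_5[OF gt _ gt, of i j] k assms by simp
    qed
  next
    case k: False
    note k' = gt[OF assms(5) k]
    show ?thesis
    proof (cases "i = 1"; cases "j = 1")
      assume "i = 1" "j = 1"
      then show ?thesis using low_q_1[of k] k k' assms by simp
    next
      assume "i = 1" "j \<noteq> 1"
      then show ?thesis using low_q_2[OF gt _ k', of j] k assms by (simp add: z_def add.commute)
    next
      assume "i \<noteq> 1" "j = 1"
      then show ?thesis using low_q_2[OF gt _ k', of i] k assms by (simp add: z_def)
    next
      assume "i \<noteq> 1" "j \<noteq> 1"
      then show ?thesis
        using low_q_3[OF gt _ gt _ k', of i j] low_q_4[OF gt, of i] low_q_4[OF gt, of j] assms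
        by (simp add: z_def)
    qed
  qed
qed

lemma E_z:
  assumes "0 < a" "a < n" "0 < b" "b < n" "0 < j" "j < n"
  shows "br (E a b) (z j) = (if b = j then z a else 0)"
proof -
  have *: "br (E a b) (z j) = - (br (E j 0) ((if b = j then q a j else 0) - (if a = j then q j b else 0))
      + (if b = j then br (E a 0) (q j j) else 0))"
    using E_low[of a b j "q j j" 1] E_q[of a b j j] assms by (simp add: z_def)
  consider "a = j" "b = j" | "a = j" "b \<noteq> j" | "a \<noteq> j" "b = j" | "a \<noteq> j" "b \<noteq> j" by blast
  then show ?thesis
  proof cases
    case 1
    then have "br (E a b) (z j) = - br (E a 0) (q a a)" using * by simp
    then have "br (E a b) (z j) = z a" unfolding z_def[of a, symmetric] .
    then show ?thesis by (subst if_P[OF 1(2)])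
  next
    case 2
    have "br (E j 0) (q j b) + br (E j 0) (q j b) = 0" using low_q_skew[of j j b] 2 assms by simp
    then have "br (E j 0) (q j b) = 0" by (rule double_eq_0)
    then show ?thesis using * 2 by simp
  next
    case 3
    have skew: "br (E j 0) (q a j) + br (E a 0) (q j j) = - z a"
      using low_q_skew[of a j j] 3 assms by (simp add: add.commute)
    have "br (E a b) (z j) = - (br (E j 0) (q a j) + br (E a 0) (q j j))" using * 3 by simp
    also have "\<dots> = z a" unfolding skew by simp
    finally show ?thesis using 3 by simp
  next
    case 4 then show ?thesis using * by simp
  qed
qed

lemma N0_z: "0 < j \<Longrightarrow> j < n \<Longrightarrow> br (E 0 0) (z j) = 0"
  using E_comm[of 0 0 j 0 "q j j" 1] N0_q[of j j] by (simp add: z_def)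

lemma E0_z: "0 < a \<Longrightarrow> a < n \<Longrightarrow> 0 < j \<Longrightarrow> j < n \<Longrightarrow> br (E 0 a) (z j) = - q j a"
  using E0_low[of a j "q j j" 1] E0_q[of a j j] N0_q[of j j] E_q[of j a j j] by (auto simp: z_def)

lemma low_z_skew:
  assumes "0 < i" "i < n" "0 < j" "j < n"
  shows "br (E i 0) (z j) = - br (E j 0) (z i)"
proof -
  have 1: "br (E 1 0) (z 1) = 0" using low_low_p[of 1] by (simp add: z_def q_def)
  have 2: "br (E 1 0) (z i) + br (E i 0) (z 1) = 0" if "0 < i" "i < n" for i
    using E_low[of i 1 1 "z 1" 1] E_z[of i 1 1] 1 that by simp
  have "br (E j 0) (z i) + br (E i 0) (z j) = 0"
  proof (cases "i = 1")
    case True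
    then show ?thesis using 2[of j] assms by (simp add: add.commute)
  next
    case False
    have "br (E j 1) (br (E 1 0) (z i) + br (E i 0) (z 1)) = 0" using 2[of i] assms by simp
    then show ?thesis
      using E_low[of j 1 1 "z i" 1] E_low[of j 1 i "z 1" 1] E_z[of j 1 i] E_z[of j 1 1] assms False
      by simp
  qed
  then show ?thesis by (simp add: eq_neg_iff_add_eq_0 add.commute)
qed

text \<open>Alternating the two symmetries returns to the starting indices after six exchanges,
  three of which change the sign. Applied below because E_a0 and E_b0 commute while the field they
  act on is skew in b and c.\<close>

lemma sym_skew_zero:
  fixes S :: "nat \<Rightarrow> nat \<Rightarrow> nat \<Rightarrow> 'a"
  assumes sym: "\<And>a b c. P a \<Longrightarrow> P b \<Longrightarrow> P c \<Longrightarrow> S a b c = S b a c"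
    and skew: "\<And>a b c. P a \<Longrightarrow> P b \<Longrightarrow> P c \<Longrightarrow> S a b c = - S a c b"
    and P: "P a" "P b" "P c"
  shows "S a b c = 0"
proof -
  have "S a b c = - S a c b" by (rule skew[OF P])
  also have "\<dots> = - S c a b" using sym[of a c b] P by simp
  also have "\<dots> = S c b a" using skew[of c a b] P by simp
  also have "\<dots> = S b c a" using sym[of b c a] P by simp
  also have "\<dots> = - S b a c" by (rule skew) fact+
  also have "\<dots> = - S a b c" using sym[of a b c] P by simp
  finally show ?thesis by (rule eq_minus_self)
qed

lemma low_low_z:
  assumes "0 < a" "a < n" "0 < b" "b < n" "0 < c" "c < n"
  shows "br (E a 0) (br (E b 0) (z c)) = 0"
proof (rule sym_skew_zero[where P = "\<lambda>i. 0 < i \<and> i < n"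
      and S = "\<lambda>a b c. br (E a 0) (br (E b 0) (z c))"])
  fix a b c assume *: "0 < a \<and> a < n" "0 < b \<and> b < n" "0 < c \<and> c < n"
  show "br (E a 0) (br (E b 0) (z c)) = br (E b 0) (br (E a 0) (z c))"
    using low_comm[of a b "z c" 1] * by simp
  show "br (E a 0) (br (E b 0) (z c)) = - br (E a 0) (br (E c 0) (z b))"
    using low_z_skew[of b c] * by simp
qed (use assms in auto)

text \<open>The same argument as for \<open>low_low_z\<close>, after adding the correction terms
  that make the expression skew in b and c.\<close>

lemma low_low_q:
  assumes "0 < a" "a < n" "0 < b" "b < n" "0 < c" "c < n" "0 < k" "k < n"
  shows "br (E a 0) (br (E b 0) (q c k)) =
    - (if b = k then br (E a 0) (z c) else 0) - (if a = k then br (E b 0) (z c) else 0)"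
proof -
  let ?S = "\<lambda>a b c. br (E a 0) (br (E b 0) (q c k)) +
    ((if b = k then br (E a 0) (z c) else 0) + (if a = k then br (E b 0) (z c) else 0))"
  have "?S a b c = 0"
  proof (rule sym_skew_zero[where P = "\<lambda>i. 0 < i \<and> i < n" and S = ?S])
    fix a b c assume *: "0 < a \<and> a < n" "0 < b \<and> b < n" "0 < c \<and> c < n"
    show "?S a b c = ?S b a c"
      using low_comm[of a b "q c k" 1] * assms by (simp add: add.commute)
    have "br (E b 0) (q c k) =
        - (if b = k then z c else 0) - (if c = k then z b else 0) - br (E c 0) (q b k)"
      by (rule eq_diff_eq[THEN iffD2], rule low_q_skew) (use * assms in auto)
    then show "?S a b c = - ?S a c b"
      using low_z_skew[of b c] * by simp
  qed (use assms in auto)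
  then have "br (E a 0) (br (E b 0) (q c k)) =
      - ((if b = k then br (E a 0) (z c) else 0) + (if a = k then br (E b 0) (z c) else 0))"
    by (simp only: eq_neg_iff_add_eq_0)
  then show ?thesis by simp
qed

text \<open>\<open>M i j k\<close> corresponds to the vector field \<open>\<theta>\<^sub>i \<theta>\<^sub>j \<partial>\<^sub>k\<close>.\<close>

definition M :: "nat \<Rightarrow> nat \<Rightarrow> nat \<Rightarrow> 'a" where
  "M i j k =
    (if i = 0 then if j = 0 then 0 else if k = 0 then z j else q j k
     else if j = 0 then if k = 0 then - z i else - q i k
     else if k = 0 then br (E i 0) (z j) else br (E i 0) (q j k) + (if i = k then z j else 0))"

lemma M_simps:
  "0 < j \<Longrightarrow> M 0 j 0 = z j"
  "0 < j \<Longrightarrow> 0 < k \<Longrightarrow> M 0 j k = q j k"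
  "0 < i \<Longrightarrow> M i 0 0 = - z i"
  "0 < i \<Longrightarrow> 0 < k \<Longrightarrow> M i 0 k = - q i k"
  "0 < i \<Longrightarrow> 0 < j \<Longrightarrow> M i j 0 = br (E i 0) (z j)"
  "0 < i \<Longrightarrow> 0 < j \<Longrightarrow> 0 < k \<Longrightarrow> M i j k = br (E i 0) (q j k) + (if i = k then z j else 0)"
  by (simp_all add: M_def)

lemma M_odd [simp]: "i < n \<Longrightarrow> j < n \<Longrightarrow> k < n \<Longrightarrow> M i j k \<in> hom 1"
  by (simp add: M_def)

lemma M_skew: "i < n \<Longrightarrow> j < n \<Longrightarrow> k < n \<Longrightarrow> M i j k = - M j i k"
  using low_q_skew[of i j k, folded eq_diff_eq] low_z_skew[of i j] by (simp add: M_def)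

lemma M_self: "i < n \<Longrightarrow> k < n \<Longrightarrow> M i i k = 0"
  by (rule eq_minus_self) (rule M_skew)

lemma E_M_0: "a < n \<Longrightarrow> b < n \<Longrightarrow> 0 < j \<Longrightarrow> j < n \<Longrightarrow> k < n \<Longrightarrow>
  br (E a b) (M 0 j k) =
    (if b = 0 then M a j k else 0) + (if b = j then M 0 a k else 0) - (if a = k then M 0 j b else 0)"
  using E_q[of a b j k] E_z[of a b j] E0_q[of b j k] E0_z[of b j] N0_q[of j k] N0_z[of j]
  by (auto simp: M_def)

lemma E_M_pos: "a < n \<Longrightarrow> b < n \<Longrightarrow> 0 < i \<Longrightarrow> i < n \<Longrightarrow> 0 < j \<Longrightarrow> j < n \<Longrightarrow> k < n \<Longrightarrow>
  br (E a b) (M i j k) =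
    (if b = i then M a j k else 0) + (if b = j then M i a k else 0) - (if a = k then M i j b else 0)"
proof -
  assume *: "a < n" "b < n" "0 < i" "i < n" "0 < j" "j < n" "k < n"
  consider "a = 0" "b = 0" | "a = 0" "0 < b" | "0 < a" "b = 0" | "0 < a" "0 < b" by linarith
  then show ?thesis
  proof cases
    case 1
    have low: "br (E 0 0) (br (E i 0) x) = br (E i 0) (br (E 0 0) x) - br (E i 0) x" if "x \<in> hom 1" for x
      using E_comm[of 0 0 i 0 x 1] that * by simp
    show ?thesis
      using 1 * by (cases "k = 0") (simp_all add: M_simps low N0_z N0_q)
  next
    case 2
    then show ?thesis
      using * by (cases "k = 0") (simp_all add: M_simps E0_low[where c=1] E0_z E0_q N0_z N0_q E_z E_q)
  next
    case 3
    then show ?thesis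
      using * by (cases "k = 0") (simp_all add: M_simps low_low_z low_low_q)
  next
    case 4
    then show ?thesis
      using * by (cases "k = 0") (simp_all add: M_simps E_low[where c=1] E_z E_q)
  qed
qed

lemma E_M: "a < n \<Longrightarrow> b < n \<Longrightarrow> i < n \<Longrightarrow> j < n \<Longrightarrow> k < n \<Longrightarrow>
  br (E a b) (M i j k) =
    (if b = i then M a j k else 0) + (if b = j then M i a k else 0) - (if a = k then M i j b else 0)"
proof -
  assume *: "a < n" "b < n" "i < n" "j < n" "k < n"
  consider "i = 0" "j = 0" | "i = 0" "0 < j" | "0 < i" "j = 0" | "0 < i" "0 < j" by linarith
  then show ?thesis
  proof cases
    case 1
    then show ?thesis using * M_skew[of a 0 k] M_self[of 0] by auto
  next
    case 2
    then show ?thesis using E_M_0 * by simp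
  next
    case 3
    have "br (E a b) (M i 0 k) = - br (E a b) (M 0 i k)" using M_skew[of i 0 k] * by simp
    then show ?thesis
      using 3 * E_M_0[of a b i k] M_skew[of a i k] M_skew[of 0 a k] M_skew[of 0 i b] by simp
  next
    case 4
    then show ?thesis using E_M_pos * by simp
  qed
qed

text \<open>d_a is - [E_0a, d_0], so brackets with d_a reduce to those with d_0 and the known action
  of E_0a.\<close>

lemma d_step: "0 < a \<Longrightarrow> a < n \<Longrightarrow> x \<in> hom c \<Longrightarrow>
    br (d a) x = br (d 0) (br (E 0 a) x) - br (E 0 a) (br (d 0) x)"
  using br_br_even[of "E 0 a" "d 0" 1 x c] E_d[of 0 a 0] by (simp add: minus_equation_iff[of "br _ _"])

lemma d0_low: "0 < i \<Longrightarrow> i < n \<Longrightarrow> x \<in> hom c \<Longrightarrow> br (d 0) (br (E i 0) x) = br (E i 0) (br (d 0) x)"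
  using jacobi_even[of "E i 0" "d 0" 1 x c] E_d[of i 0 0] by simp

lemma d0_z: "0 < j \<Longrightarrow> j < n \<Longrightarrow> br (d 0) (z j) = E j 0"
  using d0_low[of j "q j j" 1] d0_q[of j j] E_E[of j 0 j j] by (simp add: z_def)

lemma d0_M: "i < n \<Longrightarrow> j < n \<Longrightarrow> k < n \<Longrightarrow>
    br (d 0) (M i j k) = (if i = 0 then E j k else 0) - (if j = 0 then E i k else 0)"
  using d0_z[of i] d0_z[of j] d0_q[of i k] d0_q[of j k] d0_low[of i "z j" 1] d0_low[of i "q j k" 1]
    E_E[of i 0 j k] E_E[of i 0 j 0]
  by (auto simp: M_def)

lemma d_M: "a < n \<Longrightarrow> i < n \<Longrightarrow> j < n \<Longrightarrow> k < n \<Longrightarrow>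
    br (d a) (M i j k) = (if i = a then E j k else 0) - (if j = a then E i k else 0)"
proof (cases "a = 0")
  case False
  assume *: "a < n" "i < n" "j < n" "k < n"
  have "br (d a) (M i j k) =
    br (d 0) (br (E 0 a) (M i j k)) - br (E 0 a) (br (d 0) (M i j k))"
    using d_step[of a "M i j k" 1] False * by simp
  also have "br (E 0 a) (br (d 0) (M i j k)) =
    (if i = 0 then br (E 0 a) (E j k) else 0) - (if j = 0 then br (E 0 a) (E i k) else 0)"
    using * by (simp add: d0_M)
  finally show ?thesis
    using * False by (simp add: E_M d0_M E_E)
qed (use d0_M in simp)

lemma f0_eq_M:
  "f0 0 = (\<Sum>j=1..<n. M 0 j j)"
  "2 \<le> a \<Longrightarrow> a < n \<Longrightarrow> f0 a = M 0 (a - 1) (a - 1) - M 0 a a"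
proof -
  have "(\<Sum>j=1..<n. M 0 j j) = (\<Sum>j=1..<n. p j)"
    by (rule sum.cong[OF HOL.refl]) (simp add: M_def q_def)
  then show "f0 0 = (\<Sum>j=1..<n. M 0 j j)" using sum_p by simp
  show "2 \<le> a \<Longrightarrow> a < n \<Longrightarrow> f0 a = M 0 (a - 1) (a - 1) - M 0 a a"
    using p_diff[of "a - 1"] by (cases a) (simp_all add: M_def q_def)
qed

end


section \<open>Brackets of two elements of degree \<open>- 1\<close>\<close>

context lie_superalg
begin

lemma ad_pow_hom: "x \<in> hom 0 \<Longrightarrow> u \<in> hom c \<Longrightarrow> (br x ^^ k) u \<in> hom c"
  by (induction k) auto

lemma ad_pow_leibniz:
  assumes x: "x \<in> hom 0" and u: "u \<in> hom a" and v: "v \<in> hom b"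
  shows "(br x ^^ r) (br u v) =
    (\<Sum>k\<le>r. of_nat (r choose k) *s br ((br x ^^ k) u) ((br x ^^ (r - k)) v))"
proof (induction r)
  case (Suc r)
  let ?t = "\<lambda>k l. br ((br x ^^ k) u) ((br x ^^ l) v)"
  have D: "br x (?t k l) = ?t (Suc k) l + ?t k (Suc l)" for k l
    using jacobi_even[OF x ad_pow_hom[OF x u] ad_pow_hom[OF x v]] by simp
  have "(br x ^^ Suc r) (br u v) = (\<Sum>k\<le>r. of_nat (r choose k) *s br x (?t k (r - k)))"
    using Suc by (simp add: br_sum_right)
  also have "\<dots> = (\<Sum>k\<le>r. of_nat (r choose k) *s ?t (Suc k) (r - k)) +
      (\<Sum>k\<le>r. of_nat (r choose k) *s ?t k (Suc r - k))"
    unfolding sum.distrib[symmetric]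
    by (rule sum.cong[OF HOL.refl]) (simp only: D scale_right_distrib, simp add: Suc_diff_le)
  also have "(\<Sum>k\<le>r. of_nat (r choose k) *s ?t k (Suc r - k)) =
      ?t 0 (Suc r) + (\<Sum>k\<le>r. of_nat (r choose Suc k) *s ?t (Suc k) (r - k))"
  proof -
    have "(\<Sum>k\<le>r. of_nat (r choose k) *s ?t k (Suc r - k)) =
        (\<Sum>k\<le>Suc r. of_nat (r choose k) *s ?t k (Suc r - k))" by simp
    also have "\<dots> = ?t 0 (Suc r) + (\<Sum>k\<le>r. of_nat (r choose Suc k) *s ?t (Suc k) (r - k))"
      by (subst sum.atMost_Suc_shift) simp
    finally show ?thesis .
  qed
  also have "(\<Sum>k\<le>r. of_nat (r choose k) *s ?t (Suc k) (r - k)) +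
      (?t 0 (Suc r) + (\<Sum>k\<le>r. of_nat (r choose Suc k) *s ?t (Suc k) (r - k))) =
      ?t 0 (Suc r) + (\<Sum>k\<le>r. of_nat (Suc r choose Suc k) *s ?t (Suc k) (r - k))"
    by (simp add: scale_left_distrib sum.distrib algebra_simps)
  also have "\<dots> = (\<Sum>k\<le>Suc r. of_nat (Suc r choose k) *s ?t k (Suc r - k))"
    by (subst sum.atMost_Suc_shift) simp
  finally show ?case .
qed simp

text \<open>Only one term of the Leibniz expansion of \<open>(ad x)\<^bsup>s+t\<^esup> [u, v]\<close> survives.\<close>

lemma br_strings_eq_0:
  assumes x: "x \<in> hom 0" and u: "u \<in> hom a" and v: "v \<in> hom b"
    and "(br x ^^ Suc s) u = 0" "(br x ^^ Suc t) v = 0" "br u v = 0"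
  shows "br ((br x ^^ s) u) ((br x ^^ t) v) = 0"
proof -
  have zero: "(br x ^^ k) w = 0" if "(br x ^^ l) w = 0" "l \<le> k" for k l w
  proof -
    have pow0: "(br x ^^ r) 0 = 0" for r by (induction r) auto
    have "(br x ^^ k) w = (br x ^^ (k - l)) ((br x ^^ l) w)"
      using that(2) by (metis comp_apply funpow_add le_add_diff_inverse2)
    then show ?thesis using that(1) pow0 by simp
  qed
  have "(br x ^^ (s + t)) (br u v) =
    (\<Sum>k\<le>s + t. of_nat (s + t choose k) *s br ((br x ^^ k) u) ((br x ^^ (s + t - k)) v))"
    by (rule ad_pow_leibniz[OF x u v])
  also have "\<dots> = (\<Sum>k\<le>s + t. if k = s then of_nat (s + t choose s) *s br ((br x ^^ s) u) ((br x ^^ t) v) else 0)"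
  proof (rule sum.cong[OF HOL.refl])
    fix k assume "k \<in> {..s + t}"
    consider "k = s" | "Suc s \<le> k" | "k < s" by linarith
    then show "of_nat (s + t choose k) *s br ((br x ^^ k) u) ((br x ^^ (s + t - k)) v) =
      (if k = s then of_nat (s + t choose s) *s br ((br x ^^ s) u) ((br x ^^ t) v) else 0)"
    proof cases
      case 2
      then show ?thesis using zero[OF assms(4) 2] by simp
    next
      case 3
      then have "Suc t \<le> s + t - k" by simp
      then show ?thesis using zero[OF assms(5)] 3 by simp
    qed simp
  qed
  also have "\<dots> = of_nat (s + t choose s) *s br ((br x ^^ s) u) ((br x ^^ t) v)" by simp
  finally have "of_nat (s + t choose s) *s br ((br x ^^ s) u) ((br x ^^ t) v) = 0"
    using zero[of 0 "br u v" "s + t"] assms(6) by simp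
  moreover have "of_nat (s + t choose s) \<noteq> (0::'k)" by simp
  ultimately show ?thesis by simp
qed

end

locale w_quotient = w_algebra sc br hom n e f f0
  for sc :: "'k::field_char_0 \<Rightarrow> 'a::ab_group_add \<Rightarrow> 'a" (infixr "*s" 75)
    and br hom n e f f0 +
  assumes J1: "a < n \<Longrightarrow> a \<noteq> 1 \<Longrightarrow> b < n \<Longrightarrow> b \<noteq> 1 \<Longrightarrow> br (f0 a) (f0 b) = 0"
    and J2: "i \<in> {3..<n} \<Longrightarrow> j \<in> {3..<n} \<Longrightarrow> br (f0 i) (br (f 1) (f0 j)) = 0"
    and J3: "i \<in> {3..<n} \<Longrightarrow> br (f0 2 - f0 0) (br (f 1) (f0 i)) = 0"
begin

section \<open>Brackets of fields sharing a factor \<theta>_i\<close>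

lemma br_p_p: "0 < j \<Longrightarrow> j < n \<Longrightarrow> 0 < k \<Longrightarrow> k < n \<Longrightarrow> br (p j) (p k) = 0"
  unfolding p_def br_lin_left br_lin_right by (intro lin_zero) (simp_all add: J1)

text \<open>Acting with E_jk on [\<open>p y\<close>, \<open>p x\<close>] = 0 replaces factors by
  \<plusminus> \<open>q j k\<close>. For a suitable y the wanted bracket appears twice if x is j or
  k, and once otherwise.\<close>

lemma br_q_p:
  assumes "0 < j" "j < n" "0 < k" "k < n" "0 < x" "x < n"
  shows "br (q j k) (p x) = 0"
proof (cases "j = k")
  case True
  then show ?thesis using br_p_p assms by (simp add: q_def)
next
  case False
  have *: "br (br (E j k) (p y)) (p x) + br (p y) (br (E j k) (p x)) = 0" if "0 < y" "y < n" for y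
    using jacobi_even[of "E j k" "p y" 1 "p x" 1] br_p_p[of y x] assms that by simp
  consider "x = k" | "x = j" | "x \<noteq> k" "x \<noteq> j" by blast
  then show ?thesis
  proof cases
    case 1
    have "br (q j k) (p x) + br (q j k) (p x) = 0"
      using *[of k] 1 False assms E_p[of j k k] skew_odd[of "p k" "q j k"] by simp
    then show ?thesis by (rule double_eq_0)
  next
    case 2
    have "br (q j k) (p x) = - br (q j k) (p x)"
      using *[of j] 2 False assms E_p[of j k j] skew_odd[of "p j" "q j k"] by simp
    then show ?thesis by (rule eq_minus_self)
  next
    case 3
    then show ?thesis using *[of k] False assms E_p[of j k k] E_p[of j k x] by simp
  qed
qed

lemma br_q_q:
  assumes "0 < j" "j < n" "0 < k" "k < n" "0 < l" "l < n" "0 < m" "m < n"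
  shows "br (q j k) (q l m) = 0"
proof (cases "l = m")
  case True
  then show ?thesis using br_q_p assms by (simp add: q_def)
next
  case False
  have "br (br (E l m) (q j k)) (p m) + br (q j k) (br (E l m) (p m)) = 0"
    using jacobi_even[of "E l m" "q j k" 1 "p m" 1] br_q_p[of j k m] assms by simp
  moreover have "br (br (E l m) (q j k)) (p m) = 0"
    using assms br_q_p by (simp add: E_q)
  ultimately show ?thesis using False by (simp add: q_def)
qed

lemma br_M_M_0:
  assumes "0 < a" "a < n" "0 < b" "b < n" "0 < c" "c < n" "0 < k" "k < n"
  shows "br (M 0 a b) (M 0 c k) = 0"
  using br_q_q[of a b c k] assms by (simp add: M_simps)

text \<open>The top of the \<open>E i 0\<close>-string through \<open>M 0 a' b'\<close>, where the prime exchanges \<open>0\<close> and \<open>i\<close>.\<close>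

lemma M_string:
  assumes "i < n" "i \<noteq> 0" "a < n" "a \<noteq> i" "b < n" "b \<noteq> i"
  defines "u \<equiv> M 0 (if a = 0 then i else a) (if b = 0 then i else b)"
  shows "\<exists>s c. c \<noteq> 0 \<and> (br (E i 0) ^^ s) u = c *s M i a b \<and> (br (E i 0) ^^ Suc s) u = 0"
proof -
  note EM = E_M[of i 0]
  have 0 [simp]: "0 < n" by simp
  consider "a \<noteq> 0" "b \<noteq> 0" | "a = 0" "b \<noteq> 0" | "a \<noteq> 0" "b = 0" | "a = 0" "b = 0" by blast
  then show ?thesis
  proof cases
    case 1
    then have "(br (E i 0) ^^ 1) u = 1 *s M i a b \<and> (br (E i 0) ^^ Suc 1) u = 0"
      using assms by (simp add: EM)
    then show ?thesis by (metis one_neq_zero)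
  next
    case 2
    then have "(br (E i 0) ^^ 0) u = (- 1) *s M i a b \<and> (br (E i 0) ^^ Suc 0) u = 0"
      using assms M_skew[of 0 i b] M_self[of i b] by (simp add: EM)
    then show ?thesis by (metis neg_equal_0_iff_equal one_neq_zero)
  next
    case 3
    have "(2::'k) *s M i a b = M i a b + M i a b"
      by (metis one_add_one scale_left_distrib scale_one)
    then have "(br (E i 0) ^^ 2) u = (- 2) *s M i a b \<and> (br (E i 0) ^^ Suc 2) u = 0"
      using 3 assms by (simp add: EM numeral_2_eq_2)
    then show ?thesis by (metis neg_equal_0_iff_equal zero_neq_numeral)
  next
    case 4
    then have "(br (E i 0) ^^ 1) u = 1 *s M i a b \<and> (br (E i 0) ^^ Suc 1) u = 0"
      using assms M_skew[of i 0 0] M_self[of i i] M_self[of i 0] by (simp add: EM)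
    then show ?thesis by (metis one_neq_zero)
  qed
qed

text \<open>E_i0-strings replace the Weyl reflection exchanging 0 and i: both factors are, up to
  nonzero scalars, tops of strings that begin at commuting elements with first index 0, and
  \<open>br_strings_eq_0\<close> carries the vanishing to the tops.\<close>

lemma br_M_M_same:
  assumes "i < n" "a < n" "b < n" "c < n" "k < n" "a \<noteq> i" "b \<noteq> i" "c \<noteq> i" "k \<noteq> i"
  shows "br (M i a b) (M i c k) = 0"
proof (cases "i = 0")
  case True
  then show ?thesis using br_M_M_0 assms by simp
next
  case False
  let ?s = "\<lambda>x. if x = 0 then i else x"
  let ?u = "M 0 (?s a) (?s b)" and ?v = "M 0 (?s c) (?s k)"
  obtain s c1 where s: "c1 \<noteq> 0" "(br (E i 0) ^^ s) ?u = c1 *s M i a b" "(br (E i 0) ^^ Suc s) ?u = 0"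
    using M_string[of i a b] assms False by blast
  obtain t c2 where t: "c2 \<noteq> 0" "(br (E i 0) ^^ t) ?v = c2 *s M i c k" "(br (E i 0) ^^ Suc t) ?v = 0"
    using M_string[of i c k] assms False by blast
  have "br ?u ?v = 0" by (rule br_M_M_0) (use assms False in auto)
  then have "br ((br (E i 0) ^^ s) ?u) ((br (E i 0) ^^ t) ?v) = 0"
    by (intro br_strings_eq_0[where a=1 and b=1] s(3) t(3)) (use assms in auto)
  then show ?thesis using s t by simp
qed

lemma br_M_M_polarized:
  assumes "i < n" "j < n" "i \<noteq> j" "a < n" "b < n" "c < n" "k < n"
    "a \<noteq> i" "b \<noteq> i" "c \<noteq> i" "k \<noteq> i" "a \<noteq> j" "b \<noteq> j" "c \<noteq> j" "k \<noteq> j"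
  shows "br (M i a b) (M j c k) = - br (M j a b) (M i c k)"
proof -
  have "br (E j i) (br (M i a b) (M i c k)) = 0" using br_M_M_same assms by simp
  then have "br (M j a b) (M i c k) + br (M i a b) (M j c k) = 0"
    using assms jacobi_even[of "E j i" "M i a b" 1 "M i c k" 1] E_M[of j i i a b] E_M[of j i i c k]
    by simp
  then show ?thesis by (simp add: eq_neg_iff_add_eq_0 add.commute)
qed

section \<open>Commutation of the fields \<open>X a m\<close>\<close>

abbreviation X :: "nat \<Rightarrow> nat \<Rightarrow> 'a" where "X a m \<equiv> M a m m"

text \<open>Let B(x, y) denote the bracket. The first family makes B skew and the second makes its
  mixed second difference vanish, so B(x, y) = g(x) - g(y) with g(x) = B(x, 2). In f_02 - f_00 the
  field \<open>X 0 1\<close> cancels; what remains is minus a sum of n - 1 fields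
  \<open>X 0 x\<close> with x \<ge> 2, each contributing the same increment of g to the third
  family. Hence g is constant, and g(2) = 0.\<close>

lemma br_X_X_base:
  assumes "1 < x" "x < n" "1 < y" "y < n"
  shows "br (X 0 x) (X 1 y) = 0"
proof -
  have [simp]: "1 < n" using n_ge_2 by simp
  let ?B = "\<lambda>x y. br (X 0 x) (X 1 y)"
  have skew: "?B x y = - ?B y x" if "1 < x" "x < n" "1 < y" "y < n" for x y
    using br_M_M_polarized[of 0 1 x x y y] skew_odd[of "X 1 x" "X 0 y"] that by simp
  have low: "br (f 1) (X 0 y) = X 1 y" if "1 < y" "y < n" for y
    using E_M[of 1 0 0 y y] that by (simp add: E_Suc(2)[of 0, symmetric])
  have f0: "f0 (Suc y) = X 0 y - X 0 (Suc y)" if "1 < y" "Suc y < n" for y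
    using f0_eq_M(2)[of "Suc y"] that by simp
  have ff0: "br (f 1) (f0 (Suc y)) = X 1 y - X 1 (Suc y)" if "1 < y" "Suc y < n" for y
    using f0[of y] low that by simp
  have J2': "?B x y - ?B (Suc x) y = ?B x (Suc y) - ?B (Suc x) (Suc y)"
    if "1 < x" "Suc x < n" "1 < y" "Suc y < n" for x y
  proof -
    have "br (f0 (Suc x)) (br (f 1) (f0 (Suc y))) = 0" by (rule J2) (use that in auto)
    then show ?thesis unfolding f0[OF that(1,2)] ff0[OF that(3,4)] by (simp add: algebra_simps)
  qed
  have B22: "?B x x = 0" if "1 < x" "x < n" for x
    using skew[OF that that] by (rule eq_minus_self)
  have step_diff: "?B x y - ?B (Suc x) y = ?B x 2 - ?B (Suc x) 2" if "1 < x" "Suc x < n" "1 < y" "y < n" for x y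
  proof -
    have "2 \<le> y" using that by simp
    then show ?thesis using that(4)
    proof (induction y rule: dec_induct)
      case (step m)
      then show ?case using J2'[of x m] that by simp
    qed simp
  qed
  have diff: "?B x y = ?B x 2 - ?B y 2" if "1 < x" "x < n" "1 < y" "y < n" for x y
  proof -
    have "2 \<le> x" using that by simp
    then show ?thesis using that(2)
    proof (induction x rule: dec_induct)
      case base
      then show ?case using skew[of 2 y] B22[of 2] that by simp
    next
      case (step m)
      have "?B m y - ?B (Suc m) y = ?B m 2 - ?B (Suc m) 2"
        using step_diff[of m y] step that by simp
      then have "?B (Suc m) y = ?B m y - (?B m 2 - ?B (Suc m) 2)" by (simp add: algebra_simps)
      then show ?case using step by simp
    qed
  qed
  have const: "?B (Suc y) 2 = ?B y 2" if y: "1 < y" "Suc y < n" for y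
  proof -
    define S where "S = X 0 2 + (\<Sum>x=2..<n. X 0 x)"
    have S: "f0 2 - f0 0 = - S"
      unfolding S_def
      using f0_eq_M(1) f0_eq_M(2)[of 2] y sum.atLeast_Suc_lessThan[of 1 n "\<lambda>x. X 0 x"]
      by (simp add: numeral_2_eq_2)
    have "br (f0 2 - f0 0) (br (f 1) (f0 (Suc y))) = 0" by (rule J3) (use y in auto)
    then have "br S (X 1 y - X 1 (Suc y)) = 0"
      unfolding S ff0[OF y] br_simps(3) neg_equal_0_iff_equal .
    then have "(?B 2 y - ?B 2 (Suc y)) + (\<Sum>x=2..<n. ?B x y - ?B x (Suc y)) = 0"
      unfolding S_def by (simp add: br_sum_left sum_subtractf algebra_simps)
    moreover have "?B x y - ?B x (Suc y) = ?B (Suc y) 2 - ?B y 2" if "x \<in> {2..<n}" for x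
      using diff[of x y] diff[of x "Suc y"] that y by simp
    ultimately have "(?B (Suc y) 2 - ?B y 2) + (\<Sum>x=2..<n. ?B (Suc y) 2 - ?B y 2) = 0"
      using y by simp
    then have "of_nat (Suc (n - 2)) *s (?B (Suc y) 2 - ?B y 2) = 0"
      by (simp only: sum_constant_scale of_nat_Suc scale_left_distrib scale_one card_atLeastLessThan)
    then show ?thesis by (simp del: of_nat_Suc)
  qed
  have "?B z 2 = 0" if "1 < z" "z < n" for z
  proof -
    have "2 \<le> z" using that by simp
    then show ?thesis using that(2)
      by (induction z rule: dec_induct) (use B22[of 2] const in auto)
  qed
  then show ?thesis using diff[OF assms] assms by simp
qed

text \<open>A predicate on four index slots, so that moves between quadruples of distinct indices
  can be chained as rules: exchanges come from the symmetry of the odd bracket, from polarisation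
  and from E_mi, and \<open>X_comm_move\<close> brings in a fifth index.\<close>

definition X_comm :: "nat \<Rightarrow> nat \<Rightarrow> nat \<Rightarrow> nat \<Rightarrow> bool" where
  "X_comm i m j k \<longleftrightarrow> br (X i m) (X j k) = 0"

context
  fixes i m j k :: nat
  assumes lt: "i < n" "m < n" "j < n" "k < n"
    and neq: "i \<noteq> m" "i \<noteq> j" "i \<noteq> k" "m \<noteq> j" "m \<noteq> k" "j \<noteq> k"
    and comm: "X_comm i m j k"
begin

lemma X_comm_flip: "X_comm j k i m"
  using comm skew_odd[of "X i m" "X j k"] lt by (simp add: X_comm_def)

lemma X_comm_swap: "X_comm j m i k"
  using comm br_M_M_polarized[of j i m m k k] lt neq by (simp add: X_comm_def)

lemma X_comm_turn: "X_comm m i j k"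
proof -
  have "br (E m i) (X i m) = X m i" "br (E m i) (X j k) = 0"
    using lt neq M_self[of m m] M_skew[of i m i] by (simp_all add: E_M)
  then show ?thesis
    using comm jacobi_even[of "E m i" "X i m" 1 "X j k" 1] lt by (simp add: X_comm_def)
qed

lemma X_comm_move:
  assumes "l < n" "l \<noteq> i" "l \<noteq> m" "l \<noteq> j" "l \<noteq> k"
  shows "X_comm l m j k"
proof -
  have "br (E l i) (X i m) = X l m" "br (E l i) (X j k) = 0"
    using lt neq assms by (simp_all add: E_M)
  then show ?thesis
    using comm jacobi_even[of "E l i" "X i m" 1 "X j k" 1] lt assms by (simp add: X_comm_def)
qed

end

lemma br_X_X_distinct:
  assumes "i < n" "m < n" "j < n" "k < n"
    "i \<noteq> m" "i \<noteq> j" "i \<noteq> k" "m \<noteq> j" "m \<noteq> k" "j \<noteq> k"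
  shows "br (X i m) (X j k) = 0"
proof -
  have 1: "1 < n" using n_ge_2 by simp
  have base: "X_comm 0 m 1 k" if "1 < m" "m < n" "1 < k" "k < n" for m k
    using br_X_X_base that by (simp add: X_comm_def)
  have gt: "1 < x" if "x \<noteq> 0" "x \<noteq> 1" for x :: nat using that by linarith
  \<comment> \<open>Quadruples with 0 in the first slot, sorted by the slot that holds 1; if 1 does
    not occur, the base case with 1 is taken and \<open>X_comm_move\<close> trades 1 for j.\<close>
  have zero: "X_comm 0 m j k"
    if *: "m < n" "j < n" "k < n" "0 < m" "0 < j" "0 < k" "m \<noteq> j" "m \<noteq> k" "j \<noteq> k" for m j k
  proof -
    consider "j = 1" | "m = 1" | "k = 1" | "j \<noteq> 1" "m \<noteq> 1" "k \<noteq> 1" by blast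
    then show ?thesis
    proof cases
      case 1
      then show ?thesis using base[of m k] * gt[of m] gt[of k] by simp
    next
      case 2
      have "X_comm 0 j 1 k" using base[of j k] * gt[of j] gt[of k] 2 by simp
      then have "X_comm j 0 1 k" by (rule X_comm_turn[rotated -1]) (use * 2 1 in auto)
      then have "X_comm 1 0 j k" by (rule X_comm_swap[rotated -1]) (use * 2 1 in auto)
      then have "X_comm 0 1 j k" by (rule X_comm_turn[rotated -1]) (use * 2 1 in auto)
      then show ?thesis using 2 by simp
    next
      case 3
      have "X_comm 0 m 1 j" using base[of m j] * gt[of m] gt[of j] 3 by simp
      then have "X_comm 1 j 0 m" by (rule X_comm_flip[rotated -1]) (use * 3 1 in auto)
      then have "X_comm j 1 0 m" by (rule X_comm_turn[rotated -1]) (use * 3 1 in auto)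
      then have "X_comm 0 m j 1" by (rule X_comm_flip[rotated -1]) (use * 3 1 in auto)
      then show ?thesis using 3 by simp
    next
      case 4
      have "X_comm 0 m 1 k" using base[of m k] * gt[of m] gt[of k] 4 by simp
      then have "X_comm 1 k 0 m" by (rule X_comm_flip[rotated -1]) (use * 4 1 in auto)
      then have "X_comm j k 0 m" by (rule X_comm_move[rotated 10]) (use * 4 1 in auto)
      then show ?thesis by (rule X_comm_flip[rotated -1]) (use * 4 1 in auto)
    qed
  qed
  have "X_comm i m j k"
  proof -
    consider "i = 0" | "m = 0" | "j = 0" | "k = 0" | "i \<noteq> 0" "m \<noteq> 0" "j \<noteq> 0" "k \<noteq> 0" by blast
    then show ?thesis
    proof cases
      case 1
      then show ?thesis using zero[of m j k] assms by simp
    next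
      case 2
      then have "X_comm 0 i j k" using zero[of i j k] assms by simp
      then show ?thesis unfolding 2 by (rule X_comm_turn[rotated -1]) (use assms 2 in auto)
    next
      case 3
      then have "X_comm 0 k i m" using zero[of k i m] assms by simp
      then show ?thesis unfolding 3 by (rule X_comm_flip[rotated -1]) (use assms 3 in auto)
    next
      case 4
      then have "X_comm 0 j i m" using zero[of j i m] assms by simp
      then have "X_comm j 0 i m" by (rule X_comm_turn[rotated -1]) (use assms 4 in auto)
      then show ?thesis unfolding 4 by (rule X_comm_flip[rotated -1]) (use assms 4 in auto)
    next
      case 5
      then have "X_comm 0 m j k" using zero[of m j k] assms by simp
      then show ?thesis by (rule X_comm_move[rotated 10]) (use assms 5 in auto)
    qed
  qed
  then show ?thesis by (simp add: X_comm_def)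
qed

text \<open>The excluded coincidences a = k and b = m are those in which one diagonal field sees the
  \<theta> of the other. Equal first or equal second indices follow from the first family; four
  distinct indices use the other two.\<close>

lemma br_X_X:
  assumes "a < n" "b < n" "m < n" "k < n" "a \<noteq> m" "b \<noteq> k" "a \<noteq> k" "b \<noteq> m"
  shows "br (X a m) (X b k) = 0"
proof -
  consider "a = b" | "a \<noteq> b" "m = k" | "a \<noteq> b" "m \<noteq> k" by blast
  then show ?thesis
  proof cases
    case 1
    then show ?thesis using br_M_M_same assms by simp
  next
    case 2
    have "br (X a m) (X b k) + br (X a m) (X b k) = 0"
      using 2 assms br_M_M_polarized[of a b m m m m] skew_odd[of "X a m" "X b m"]
      by (simp add: eq_neg_iff_add_eq_0)
    then show ?thesis by (rule double_eq_0)
  next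
    case 3
    then show ?thesis using br_X_X_distinct assms by simp
  qed
qed

end


section \<open>Words spanning the negative part\<close>

context lie_superalg
begin

text \<open>Reordering a word in the odd \<open>X a m\<close> changes its sign. Only spans and the
  vanishing of coefficients matter later, so the sign is forgotten at once.\<close>

definition pm :: "'a \<Rightarrow> 'a \<Rightarrow> bool" where "pm x y \<longleftrightarrow> x = y \<or> x = - y"

lemma pm_refl [simp]: "pm x x" and pm_minus: "pm (- x) x" and pm_sym: "pm x y \<Longrightarrow> pm y x"
  and pm_trans [trans]: "pm x y \<Longrightarrow> pm y z \<Longrightarrow> pm x z" and pm_0: "pm x 0 \<Longrightarrow> x = 0"
  by (auto simp: pm_def)

lemma pm_br: "pm x y \<Longrightarrow> pm (br a x) (br a y)"
  by (auto simp: pm_def)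

lemma pm_foldr: "pm v w \<Longrightarrow> pm (foldr (\<lambda>a. br (g a)) as v) (foldr (\<lambda>a. br (g a)) as w)"
  by (induction as) (auto intro: pm_br)

lemma pm_fold: "pm v w \<Longrightarrow> pm (fold (\<lambda>a. br (g a)) as v) (fold (\<lambda>a. br (g a)) as w)"
  by (induction as arbitrary: v w) (auto intro: pm_br)

lemma pm_span: "pm x y \<Longrightarrow> y \<in> span S \<Longrightarrow> x \<in> span S"
  by (auto simp: pm_def span_neg)

lemma fold_br_0: "fold (\<lambda>a. br (g a)) ps 0 = 0" and foldr_br_0: "foldr (\<lambda>a. br (g a)) ps 0 = 0"
  by (induction ps) auto

lemma fold_br_sum:
  "fold (\<lambda>a. br (g a)) ps (\<Sum>i\<in>I. c i *s v i) = (\<Sum>i\<in>I. c i *s fold (\<lambda>a. br (g a)) ps (v i))"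
  by (induction ps arbitrary: v) (simp_all add: br_sum_right)

text \<open>Coefficients are indexed by I and not by the vectors, because the families it is applied
  to are not known to be injective.\<close>

lemma span_family:
  assumes "finite I" "x \<in> span (v ` I)"
  obtains c where "x = (\<Sum>i\<in>I. c i *s v i)"
proof -
  let ?S = "{\<Sum>i\<in>I. c i *s v i | c. True}"
  have "subspace ?S"
  proof (rule subspaceI)
    show "0 \<in> ?S" by (auto intro!: exI[of _ "\<lambda>_. 0"])
    show "x + y \<in> ?S" if xy: "x \<in> ?S" "y \<in> ?S" for x y
    proof -
      obtain c c' where "x = (\<Sum>i\<in>I. c i *s v i)" "y = (\<Sum>i\<in>I. c' i *s v i)" using xy by auto
      then have "x + y = (\<Sum>i\<in>I. (c i + c' i) *s v i)"
        by (simp add: scale_left_distrib sum.distrib)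
      then show ?thesis by (auto intro!: exI[of _ "\<lambda>i. c i + c' i"])
    qed
    show "a *s x \<in> ?S" if x: "x \<in> ?S" for a x
    proof -
      obtain c where "x = (\<Sum>i\<in>I. c i *s v i)" using x by auto
      then have "a *s x = (\<Sum>i\<in>I. (a * c i) *s v i)" by (simp add: scale_sum_right)
      then show ?thesis by (auto intro!: exI[of _ "\<lambda>i. a * c i"])
    qed
  qed
  moreover have "v ` I \<subseteq> ?S"
  proof
    fix y assume "y \<in> v ` I"
    then obtain k where "k \<in> I" "y = v k" by auto
    then have "y = (\<Sum>i\<in>I. (if i = k then 1 else 0) *s v i)"
      using assms(1) by (simp add: if_distrib[of "\<lambda>c. c *s _"] sum.delta cong: if_cong)
    then show "y \<in> ?S" by (auto intro!: exI[of _ "\<lambda>i. if i = k then 1 else 0"])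
  qed
  ultimately have "span (v ` I) \<subseteq> ?S" by (intro span_minimal)
  then show thesis using assms(2) that by blast
qed

lemma br_span: "(\<And>a. a \<in> A \<Longrightarrow> br x a \<in> span B) \<Longrightarrow> v \<in> span A \<Longrightarrow> br x v \<in> span B"
  by (rule span_induct_alt[of v A "\<lambda>v. br x v \<in> span B"]) (auto intro: span_zero span_add span_scale)

end

context w_algebra
begin

lemma d_nonzero: "e 0 \<noteq> 0 \<Longrightarrow> j < n \<Longrightarrow> d j \<noteq> 0"
  using E_d[of j 0 j] by (auto simp: d.simps)

text \<open>E_kk acts on \<open>d j\<close> by - \<delta>_jk and so isolates the k-th term.\<close>

lemma d_independent:
  assumes "e 0 \<noteq> 0" "(\<Sum>j<n. a j *s d j) = 0" "k < n"
  shows "a k = 0"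
proof -
  have "br (E k k) (\<Sum>j<n. a j *s d j) = (\<Sum>j<n. if j = k then - (a k *s d k) else 0)"
    unfolding br_sum_right by (rule sum.cong[OF HOL.refl]) (use assms(3) in \<open>simp add: E_d\<close>)
  also have "\<dots> = - (a k *s d k)" using assms(3) by simp
  finally show ?thesis using assms d_nonzero[of k] by simp
qed

lemma d_E: "k < n \<Longrightarrow> i < n \<Longrightarrow> j < n \<Longrightarrow> br (d k) (E i j) = (if i = k then d j else 0)"
  using skew_even'[of "d k" 1 "E i j"] E_d[of i j k] by simp

end

context w_quotient
begin

text \<open>\<open>X a m\<close> corresponds to \<open>\<theta>\<^sub>a N\<^sub>m\<close>, so that \<open>wd m as j\<close> is \<open>\<theta>\<^sub>A \<partial>\<^sub>j\<close> up to sign, for \<open>A\<close> the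
  set of \<open>m\<close> and the entries of \<open>as\<close>.\<close>

definition wd :: "nat \<Rightarrow> nat list \<Rightarrow> nat \<Rightarrow> 'a" where
  "wd m as j = foldr (\<lambda>a. br (X a m)) as (E m j)"

section \<open>Words as normal forms of \<theta>_A \<partial>_j\<close>

lemma wd_simps: "wd m [] j = E m j" "wd m (a # as) j = br (X a m) (wd m as j)"
  "wd m (as @ [a]) j = foldr (\<lambda>a. br (X a m)) as (br (X a m) (E m j))"
  by (simp_all add: wd_def)

lemma foldr_X_hom:
  assumes "k < n" "set as \<subseteq> {..<n}" "v \<in> hom c"
  shows "\<exists>c'. foldr (\<lambda>a. br (X a k)) as v \<in> hom c'"
  using assms(2)
proof (induction as)
  case (Cons a as)
  then obtain c' where "foldr (\<lambda>a. br (X a k)) as v \<in> hom c'" by auto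
  then have "br (X a k) (foldr (\<lambda>a. br (X a k)) as v) \<in> hom (1 + c')"
    using assms(1) Cons.prems by (intro hom_br) auto
  then show ?case by auto
qed (use assms in auto)

lemma wd_hom: "m < n \<Longrightarrow> j < n \<Longrightarrow> set as \<subseteq> {..<n} \<Longrightarrow> \<exists>c. wd m as j \<in> hom c"
  unfolding wd_def by (rule foldr_X_hom[where c=0]) auto

lemma X_X_anticomm:
  assumes "a < n" "b < n" "m < n" "k < n" "a \<noteq> m" "b \<noteq> k" "a \<noteq> k" "b \<noteq> m" "v \<in> hom c"
  shows "br (X a m) (br (X b k) v) = - br (X b k) (br (X a m) v)"
  using jacobi_odd[of "X a m" "X b k" v c] br_X_X[of a b m k] assms by simp

lemma X_pass:
  assumes "i < n" "m < n" "k < n" "i \<noteq> m" "i \<noteq> k" "v \<in> hom c"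
    and "\<And>a. a \<in> set as \<Longrightarrow> a < n \<and> a \<noteq> k \<and> a \<noteq> m"
  shows "pm (br (X i m) (foldr (\<lambda>a. br (X a k)) as v)) (foldr (\<lambda>a. br (X a k)) as (br (X i m) v))"
  using assms(7)
proof (induction as)
  case (Cons a as)
  let ?w = "foldr (\<lambda>a. br (X a k)) as v"
  have "set as \<subseteq> {..<n}" using Cons.prems by auto
  then obtain c' where "?w \<in> hom c'" using foldr_X_hom[of k as v c] assms by blast
  then have "br (X i m) (br (X a k) ?w) = - br (X a k) (br (X i m) ?w)"
    using X_X_anticomm[of i a m k ?w c'] assms(1-5) Cons.prems[of a] by simp
  then have "pm (br (X i m) (br (X a k) ?w)) (br (X a k) (br (X i m) ?w))"
    by (simp add: pm_minus)
  also have "pm (br (X a k) (br (X i m) ?w)) (br (X a k) (foldr (\<lambda>a. br (X a k)) as (br (X i m) v)))"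
    by (rule pm_br[OF Cons.IH]) (use Cons.prems in simp)
  finally show ?case by simp
qed simp

lemma X_perm:
  assumes "k < n" "v \<in> hom c" "mset as = mset bs" "\<And>a. a \<in> set as \<Longrightarrow> a < n \<and> a \<noteq> k"
  shows "pm (foldr (\<lambda>a. br (X a k)) as v) (foldr (\<lambda>a. br (X a k)) bs v)"
  using assms(3,4)
proof (induction as arbitrary: bs)
  case (Cons a as)
  have set_bs: "set bs = set (a # as)" using Cons.prems(1) by (metis set_mset_mset)
  then have "a \<in> set bs" by simp
  then obtain xs ys where bs: "bs = xs @ a # ys" by (meson split_list)
  have eq: "mset as = mset (xs @ ys)" using Cons.prems(1) bs by simp
  let ?W = "\<lambda>as v. foldr (\<lambda>a. br (X a k)) as v"
  have valid: "b < n \<and> b \<noteq> k" if "b \<in> set bs" for b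
    using Cons.prems(2)[of b] set_bs that by simp
  then have "set ys \<subseteq> {..<n}" using bs by auto
  then obtain c' where c': "?W ys v \<in> hom c'"
    using foldr_X_hom[of k ys v c] assms(1,2) by blast
  have "pm (?W (a # as) v) (br (X a k) (?W (xs @ ys) v))"
    using pm_br[OF Cons.IH[OF eq], of "X a k"] Cons.prems(2) by simp
  also have "pm (br (X a k) (?W (xs @ ys) v)) (?W xs (br (X a k) (?W ys v)))"
    using X_pass[of a k k "?W ys v" c' xs] assms(1) valid[of a] c' valid bs by simp
  finally show ?case using bs by simp
qed simp

lemma wd_perm:
  assumes "m < n" "j < n" "mset as = mset bs" "set as \<subseteq> {..<n}" "m \<notin> set as"
  shows "pm (wd m as j) (wd m bs j)"
  unfolding wd_def by (rule X_perm[where c=0]) (use assms in auto)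

text \<open>Two equal letters can be moved side by side, and an odd x with [x, x] = 0 acts with
  square zero.\<close>

lemma wd_repeat:
  assumes "m < n" "j < n" "\<not> distinct as" "set as \<subseteq> {..<n}" "m \<notin> set as"
  shows "wd m as j = 0"
proof -
  obtain xs ys zs a where as: "as = xs @ [a] @ ys @ [a] @ zs"
    using not_distinct_decomp[OF assms(3)] by blast
  let ?r = "xs @ ys @ zs"
  have "pm (wd m as j) (wd m (a # a # ?r) j)" by (rule wd_perm) (use assms as in auto)
  moreover have "set ?r \<subseteq> {..<n}" using assms as by auto
  then obtain c where "wd m ?r j \<in> hom c" using wd_hom[of m j ?r] assms by blast
  then have "wd m (a # a # ?r) j = - wd m (a # a # ?r) j"
    using X_X_anticomm[of a a m m "wd m ?r j" c] assms as by (simp only: wd_simps) simp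
  then have "wd m (a # a # ?r) j = 0" by (rule eq_minus_self)
  ultimately show ?thesis by (simp add: pm_0)
qed

lemma X_E: "a < n \<Longrightarrow> m < n \<Longrightarrow> j < n \<Longrightarrow> j \<noteq> m \<Longrightarrow> br (X a m) (E m j) = M a m j"
  using skew_even'[of "X a m" 1 "E m j"] E_M[of m j a m m] M_self[of m m] by auto

text \<open>\<open>\<theta>\<^sub>a (N\<^sub>m - N\<^sub>k)\<close> annihilates \<open>\<theta>\<^sub>k \<theta>\<^sub>m \<partial>\<^sub>j\<close>, since it equals
  \<open>[E\<^sub>m\<^sub>k, \<theta>\<^sub>a \<theta>\<^sub>k \<partial>\<^sub>m]\<close>.\<close>

lemma X_M_exchange:
  assumes "a < n" "m < n" "k < n" "j < n" "a \<noteq> m" "a \<noteq> k" "m \<noteq> k" "j \<noteq> m" "j \<noteq> k"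
  shows "br (X a m) (M k m j) = br (X a k) (M k m j)"
proof -
  have 0: "br (M a k m) (M k m j) = 0"
    using br_M_M_same[of k a m m j] M_skew[of a k m] assms by simp
  have "br (E m k) (M a k m) = X a m - X a k" using E_M[of m k a k m] assms by simp
  moreover have "br (E m k) (M k m j) = 0" using E_M[of m k k m j] M_self[of m j] assms by simp
  ultimately have "br (X a m - X a k) (M k m j) = 0"
    using jacobi_even[of "E m k" "M a k m" 1 "M k m j" 1] 0 assms by simp
  then show ?thesis by simp
qed

text \<open>The index m is no letter but the slot of the common diagonal field. It can trade places
  with a letter k: after the innermost step both words continue from \<theta>_k \<theta>_m
  \<partial>_j up to sign, where \<open>X a m\<close> and \<open>X a k\<close> agree, and
  anticommutation carries the agreement outwards.\<close>

lemma wd_base_change: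
  assumes "m < n" "k < n" "j < n" "m \<noteq> k" "j \<noteq> m" "j \<noteq> k"
    and as: "\<And>a. a \<in> set as \<Longrightarrow> a < n \<and> a \<noteq> m \<and> a \<noteq> k"
  shows "wd m (as @ [k]) j = - wd k (as @ [m]) j"
proof -
  let ?v = "M k m j"
  have swap: "br (X a m) (foldr (\<lambda>a. br (X a m)) as ?v) = br (X a k) (foldr (\<lambda>a. br (X a m)) as ?v)"
    if a: "a < n" "a \<noteq> m" "a \<noteq> k" and as: "\<And>a. a \<in> set as \<Longrightarrow> a < n \<and> a \<noteq> m \<and> a \<noteq> k" for a as
    using as
  proof (induction as)
    case Nil
    then show ?case using X_M_exchange assms(1-6) a by simp
  next
    case (Cons b as)
    let ?w = "foldr (\<lambda>a. br (X a m)) as ?v"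
    have b: "b < n" "b \<noteq> m" "b \<noteq> k" using Cons.prems[of b] by auto
    have "set as \<subseteq> {..<n}" using Cons.prems by auto
    then obtain c where c: "?w \<in> hom c" using foldr_X_hom[of m as ?v 1] assms(1-3) by auto
    have "br (X a m) (br (X b m) ?w) = - br (X b m) (br (X a m) ?w)"
      "br (X a k) (br (X b m) ?w) = - br (X b m) (br (X a k) ?w)"
      using X_X_anticomm[of a b m m ?w c] X_X_anticomm[of a b k m ?w c] assms(1-6) a b c by simp_all
    moreover have "br (X a m) ?w = br (X a k) ?w" using Cons by simp
    ultimately show ?case by simp
  qed
  have "foldr (\<lambda>a. br (X a m)) as ?v = foldr (\<lambda>a. br (X a k)) as ?v"
    using as
  proof (induction as)
    case (Cons a as)
    have "foldr (\<lambda>a. br (X a m)) (a # as) ?v = br (X a k) (foldr (\<lambda>a. br (X a m)) as ?v)"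
      using swap[of a as] Cons.prems by simp
    also have "foldr (\<lambda>a. br (X a m)) as ?v = foldr (\<lambda>a. br (X a k)) as ?v"
      using Cons by simp
    finally show ?case by simp
  qed simp
  moreover have "br (X k m) (E m j) = ?v" "br (X m k) (E k j) = - ?v"
    using X_E[of k m j] X_E[of m k j] M_skew[of m k j] assms(1-6) by simp_all
  moreover have "foldr (\<lambda>a. br (X a k)) as (- ?v) = - foldr (\<lambda>a. br (X a k)) as ?v"
    by (induction as) auto
  ultimately show ?thesis by (simp add: wd_simps(3))
qed

text \<open>One representative of \<plusminus> \<theta>_A \<partial>_j. The slot must lie in A and
  differ from j, and \<open>Min\<close> merely selects such an element; if there is none the value
  has no meaning, so the lemmas ask for one or for enough elements in A.\<close>

definition T :: "nat set \<Rightarrow> nat \<Rightarrow> 'a" where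
  "T A j = wd (Min (A - {j})) (sorted_list_of_set (A - {Min (A - {j})})) j"

lemma mset_eq_sorted:
  "distinct bs \<Longrightarrow> set bs = B \<Longrightarrow> mset bs = mset (sorted_list_of_set (B :: nat set))"
  by (metis List.finite_set distinct_sorted_list_of_set set_eq_iff_mset_eq_distinct
      set_sorted_list_of_set)

lemma T_wd:
  assumes "A \<subseteq> {..<n}" "m \<in> A" "j < n" "m \<noteq> j" "distinct as" "set as = A - {m}"
  shows "pm (T A j) (wd m as j)"
proof (rule pm_sym)
  have fin [simp]: "finite A" using assms(1) finite_subset by blast
  define k where "k = Min (A - {j})"
  have "k \<in> A - {j}" unfolding k_def using assms by (intro Min_in) auto
  then have k: "k \<in> A" "k \<noteq> j" "k < n" and m: "m < n" using assms by auto
  have T: "T A j = wd k (sorted_list_of_set (A - {k})) j" by (simp add: T_def k_def)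
  show "pm (wd m as j) (T A j)"
  proof (cases "k = m")
    case True
    then show ?thesis
      unfolding T by (simp, intro wd_perm mset_eq_sorted) (use assms m in auto)
  next
    case False
    let ?as = "remove1 k as"
    have set_as: "set ?as = A - {m, k}" using assms by auto
    have "pm (wd m as j) (wd m (?as @ [k]) j)"
      by (rule wd_perm) (use assms k m False in auto)
    also have "wd m (?as @ [k]) j = - wd k (?as @ [m]) j"
      by (rule wd_base_change) (use assms k m False set_as in auto)
    also have "pm (- wd k (?as @ [m]) j) (wd k (?as @ [m]) j)" by (rule pm_minus)
    also have "pm (wd k (?as @ [m]) j) (T A j)"
      unfolding T
    proof (rule wd_perm)
      show "mset (?as @ [m]) = mset (sorted_list_of_set (A - {k}))"
        by (rule mset_eq_sorted) (use assms set_as False in \<open>auto simp: distinct_remove1\<close>)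
    qed (use assms k m set_as False in auto)
    finally show ?thesis .
  qed
qed

lemma M_T: "a < n \<Longrightarrow> b < n \<Longrightarrow> j < n \<Longrightarrow> a \<noteq> b \<Longrightarrow> pm (T {a, b} j) (M a b j)"
proof (cases "j = b")
  case False
  assume *: "a < n" "b < n" "j < n" "a \<noteq> b"
  have "pm (T {a, b} j) (wd b [a] j)" by (rule T_wd) (use * False in auto)
  then show ?thesis using X_E[of a b j] * False by (simp add: wd_simps)
next
  case True
  assume *: "a < n" "b < n" "j < n" "a \<noteq> b"
  have "pm (T {a, b} j) (wd a [b] j)" by (rule T_wd) (use * True in auto)
  also have "wd a [b] j = - M a b j"
    using X_E[of b a j] M_skew[of b a j] * True by (simp add: wd_simps)
  also have "pm (- M a b j) (M a b j)" by (rule pm_minus)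
  finally show ?thesis .
qed

text \<open>Fields \<theta>_A \<partial>_j with r elements in A have degree 1 - r, which is the
  shift between \<open>T_span\<close> and the graded components below.\<close>

definition T_span :: "nat \<Rightarrow> 'a set" where
  "T_span r = span ((\<lambda>(A, j). T A j) ` ({A. A \<subseteq> {..<n} \<and> card A = r} \<times> {..<n}))"

lemma T_in_span: "A \<subseteq> {..<n} \<Longrightarrow> card A = r \<Longrightarrow> j < n \<Longrightarrow> T A j \<in> T_span r"
  unfolding T_span_def by (rule span_base) auto

lemma pm_T_span: "pm x y \<Longrightarrow> y \<in> T_span r \<Longrightarrow> x \<in> T_span r"
  unfolding T_span_def by (rule pm_span)

lemma wd_in_T_span:
  assumes "m < n" "j < n" "m \<noteq> j" "set as \<subseteq> {..<n}" "m \<notin> set as"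
  shows "wd m as j \<in> T_span (Suc (length as))"
proof (cases "distinct as")
  case True
  have "pm (T (insert m (set as)) j) (wd m as j)"
    by (rule T_wd) (use assms True in auto)
  moreover have "T (insert m (set as)) j \<in> T_span (Suc (length as))"
    by (rule T_in_span) (use assms True in \<open>auto simp: distinct_card\<close>)
  ultimately show ?thesis using pm_T_span pm_sym by blast
next
  case False
  then show ?thesis using wd_repeat assms by (simp add: T_span_def span_zero)
qed

text \<open>In the model [\<theta>_i N_m, \<theta>_A \<partial>_j] is, up to sign, \<theta>_i
  \<theta>_A \<partial>_j in \<open>c1\<close> and \<open>c5\<close>, \<theta>_A \<theta>_m
  \<partial>_m in \<open>c4\<close>, and 0 in \<open>c2\<close> and \<open>c3\<close>. The slot of
  the word is chosen so that \<open>X i m\<close> either becomes a new letter or passes the letters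
  and acts on the core of the word.\<close>

lemma X_T:
  assumes A: "A \<subseteq> {..<n}" "2 \<le> card A" and ijm: "i < n" "m < n" "j < n" "i \<noteq> m"
  shows "br (X i m) (T A j) \<in> T_span (Suc (card A))"
proof -
  have fin [simp]: "finite A" using A finite_subset by blast
  have lt: "k < n" if "k \<in> A" for k using that A by auto
  have other: "\<exists>k\<in>A. k \<noteq> x" for x
  proof (rule ccontr)
    assume "\<not> (\<exists>k\<in>A. k \<noteq> x)"
    then have "A \<subseteq> {x}" by auto
    then show False using A(2) card_mono[of "{x}" A] by simp
  qed
  have pair: "A = {x, y} \<and> x \<noteq> y" if "A \<subseteq> {x, y}" for x y
    using that other[of x] other[of y] by blast
  have done_pm: "br (X i m) (T A j) \<in> T_span (Suc (card A))"
    if "pm (T A j) y" "pm (br (X i m) y) z" "z \<in> T_span (Suc (card A))" for y z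
    by (rule pm_T_span[OF pm_trans[OF pm_br[OF that(1)] that(2)] that(3)])
  have zero: "0 \<in> T_span (Suc (card A))" by (simp add: T_span_def span_zero)
  have X_pair: "br (X i m) (T A j) \<in> T_span (Suc (card A))"
    if "A = {x, y}" "x \<noteq> y" "br (X i m) (M x y j) = 0" for x y
  proof (rule done_pm)
    show "pm (T A j) (M x y j)" using M_T[of x y j] that lt ijm by simp
  qed (use that zero in auto)
  have rep: "\<exists>as. distinct as \<and> set as = A - {k} \<and> length as = card A - 1 \<and> pm (T A j) (wd k as j)"
    if "k \<in> A" "k \<noteq> j" for k
  proof -
    let ?as = "sorted_list_of_set (A - {k})"
    have "pm (T A j) (wd k ?as j)" by (rule T_wd) (use that A ijm in auto)
    then show ?thesis using that by (intro exI[of _ ?as]) auto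
  qed
  have len: "Suc (card A - 1) = card A" using A(2) by simp
  consider (c1) "m \<in> A" "j \<noteq> m" | (c2) "m \<in> A" "j = m" | (c3) "m \<notin> A" "j \<noteq> m" "j \<noteq> i"
    | (c4) "m \<notin> A" "j = i" | (c5) "m \<notin> A" "j = m" by fast
  then show ?thesis
  proof cases
    case c1
    obtain as where as: "distinct as" "set as = A - {m}" "length as = card A - 1" "pm (T A j) (wd m as j)"
      using rep[of m] c1 by auto
    \<comment> \<open>If i already lies in A the longer word repeats a letter and is 0, which
      \<open>wd_in_T_span\<close> includes.\<close>
    have "wd m (i # as) j \<in> T_span (Suc (length (i # as)))"
      by (rule wd_in_T_span) (use as A ijm c1 in auto)
    then have "wd m (i # as) j \<in> T_span (Suc (card A))" using as(3) len by simp
    then show ?thesis by (intro done_pm[OF as(4)]) (simp_all add: wd_simps)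
  next
    case c2
    show ?thesis
    \<comment> \<open>The slot should be a third element of A; if A is just {m, i} there is none,
      and the field is treated directly.\<close>
    proof (cases "A \<subseteq> {m, i}")
      case True
      have "br (X i m) (M m i m) = 0"
        using br_X_X[of i i m m] M_skew[of m i m] ijm by simp
      then show ?thesis using pair[OF True] c2 by (intro X_pair[of m i]) auto
    next
      case False
      then obtain k where k: "k \<in> A" "k \<noteq> m" "k \<noteq> i" by auto
      note kn = lt[OF k(1)]
      let ?as = "sorted_list_of_set (A - {k, m})"
      have 1: "pm (T A j) (wd k (?as @ [m]) j)"
        by (rule T_wd) (use k c2 A ijm in auto)
      have "br (X m k) (E k j) = M m k m"
        using X_E[of m k j] k kn c2 ijm by simp
      then have 2: "wd k (?as @ [m]) j = foldr (\<lambda>a. br (X a k)) ?as (M m k m)"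
        by (simp add: wd_simps)
      have 3: "pm (br (X i m) (foldr (\<lambda>a. br (X a k)) ?as (M m k m)))
          (foldr (\<lambda>a. br (X a k)) ?as (br (X i m) (M m k m)))"
        by (rule X_pass[where c=1]) (use k kn c2 A ijm in auto)
      have "br (X i m) (M m k m) = 0"
        using br_X_X[of i k m m] M_skew[of m k m] k kn ijm by simp
      then show ?thesis
        using done_pm[OF 1[unfolded 2] 3] zero by (simp add: foldr_br_0)
    qed
  next
    case c3
    show ?thesis
    proof (cases "A \<subseteq> {i, j}")
      case True
      then have "br (X i m) (M i j j) = 0"
        using pair[OF True] br_X_X[of i i m j] ijm c3 by simp
      then show ?thesis using pair[OF True] by (intro X_pair[of i j]) auto
    next
      case False
      then obtain k where k: "k \<in> A" "k \<noteq> i" "k \<noteq> j" by auto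
      then have kn: "k < n" "k \<noteq> m" using lt c3 by auto
      obtain as where as: "distinct as" "set as = A - {k}" "length as = card A - 1" "pm (T A j) (wd k as j)"
        using rep[of k] k by auto
      have 1: "pm (br (X i m) (wd k as j)) (foldr (\<lambda>a. br (X a k)) as (br (X i m) (E k j)))"
        unfolding wd_def by (rule X_pass[where c=0]) (use k kn c3 A ijm as in auto)
      have "br (X i m) (E k j) = 0"
        using skew_even'[of "X i m" 1 "E k j"] E_M[of k j i m m] k kn ijm c3 by simp
      then show ?thesis using done_pm[OF as(4) 1] zero by (simp add: foldr_br_0)
    qed
  next
    case c4
    obtain k where k: "k \<in> A" "k \<noteq> j" using other by auto
    then have kn: "k < n" "k \<noteq> m" using lt c4 by auto
    obtain as where as: "distinct as" "set as = A - {k}" "length as = card A - 1" "pm (T A j) (wd k as j)"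
      using rep[of k] k by auto
    have 1: "pm (br (X i m) (wd k as j)) (foldr (\<lambda>a. br (X a k)) as (br (X i m) (E k j)))"
      unfolding wd_def by (rule X_pass[where c=0]) (use k c4 A ijm as kn in auto)
    have 2: "br (X i m) (E k j) = br (X m k) (E k m)"
      using skew_even'[of "X i m" 1 "E k j"] E_M[of k j i m m] X_E[of m k m] M_skew[of k m m]
        k kn ijm c4 by simp
    have "wd k (as @ [m]) m \<in> T_span (Suc (length (as @ [m])))"
      by (rule wd_in_T_span) (use as A ijm kn c4 in auto)
    then have "wd k (as @ [m]) m \<in> T_span (Suc (card A))" using len as(3) by simp
    then show ?thesis by (intro done_pm[OF as(4) 1]) (simp add: 2 wd_simps(3))
  next
    case c5
    obtain k where k: "k \<in> A" "k \<noteq> i" using other by auto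
    then have kn: "k < n" "k \<noteq> m" "k \<noteq> j" using lt c5 by auto
    obtain as where as: "distinct as" "set as = A - {k}" "length as = card A - 1" "pm (T A j) (wd k as j)"
      using rep[of k] k kn by auto
    have 1: "pm (br (X i m) (wd k as j)) (foldr (\<lambda>a. br (X a k)) as (br (X i m) (E k j)))"
      unfolding wd_def by (rule X_pass[where c=0]) (use k c5 A ijm as kn in auto)
    have 2: "br (X i m) (E k j) = - br (X i k) (E k m)"
      using skew_even'[of "X i m" 1 "E k j"] E_M[of k j i m m] X_E[of i k m] k kn ijm c5 by simp
    have 3: "pm (foldr (\<lambda>a. br (X a k)) as (- br (X i k) (E k m))) (wd k (as @ [i]) m)"
      unfolding wd_simps(3) by (rule pm_foldr[OF pm_minus])
    have "wd k (as @ [i]) m \<in> T_span (Suc (length (as @ [i])))"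
      by (rule wd_in_T_span) (use as A ijm kn k in auto)
    then have "wd k (as @ [i]) m \<in> T_span (Suc (card A))" using len as(3) by simp
    then show ?thesis by (rule done_pm[OF as(4) pm_trans[OF 1[unfolded 2] 3]])
  qed
qed

section \<open>Recovering coefficients with the \<open>d l\<close>\<close>

lemma N_wd:
  assumes "m < n" "j < n" "m \<noteq> j" "set as \<subseteq> {..<n}" "m \<notin> set as"
  shows "br (E m m) (wd m as j) = wd m as j"
  using assms(4,5)
proof (induction as)
  case Nil
  then show ?case using assms by (simp add: wd_simps E_E)
next
  case (Cons a as)
  have "set as \<subseteq> {..<n}" using Cons.prems by auto
  then obtain c where "wd m as j \<in> hom c" using wd_hom[of m j as] assms by blast
  then show ?case
    using Cons assms(1) jacobi_even[of "E m m" "X a m" 1 "wd m as j" c] E_M[of m m a m m]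
    by (simp add: wd_simps)
qed

lemma d_wd:
  assumes "m < n" "j < n" "l < n" "l \<noteq> m" "set as \<subseteq> {..<n}" "m \<notin> set as" "l \<notin> set as"
  shows "br (d l) (wd m as j) = 0"
  using assms(5,6,7)
proof (induction as)
  case Nil
  then show ?case using assms by (simp add: wd_simps d_E)
next
  case (Cons a as)
  have "set as \<subseteq> {..<n}" using Cons.prems by auto
  then obtain c where "wd m as j \<in> hom c" using wd_hom[of m j as] assms by blast
  then show ?case
    using Cons assms(1-4) jacobi_odd[of "d l" "X a m" "wd m as j" c] d_M[of l a m m]
    by (simp add: wd_simps)
qed

text \<open>Three elements in A leave one, m, that differs from j and from l. With m as slot and l
  as outermost letter, [\<partial>_l, \<theta>_l N_m] is N_m, which fixes the rest of the word, and
  \<partial>_l kills that rest. With only two elements such a slot may be missing.\<close>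

lemma d_T:
  assumes A: "A \<subseteq> {..<n}" "3 \<le> card A" and j: "j < n" "l < n"
  shows "pm (br (d l) (T A j)) (if l \<in> A then T (A - {l}) j else 0)"
proof -
  have fin [simp]: "finite A" using A finite_subset by blast
  have "card {j, l} \<le> 2" by (simp add: card_insert_if)
  then have "\<not> A \<subseteq> {j, l}" using card_mono[of "{j, l}" A] A(2) by auto
  then obtain m where m: "m \<in> A" "m \<noteq> j" "m \<noteq> l" by auto
  then have mn: "m < n" using A by auto
  let ?as = "sorted_list_of_set (A - {m, l})"
  have set_as: "set ?as \<subseteq> {..<n}" using A by auto
  have d0: "br (d l) (wd m ?as j) = 0" by (rule d_wd) (use m mn A j in auto)
  show ?thesis
  proof (cases "l \<in> A")
    case False
    have "pm (T A j) (wd m ?as j)" by (rule T_wd) (use m A j False in auto)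
    then have "pm (br (d l) (T A j)) (br (d l) (wd m ?as j))" by (rule pm_br)
    then show ?thesis using d0 False by simp
  next
    case True
    obtain c where c: "wd m ?as j \<in> hom c" using wd_hom[OF mn j(1) set_as] by blast
    have N: "br (E m m) (wd m ?as j) = wd m ?as j" by (rule N_wd) (use m mn A j in auto)
    have "pm (T A j) (wd m (l # ?as) j)" by (rule T_wd) (use m A j True in auto)
    then have "pm (br (d l) (T A j)) (br (d l) (wd m (l # ?as) j))" by (rule pm_br)
    also have "br (d l) (wd m (l # ?as) j) = wd m ?as j"
      using jacobi_odd[of "d l" "X l m" "wd m ?as j" c] c d0 N d_M[of l l m m] m mn j
      by (simp add: wd_simps)
    also have "pm (wd m ?as j) (T (A - {l}) j)"
      by (rule pm_sym, rule T_wd) (use m A j True in auto)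
    finally show ?thesis using True by simp
  qed
qed

text \<open>Letters are stripped one by one down to two elements, where \<open>d_T\<close> stops and
  the explicit bracket \<open>d_M\<close> takes over.\<close>

lemma fold_d_T:
  assumes "B \<subseteq> {..<n}" "card B = length ps" "2 \<le> card B" "distinct ps" "set ps \<subseteq> {..<n}" "j < n"
  shows "pm (fold (\<lambda>l. br (d l)) ps (T B j)) (if set ps = B then d j else 0)"
  using assms(1-5)
proof (induction ps arbitrary: B)
  case (Cons l ps)
  have fin [simp]: "finite B" using Cons.prems(1) finite_subset by blast
  show ?case
  proof (cases "card B = 2")
    case True
    then obtain a b where B: "B = {a, b}" "a \<noteq> b" by (meson card_2_iff)
    obtain q where ps: "ps = [q]" using Cons.prems(2) True by (cases ps; cases "tl ps") auto
    have lt: "a < n" "b < n" "l < n" "q < n" "l \<noteq> q" using Cons.prems B ps by auto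
    have "pm (T B j) (M a b j)" using M_T[of a b j] B lt \<open>j < n\<close> by simp
    then have "pm (fold (\<lambda>l. br (d l)) (l # ps) (T B j)) (br (d q) (br (d l) (M a b j)))"
      by (simp add: ps pm_br)
    also have "br (d q) (br (d l) (M a b j)) =
        (if a = l \<and> b = q then d j else 0) - (if b = l \<and> a = q then d j else 0)"
      using lt \<open>j < n\<close> by (simp add: d_M d_E)
    also have "pm \<dots> (if set (l # ps) = B then d j else 0)"
      using B ps by (auto simp: doubleton_eq_iff pm_def)
    finally show ?thesis .
  next
    case False
    then have 3: "3 \<le> card B" using Cons.prems(3) by simp
    have "pm (br (d l) (T B j)) (if l \<in> B then T (B - {l}) j else 0)"
      by (rule d_T[OF Cons.prems(1) 3 \<open>j < n\<close>]) (use Cons.prems in simp)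
    then have "pm (fold (\<lambda>l. br (d l)) (l # ps) (T B j))
        (fold (\<lambda>l. br (d l)) ps (if l \<in> B then T (B - {l}) j else 0))"
      by (simp add: pm_fold)
    also have "pm (fold (\<lambda>l. br (d l)) ps (if l \<in> B then T (B - {l}) j else 0))
        (if set (l # ps) = B then d j else 0)"
    proof (cases "l \<in> B")
      case True
      have "pm (fold (\<lambda>l. br (d l)) ps (T (B - {l}) j)) (if set ps = B - {l} then d j else 0)"
        by (rule Cons.IH) (use Cons.prems True 3 in auto)
      moreover have "set (l # ps) = B \<longleftrightarrow> set ps = B - {l}" using Cons.prems True by auto
      ultimately show ?thesis using True by simp
    next
      case False
      then show ?thesis by (auto simp: fold_br_0)
    qed
    finally show ?thesis .
  qed
qed simp

text \<open>Brackets with all \<open>d l\<close> for l in A send \<theta>_A \<partial>_j to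
  \<plusminus> \<partial>_j and kill the other sets of the same size. The coefficients belonging to
  A thus reappear in a combination of the \<open>d j\<close> and vanish, although independence of
  the \<open>T A j\<close> is not known beforehand.\<close>

theorem T_span_detect:
  assumes "e 0 \<noteq> 0" "2 \<le> r" "x \<in> T_span r"
    and zero: "\<And>ps. distinct ps \<Longrightarrow> length ps = r \<Longrightarrow> set ps \<subseteq> {..<n} \<Longrightarrow>
      fold (\<lambda>l. br (d l)) ps x = 0"
  shows "x = 0"
proof -
  let ?F = "{A. A \<subseteq> {..<n} \<and> card A = r}"
  have fin: "finite ?F" by simp
  then have finI: "finite (?F \<times> {..<n})" by simp
  obtain c where "x = (\<Sum>i\<in>?F \<times> {..<n}. c i *s (case i of (A, j) \<Rightarrow> T A j))"
    using span_family[OF finI assms(3)[unfolded T_span_def]] .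
  then have x: "x = (\<Sum>i\<in>?F \<times> {..<n}. c i *s T (fst i) (snd i))"
    by (simp add: case_prod_beta)
  have "c (A, j) = 0" if A: "A \<in> ?F" and j: "j < n" for A j
  proof -
    define ps where "ps = sorted_list_of_set A"
    have finA: "finite A" using A finite_subset[of A "{..<n}"] by auto
    have ps: "distinct ps" "length ps = r" "set ps = A" "set ps \<subseteq> {..<n}"
      using A finA by (auto simp: ps_def)
    let ?f = "fold (\<lambda>l. br (d l)) ps"
    have T: "pm (?f (T B k)) (if A = B then d k else 0)" if "B \<in> ?F" "k < n" for B k
      using fold_d_T[of B ps k] that ps assms(2) by simp
    define s where "s k = (if ?f (T A k) = d k then 1 else - 1 :: 'k)" for k
    have s: "?f (T A k) = s k *s d k" if "k < n" for k
      using T[OF A that] by (auto simp: pm_def s_def)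
    have "0 = ?f x" using zero[OF ps(1,2,4)] by simp
    also have "\<dots> = (\<Sum>i\<in>?F \<times> {..<n}. c i *s ?f (T (fst i) (snd i)))"
      unfolding x by (rule fold_br_sum)
    also have "\<dots> = (\<Sum>B\<in>?F. \<Sum>k<n. c (B, k) *s ?f (T B k))"
      by (simp add: sum.cartesian_product case_prod_beta)
    also have "\<dots> = (\<Sum>B\<in>?F. if B = A then (\<Sum>k<n. c (A, k) *s ?f (T A k)) else 0)"
    proof (rule sum.cong[OF HOL.refl])
      fix B assume B: "B \<in> ?F"
      have "?f (T B k) = 0" if "B \<noteq> A" "k < n" for k
        using T[OF B that(2)] that(1) by (simp add: pm_0)
      then show "(\<Sum>k<n. c (B, k) *s ?f (T B k)) = (if B = A then (\<Sum>k<n. c (A, k) *s ?f (T A k)) else 0)"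
        by simp
    qed
    also have "\<dots> = (\<Sum>k<n. c (A, k) *s ?f (T A k))" using A fin by (subst sum.delta) auto
    also have "\<dots> = (\<Sum>k<n. (c (A, k) * s k) *s d k)"
      by (rule sum.cong[OF HOL.refl]) (simp add: s)
    finally have "c (A, j) * s j = 0"
      using d_independent[OF assms(1) _ j, of "\<lambda>k. c (A, k) * s k"] by simp
    then show ?thesis by (auto simp: s_def split: if_splits)
  qed
  then show ?thesis unfolding x by (intro sum.neutral) auto
qed

end


section \<open>The grading\<close>

context lie_superalg
begin

lemma span_br2:
  assumes "\<And>a b. a \<in> A \<Longrightarrow> b \<in> B \<Longrightarrow> br a b \<in> S" "subspace S" "x \<in> span A" "y \<in> span B"
  shows "br x y \<in> S"
proof -
  have "br a y \<in> S" if a: "a \<in> A" for a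
    using assms(4)
    by (rule span_induct_alt[of y B "\<lambda>y. br a y \<in> S"])
      (use assms(1,2) a in \<open>auto intro: subspace_0 subspace_add subspace_scale\<close>)
  with assms(3) show ?thesis
    by (rule_tac span_induct_alt[of x A "\<lambda>x. br x y \<in> S"])
      (use assms(2) in \<open>auto intro: subspace_0 subspace_add subspace_scale\<close>)
qed

lemma span_hom: "(\<And>a. a \<in> A \<Longrightarrow> a \<in> hom p) \<Longrightarrow> x \<in> span A \<Longrightarrow> x \<in> hom p"
  using span_minimal[of A "hom p"] subspace_hom by auto

lemma skew_mem: "x \<in> hom p \<Longrightarrow> y \<in> hom q \<Longrightarrow> subspace S \<Longrightarrow> br y x \<in> S \<Longrightarrow> br x y \<in> S"
  using skew[of x p y q] by (simp add: subspace_neg subspace_scale)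

lemma jacobi_mem:
  assumes "x \<in> hom p" "y \<in> hom q" "z \<in> hom r" "subspace S"
  shows "br (br x y) z \<in> S \<Longrightarrow> br y (br x z) \<in> S \<Longrightarrow> br x (br y z) \<in> S"
    and "br x (br y z) \<in> S \<Longrightarrow> br y (br x z) \<in> S \<Longrightarrow> br (br x y) z \<in> S"
proof -
  note J = jacobi[OF assms(1-3)]
  show "br (br x y) z \<in> S \<Longrightarrow> br y (br x z) \<in> S \<Longrightarrow> br x (br y z) \<in> S"
    unfolding J using assms(4) by (simp add: subspace_add subspace_scale)
  have "br (br x y) z = br x (br y z) - koszul_sign p q *s br y (br x z)" unfolding J by simp
  then show "br x (br y z) \<in> S \<Longrightarrow> br y (br x z) \<in> S \<Longrightarrow> br (br x y) z \<in> S"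
    using assms(4) by (simp add: subspace_diff subspace_scale)
qed

end

context w_algebra
begin

section \<open>Graded components and their brackets\<close>

definition d_set :: "'a set" where "d_set = d ` {..<n}"
definition E_set :: "'a set" where "E_set = (\<lambda>(i, j). E i j) ` ({..<n} \<times> {..<n})"
definition M_set :: "'a set" where "M_set = (\<lambda>(i, j, k). M i j k) ` ({..<n} \<times> {..<n} \<times> {..<n})"

lemma d_setI: "i < n \<Longrightarrow> d i \<in> d_set"
  and E_setI: "i < n \<Longrightarrow> j < n \<Longrightarrow> E i j \<in> E_set"
  and M_setI: "i < n \<Longrightarrow> j < n \<Longrightarrow> k < n \<Longrightarrow> M i j k \<in> M_set"
  by (force simp: d_set_def E_set_def M_set_def)+

lemmas d_span = span_base[OF d_setI] and E_span = span_base[OF E_setI] and M_span = span_base[OF M_setI]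

lemma d_setE: "x \<in> d_set \<Longrightarrow> (\<And>i. x = d i \<Longrightarrow> i < n \<Longrightarrow> P) \<Longrightarrow> P"
  and E_setE: "x \<in> E_set \<Longrightarrow> (\<And>i j. x = E i j \<Longrightarrow> i < n \<Longrightarrow> j < n \<Longrightarrow> P) \<Longrightarrow> P"
  and M_setE: "x \<in> M_set \<Longrightarrow> (\<And>i j k. x = M i j k \<Longrightarrow> i < n \<Longrightarrow> j < n \<Longrightarrow> k < n \<Longrightarrow> P) \<Longrightarrow> P"
  by (auto simp: d_set_def E_set_def M_set_def)

text \<open>The component of degree - k, for k \<ge> 1 spanned by right-normed brackets of k
  elements of \<open>M_set\<close>. That this is large enough is what \<open>ev_comp\<close> checks
  for homogeneous terms.\<close>

fun neg :: "nat \<Rightarrow> 'a set" where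
  "neg 0 = span E_set"
| "neg (Suc 0) = span M_set"
| "neg (Suc (Suc k)) = span {br x y | x y. x \<in> M_set \<and> y \<in> neg (Suc k)}"

lemma subspace_neg_comp: "subspace (neg k)"
  by (cases k rule: neg.cases) simp_all

lemma span_neg_comp: "x \<in> span (neg k) \<Longrightarrow> x \<in> neg k"
  using subspace_neg_comp span_eq_iff by blast

lemma d_set_hom: "x \<in> d_set \<Longrightarrow> x \<in> hom 1" and E_set_hom: "x \<in> E_set \<Longrightarrow> x \<in> hom 0"
  and M_set_hom: "x \<in> M_set \<Longrightarrow> x \<in> hom 1"
  by (auto elim!: d_setE E_setE M_setE)

lemma neg_hom: "\<exists>p. \<forall>x\<in>neg k. x \<in> hom p"
proof (induction k rule: neg.induct)
  case 1 show ?case using span_hom[of E_set 0] E_set_hom by auto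
next
  case 2 show ?case using span_hom[of M_set 1] M_set_hom by auto
next
  case (3 k)
  then obtain p where p: "\<And>x. x \<in> neg (Suc k) \<Longrightarrow> x \<in> hom p" by blast
  have "x \<in> hom (1 + p)" if "x \<in> neg (Suc (Suc k))" for x
    using that unfolding neg.simps
    by (rule span_hom[rotated]) (use p M_set_hom hom_br in blast)
  then show ?case by blast
qed

lemma E_neg: "a \<in> E_set \<Longrightarrow> y \<in> neg k \<Longrightarrow> br a y \<in> neg k"
proof (induction k arbitrary: y rule: neg.induct)
  case 1
  from 1(1) obtain i j where a: "a = E i j" "i < n" "j < n" by (rule E_setE)
  have "br a x \<in> span E_set" if "x \<in> E_set" for x
    using that a by (auto elim!: E_setE simp: E_E intro!: span_diff span_neg span_zero E_span)
  then show ?case using 1(2) br_span[of E_set a E_set y] by simp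
next
  case 2
  from 2(1) obtain i j where a: "a = E i j" "i < n" "j < n" by (rule E_setE)
  have "br a x \<in> span M_set" if "x \<in> M_set" for x
    using that a
    by (auto elim!: M_setE simp: E_M intro!: span_diff span_add span_neg span_zero M_span)
  then show ?case using 2(2) br_span[of M_set a M_set y] by simp
next
  case (3 k)
  obtain p where p: "\<And>x. x \<in> neg (Suc k) \<Longrightarrow> x \<in> hom p" using neg_hom[of "Suc k"] by blast
  have M: "br m v \<in> neg (Suc (Suc k))" if "m \<in> span M_set" "v \<in> neg (Suc k)" for m v
    by (rule span_br2[OF _ subspace_neg_comp that(1) span_base[OF that(2)]])
      (auto intro!: span_base)
  have "br a x \<in> neg (Suc (Suc k))" if x: "x \<in> {br x y | x y. x \<in> M_set \<and> y \<in> neg (Suc k)}" for x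
  proof -
    obtain m v where x: "x = br m v" "m \<in> M_set" "v \<in> neg (Suc k)" using x by blast
    from \<open>a \<in> E_set\<close> obtain i j where a: "a = E i j" "i < n" "j < n" by (rule E_setE)
    have "br a m \<in> span M_set"
      using x(2) a
      by (auto elim!: M_setE simp: E_M intro!: span_diff span_add span_neg span_zero M_span)
    then have 1: "br (br a m) v \<in> neg (Suc (Suc k))" using M x(3) by blast
    have "br a v \<in> neg (Suc k)" using "3.IH" "3.prems"(1) x(3) by blast
    then have 2: "br m (br a v) \<in> neg (Suc (Suc k))" using M x(2) span_base by blast
    show ?thesis
      unfolding x(1)
      by (rule jacobi_mem(1)[OF E_set_hom M_set_hom p subspace_neg_comp 1 2]) (use "3.prems" x in auto)
  qed
  then show ?case using "3.prems"(2) br_span unfolding neg.simps by blast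
qed

lemma M_neg: "a \<in> span M_set \<Longrightarrow> y \<in> neg k \<Longrightarrow> br a y \<in> neg (Suc k)"
proof (cases k)
  case 0
  assume *: "a \<in> span M_set" "y \<in> neg k"
  have "br m x \<in> neg 1" if "m \<in> M_set" "x \<in> E_set" for m x
    by (rule skew_mem[OF M_set_hom E_set_hom subspace_neg_comp])
      (use that E_neg[of x m 1] in \<open>auto simp: span_base\<close>)
  then have "br a y \<in> neg 1"
    by (rule span_br2[OF _ subspace_neg_comp]) (use * 0 in auto)
  then show ?thesis using 0 by simp
next
  case (Suc l)
  assume *: "a \<in> span M_set" "y \<in> neg k"
  have "br a y \<in> neg (Suc (Suc l))"
    by (rule span_br2[OF _ subspace_neg_comp *(1) span_base[OF *(2)]])
      (use Suc in \<open>auto intro!: span_base\<close>)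
  then show ?thesis using Suc by simp
qed

lemma d_M_mem: "a \<in> d_set \<Longrightarrow> m \<in> M_set \<Longrightarrow> br a m \<in> span E_set"
  by (auto elim!: d_setE M_setE simp: d_M intro!: span_diff span_neg span_zero E_span)

lemma d_neg: "a \<in> d_set \<Longrightarrow> y \<in> neg (Suc k) \<Longrightarrow> br a y \<in> neg k"
proof (induction k arbitrary: y)
  case 0
  then show ?case using br_span[of M_set a E_set y] d_M_mem by simp
next
  case (Suc k)
  obtain p where p: "\<And>x. x \<in> neg (Suc k) \<Longrightarrow> x \<in> hom p" using neg_hom[of "Suc k"] by blast
  have "br a x \<in> span (neg (Suc k))" if x: "x \<in> {br x y | x y. x \<in> M_set \<and> y \<in> neg (Suc k)}" for x
  proof -
    obtain m v where x: "x = br m v" "m \<in> M_set" "v \<in> neg (Suc k)" using x by blast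
    have 1: "br (br a m) v \<in> neg (Suc k)"
      by (rule span_br2[OF _ subspace_neg_comp d_M_mem span_base[OF x(3)]])
        (use Suc.prems x E_neg in auto)
    have 2: "br m (br a v) \<in> neg (Suc k)" using M_neg[OF span_base[OF x(2)]] Suc x by blast
    have "br a x \<in> neg (Suc k)"
      unfolding x(1)
      by (rule jacobi_mem(1)[OF d_set_hom M_set_hom p subspace_neg_comp 1 2]) (use Suc.prems x in auto)
    then show ?thesis by (rule span_base)
  qed
  then have "br a y \<in> span (neg (Suc k))" using Suc.prems(2) br_span unfolding neg.simps by blast
  then show ?case by (rule span_neg_comp)
qed

lemma neg_neg: "x \<in> neg k \<Longrightarrow> y \<in> neg l \<Longrightarrow> br x y \<in> neg (k + l)"
proof (induction k arbitrary: x y l rule: neg.induct)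
  case 1
  then show ?case using span_br2[of E_set "neg l" "neg l" x y] E_neg subspace_neg_comp span_base by auto
next
  case 2
  then show ?case using M_neg by simp
next
  case (3 k)
  obtain p where p: "\<And>x. x \<in> neg (Suc k) \<Longrightarrow> x \<in> hom p" using neg_hom[of "Suc k"] by blast
  obtain q where q: "\<And>x. x \<in> neg l \<Longrightarrow> x \<in> hom q" using neg_hom[of l] by blast
  have *: "br x y \<in> neg (Suc (Suc k) + l)"
    if x: "x \<in> {br x y | x y. x \<in> M_set \<and> y \<in> neg (Suc k)}" and y: "y \<in> neg l" for x y
  proof -
    obtain m v where x: "x = br m v" "m \<in> M_set" "v \<in> neg (Suc k)" using x by blast
    have 1: "br m (br v y) \<in> neg (Suc (Suc k) + l)"
      using M_neg[OF span_base[OF x(2)] "3.IH"[OF x(3) y]] by simp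
    have 2: "br v (br m y) \<in> neg (Suc (Suc k) + l)"
      using "3.IH"[OF x(3) M_neg[OF span_base[OF x(2)] y]] by simp
    show ?thesis
      unfolding x(1)
      by (rule jacobi_mem(2)[OF M_set_hom p q subspace_neg_comp 1 2]) (use x y in auto)
  qed
  show ?case
    by (rule span_br2[OF * subspace_neg_comp _ span_base[OF "3.prems"(2)]])
      (use "3.prems"(1) in auto)
qed

text \<open>Degrees above 1 vanish since the \<open>d i\<close> commute. Directness of the sum is
  not asserted; \<open>local_ideal_trivial\<close> separates the three local degrees by brackets
  instead.\<close>

definition comp :: "int \<Rightarrow> 'a set" where
  "comp k = (if 2 \<le> k then {0} else if k = 1 then span d_set else neg (nat (- k)))"

lemma subspace_comp: "subspace (comp k)"
  by (simp add: comp_def subspace_neg_comp subspace_single_0)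

lemma comp_br: "x \<in> comp k \<Longrightarrow> y \<in> comp l \<Longrightarrow> br x y \<in> comp (k + l)"
proof -
  assume x: "x \<in> comp k" and y: "y \<in> comp l"
  have dn: "br a b \<in> comp (1 + l)" if a: "a \<in> span d_set" and b: "b \<in> neg (nat (- l))" and "l \<le> 0" for a b l
  proof (cases "l = 0")
    case True
    then have "b \<in> span E_set" using b by simp
    have "br a b \<in> span d_set"
      by (rule span_br2[OF _ subspace_span a \<open>b \<in> span E_set\<close>])
        (auto elim!: d_setE E_setE simp: d_E intro!: span_zero d_span)
    then show ?thesis using True by (simp add: comp_def)
  next
    case False
    then have l: "nat (- l) = Suc (nat (- (1 + l)))" using \<open>l \<le> 0\<close> by simp
    have "br a b \<in> neg (nat (- (1 + l)))"
      by (rule span_br2[OF d_neg subspace_neg_comp a span_base[OF b[unfolded l]]]) auto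
    then show ?thesis using False \<open>l \<le> 0\<close> by (simp add: comp_def)
  qed
  have nd: "br b a \<in> comp (1 + l)" if a: "a \<in> span d_set" and b: "b \<in> neg (nat (- l))" and l: "l \<le> 0" for a b l
  proof -
    obtain q where "b \<in> hom q" using neg_hom b by blast
    moreover have "a \<in> hom 1" using a by (rule span_hom[rotated]) (rule d_set_hom)
    ultimately show ?thesis using skew_mem[OF _ _ subspace_comp dn[OF a b l]] by blast
  qed
  have z: "0 \<in> comp m" for m by (simp add: subspace_comp subspace_0)
  consider "2 \<le> k \<or> 2 \<le> l" | "k = 1" "l = 1" | "k = 1" "l \<le> 0" | "k \<le> 0" "l = 1" | "k \<le> 0" "l \<le> 0"
    by linarith
  then show ?thesis
  proof cases
    case 1
    then have "br x y = 0" using x y by (auto simp: comp_def)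
    then show ?thesis using z by simp
  next
    case 2
    then have "x \<in> span d_set" "y \<in> span d_set" using x y by (auto simp: comp_def)
    then have "br x y \<in> {0}"
      by (rule span_br2[rotated -2]) (auto elim!: d_setE simp: d_d subspace_single_0)
    then show ?thesis using z by simp
  next
    case 3
    then show ?thesis using dn[of x y l] x y by (simp add: comp_def)
  next
    case 4
    then show ?thesis using nd[of y x k] x y by (simp add: comp_def add.commute)
  next
    case 5
    then have "br x y \<in> neg (nat (- k) + nat (- l))" using neg_neg x y by (simp add: comp_def)
    moreover have "nat (- k) + nat (- l) = nat (- (k + l))" using 5 by simp
    ultimately show ?thesis using 5 by (simp add: comp_def)
  qed
qed

lemma gens_comp:
  "e 0 \<in> comp 1" "a \<in> {1..<n} \<Longrightarrow> e a \<in> comp 0" "a \<in> {1..<n} \<Longrightarrow> f a \<in> comp 0"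
  "a < n \<Longrightarrow> a \<noteq> 1 \<Longrightarrow> f0 a \<in> comp (- 1)"
proof -
  show "e 0 \<in> comp 1" using d_setI[of 0] by (simp add: comp_def d.simps span_base)
  show "e a \<in> comp 0" if "a \<in> {1..<n}" for a
    using that E_setI[of "a - 1" a] E_Suc(1)[of "a - 1"] by (auto simp: comp_def intro!: span_base)
  show "f a \<in> comp 0" if "a \<in> {1..<n}" for a
    using that E_setI[of a "a - 1"] E_Suc(2)[of "a - 1"] by (auto simp: comp_def intro!: span_base)
  assume a: "a < n" "a \<noteq> 1"
  show "f0 a \<in> comp (- 1)"
  proof (cases "a = 0")
    case True
    have "(\<Sum>j=1..<n. M 0 j j) \<in> span M_set" by (intro span_sum span_base M_setI) auto
    then show ?thesis using True f0_eq_M(1) by (simp add: comp_def)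
  next
    case False
    have "M 0 (a - 1) (a - 1) - M 0 a a \<in> span M_set"
      by (intro span_diff span_base M_setI) (use a in auto)
    then show ?thesis using False f0_eq_M(2)[of a] a by (simp add: comp_def)
  qed
qed

text \<open>Two brackets with elements \<open>d p\<close> kill v and w and expose the coefficients
  of u; once u = 0, one bracket exposes those of v, and then only w is left. Each time a combination
  of the \<open>d j\<close> lies in K; a nonzero one would yield some \<open>d k\<close> by its
  weight, and then e_0 by E_k0.\<close>

lemma local_ideal_trivial:
  assumes K: "subspace K" and ideal: "\<And>c y x. y \<in> hom c \<Longrightarrow> x \<in> K \<Longrightarrow> br y x \<in> K"
    and e0: "e 0 \<notin> K"
    and uvw: "u \<in> comp (- 1)" "v \<in> comp 0" "w \<in> comp 1" "u + v + w \<in> K"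
  shows "u + v + w = 0"
proof -
  have coeffs: "a k = 0" if a: "(\<Sum>j<n. a j *s d j) \<in> K" and k: "k < n" for a k
  proof (rule ccontr)
    assume nz: "a k \<noteq> 0"
    have "br (E k k) (\<Sum>j<n. a j *s d j) = (\<Sum>j<n. if j = k then - (a k *s d k) else 0)"
      unfolding br_sum_right by (rule sum.cong[OF HOL.refl]) (use k in \<open>simp add: E_d\<close>)
    also have "\<dots> = - (a k *s d k)" using k by simp
    finally have "- (a k *s d k) \<in> K" using ideal[OF _ a] k by (metis E_even)
    then have "(- inverse (a k)) *s (- (a k *s d k)) \<in> K" using K subspace_scale by blast
    then have "d k \<in> K" using nz by simp
    then have "br (E k 0) (d k) \<in> K" using ideal k by (metis E_even n_gt(1))
    then have "- d 0 \<in> K" using E_d[of k 0 k] k by simp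
    then have "- (- d 0) \<in> K" using K subspace_neg by blast
    then show False using e0 by (simp add: d.simps)
  qed
  \<comment> \<open>Only i < j, since M is skew in its first two indices and coefficients over all
    triples would not be determined.\<close>
  let ?I = "{(i, j, k). i < j \<and> j < n \<and> k < n}"
  have finI: "finite ?I"
    by (rule finite_subset[of _ "{..<n} \<times> {..<n} \<times> {..<n}"]) auto
  have "M_set \<subseteq> span ((\<lambda>(i, j, k). M i j k) ` ?I)"
  proof
    fix x assume "x \<in> M_set"
    then obtain i j k where x: "x = M i j k" "i < n" "j < n" "k < n" by (rule M_setE)
    consider "i < j" | "i = j" | "j < i" by linarith
    then show "x \<in> span ((\<lambda>(i, j, k). M i j k) ` ?I)"
    proof cases
      case 1
      then show ?thesis using x by (intro span_base image_eqI[of _ _ "(i, j, k)"]) auto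
    next
      case 2
      then show ?thesis using x M_self span_zero by simp
    next
      case 3
      then have "M j i k \<in> span ((\<lambda>(i, j, k). M i j k) ` ?I)" 
        using x by (intro span_base image_eqI[of _ _ "(j, i, k)"]) auto
      then have "- M j i k \<in> span ((\<lambda>(i, j, k). M i j k) ` ?I)" by (rule span_neg)
      then show ?thesis using M_skew[of i j k] x by simp
    qed
  qed
  then have "span M_set \<subseteq> span ((\<lambda>(i, j, k). M i j k) ` ?I)" by (rule span_minimal) simp
  then have "u \<in> span ((\<lambda>(i, j, k). M i j k) ` ?I)" using uvw(1) by (auto simp: comp_def)
  then obtain cM where u: "u = (\<Sum>t\<in>?I. cM t *s (case t of (i, j, k) \<Rightarrow> M i j k))"
    using span_family[OF finI] by blast
  have finE: "finite ({..<n} \<times> {..<n})" by simp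
  have "v \<in> span ((\<lambda>(i, j). E i j) ` ({..<n} \<times> {..<n}))"
    using uvw(2) by (simp add: comp_def E_set_def)
  then obtain cE where v: "v = (\<Sum>t\<in>{..<n} \<times> {..<n}. cE t *s (case t of (i, j) \<Rightarrow> E i j))"
    using span_family[OF finE] by blast
  have "w \<in> span (d ` {..<n})" using uvw(3) by (simp add: comp_def d_set_def)
  then obtain cd where w: "w = (\<Sum>j<n. cd j *s d j)"
    using span_family[OF finite_lessThan] by blast
  have dv: "br (d p) v = (\<Sum>j<n. cE (p, j) *s d j)" if "p < n" for p
  proof -
    have "br (d p) v = (\<Sum>i<n. \<Sum>j<n. cE (i, j) *s br (d p) (E i j))"
      by (simp add: v br_sum_right sum.cartesian_product case_prod_beta)
    also have "\<dots> = (\<Sum>i<n. if i = p then (\<Sum>j<n. cE (p, j) *s d j) else 0)"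
      by (rule sum.cong[OF HOL.refl]) (use that in \<open>auto simp: d_E\<close>)
    finally show ?thesis using that by simp
  qed
  have dw: "br (d p) w = 0" if "p < n" for p
    unfolding w br_sum_right using that by (simp add: d_d)
  have ddv: "br (d q) (br (d p) v) = 0" if "p < n" "q < n" for p q
    using that by (simp add: dv br_sum_right d_d)
  have u0: "cM (i0, j0, k0) = 0" if i0: "i0 < j0" "j0 < n" "k0 < n" for i0 j0 k0
  proof -
    have "br (d j0) (br (d i0) u) =
      (\<Sum>t\<in>?I. if t \<in> (\<lambda>k. (i0, j0, k)) ` {..<n} then cM t *s d (snd (snd t)) else 0)"
      unfolding u br_sum_right
    proof (rule sum.cong[OF HOL.refl])
      fix t assume "t \<in> ?I"
      then obtain i j k where t: "t = (i, j, k)" "i < j" "j < n" "k < n" by auto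
      have "br (d j0) (br (d i0) (M i j k)) = (if i = i0 \<and> j = j0 then d k else 0)"
        using t i0 by (simp add: d_M d_E br_if)
      then show "br (d j0) (br (d i0) (cM t *s (case t of (i, j, k) \<Rightarrow> M i j k))) =
          (if t \<in> (\<lambda>k. (i0, j0, k)) ` {..<n} then cM t *s d (snd (snd t)) else 0)"
        using t by auto
    qed
    also have "\<dots> = (\<Sum>t\<in>(\<lambda>k. (i0, j0, k)) ` {..<n}. cM t *s d (snd (snd t)))"
      by (rule sum.mono_neutral_cong_right[OF finI]) (use i0 in auto)
    also have "\<dots> = (\<Sum>k<n. cM (i0, j0, k) *s d k)"
      by (subst sum.reindex) (auto simp: inj_on_def)
    finally have "br (d j0) (br (d i0) (u + v + w)) = (\<Sum>k<n. cM (i0, j0, k) *s d k)"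
      using i0 ddv dw by simp
    moreover have "br (d j0) (br (d i0) (u + v + w)) \<in> K"
      using ideal[OF d_odd ideal[OF d_odd uvw(4)]] i0 by simp
    ultimately have "(\<Sum>k<n. cM (i0, j0, k) *s d k) \<in> K" by metis
    then show ?thesis using coeffs[of "\<lambda>k. cM (i0, j0, k)" k0] i0(3) by simp
  qed
  have u: "u = 0" unfolding u by (rule sum.neutral) (use u0 in auto)
  have "cE (i, j) = 0" if "i < n" "j < n" for i j
  proof -
    have "br (d i) (u + v + w) \<in> K" using ideal[OF d_odd uvw(4)] that by simp
    then have "(\<Sum>j<n. cE (i, j) *s d j) \<in> K" using u dv dw that by simp
    then show ?thesis using coeffs[of "\<lambda>j. cE (i, j)" j] that(2) by simp
  qed
  then have v: "v = 0" unfolding v by (intro sum.neutral) auto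
  have "(\<Sum>j<n. cd j *s d j) \<in> K" using uvw(4) u v w by simp
  then have "w = 0" unfolding w using coeffs[of cd] by (intro sum.neutral) auto
  then show ?thesis using u v by simp
qed

end

context w_quotient
begin

section \<open>The negative part lies in the spaces \<open>T_span\<close>\<close>

lemma subspace_T_span: "subspace (T_span r)"
  by (simp add: T_span_def)

lemma X_T_span: "2 \<le> r \<Longrightarrow> v \<in> T_span r \<Longrightarrow> i < n \<Longrightarrow> m < n \<Longrightarrow> i \<noteq> m \<Longrightarrow> br (X i m) v \<in> T_span (Suc r)"
  unfolding T_span_def by (erule br_span[rotated]) (use X_T in \<open>auto simp: T_span_def\<close>)

lemma d_T_span: "3 \<le> Suc r \<Longrightarrow> v \<in> T_span (Suc r) \<Longrightarrow> l < n \<Longrightarrow> br (d l) v \<in> T_span r"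
proof -
  assume r: "3 \<le> Suc r" and v: "v \<in> T_span (Suc r)" and l: "l < n"
  have "br (d l) (T A j) \<in> T_span r" if A: "A \<subseteq> {..<n}" "card A = Suc r" "j < n" for A j
  proof (rule pm_T_span)
    show "pm (br (d l) (T A j)) (if l \<in> A then T (A - {l}) j else 0)"
      by (rule d_T) (use A r l in auto)
    have "finite A" using A(1) finite_subset by blast
    then have "T (A - {l}) j \<in> T_span r" if "l \<in> A"
      by (intro T_in_span) (use A that in auto)
    then show "(if l \<in> A then T (A - {l}) j else 0) \<in> T_span r"
      by (simp add: T_span_def span_zero)
  qed
  then show ?thesis using v unfolding T_span_def by (elim br_span[rotated]) (auto simp: T_span_def)
qed

lemma T_hom: "A \<subseteq> {..<n} \<Longrightarrow> 2 \<le> card A \<Longrightarrow> j < n \<Longrightarrow> \<exists>c. T A j \<in> hom c"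
proof -
  assume A: "A \<subseteq> {..<n}" "2 \<le> card A" "j < n"
  then have fin: "finite A" using finite_subset by blast
  have "A - {j} \<noteq> {}" using A(2) card_mono[of "{j}" A] by auto
  then have "Min (A - {j}) \<in> A - {j}" using fin by (intro Min_in) auto
  then have "Min (A - {j}) < n" using A(1) by auto
  moreover have "set (sorted_list_of_set (A - {Min (A - {j})})) \<subseteq> {..<n}" using fin A(1) by auto
  ultimately show ?thesis unfolding T_def using wd_hom A(3) by blast
qed

lemma M_in_T_span: "a < n \<Longrightarrow> b < n \<Longrightarrow> j < n \<Longrightarrow> M a b j \<in> T_span 2"
proof (cases "a = b")
  case True
  assume "a < n" "b < n" "j < n"
  then show ?thesis using True M_self by (simp add: T_span_def span_zero)
next
  case False
  assume *: "a < n" "b < n" "j < n"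
  show ?thesis
    by (rule pm_T_span[OF pm_sym[OF M_T]], (rule * False)+, rule T_in_span) (use * False in auto)
qed

text \<open>E_im is - [d_m, X_im], so its action follows from those of \<open>d m\<close> and
  \<open>X i m\<close>. Size 2 is separate because \<open>d_T\<close> starts at three elements. In
  the same way the next lemma uses M_abk = [X_ab, E_bk].\<close>

lemma E_T_span:
  assumes "2 \<le> r" "v \<in> T_span r" "i < n" "m < n" "i \<noteq> m"
  shows "br (E i m) v \<in> T_span r"
proof -
  have "br (E i m) (T A j) \<in> T_span r" if A: "A \<subseteq> {..<n}" "card A = r" "j < n" for A j
  proof (cases "r = 2")
    case True
    then obtain a b where ab: "A = {a, b}" "a \<noteq> b" using A(2) card_2_iff by metis
    have "pm (br (E i m) (T A j)) (br (E i m) (M a b j))"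
      using M_T[of a b j] ab A by (intro pm_br) auto
    moreover have "br (E i m) (M a b j) \<in> T_span r"
      using ab A assms True subspace_span[of "_ :: 'a set"] unfolding T_span_def
      by (auto simp: E_M intro!: span_diff span_add span_neg M_in_T_span[unfolded T_span_def] span_zero)
    ultimately show ?thesis by (rule pm_T_span)
  next
    case False
    then have r: "3 \<le> r" using assms(1) by simp
    obtain s where s: "r = Suc s" using r by (cases r) auto
    obtain c where c: "T A j \<in> hom c" using T_hom A assms(1) by blast
    have T: "T A j \<in> T_span r" by (rule T_in_span) (use A in auto)
    have "br (d m) (X i m) = - E i m" using d_M[of m i m m] assms by simp
    then have "- br (E i m) (T A j) = br (d m) (br (X i m) (T A j)) + br (X i m) (br (d m) (T A j))"
      using br_br_odd[of "d m" "X i m" "T A j" c] c assms by simp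
    then have "br (E i m) (T A j) = - (br (d m) (br (X i m) (T A j)) + br (X i m) (br (d m) (T A j)))"
      by (metis minus_minus)
    moreover have 1: "br (d m) (br (X i m) (T A j)) \<in> T_span r"
      by (rule d_T_span[OF _ X_T_span]) (use T r assms in auto)
    moreover have 2: "br (X i m) (br (d m) (T A j)) \<in> T_span r"
      unfolding s by (rule X_T_span[OF _ d_T_span]) (use T r assms s in auto)
    ultimately show ?thesis using subspace_neg[OF subspace_T_span subspace_add[OF subspace_T_span 1 2]] by simp
  qed
  then show ?thesis using assms(2) unfolding T_span_def by (elim br_span[rotated]) (auto simp: T_span_def)
qed

lemma M_T_span:
  assumes "2 \<le> r" "v \<in> T_span r" "a < n" "b < n" "k < n"
  shows "br (M a b k) v \<in> T_span (Suc r)"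
proof -
  consider "a = b" | "a \<noteq> b" "b = k" | "a \<noteq> b" "b \<noteq> k" by blast
  then show ?thesis
  proof cases
    case 1
    then show ?thesis using M_self assms by (simp add: T_span_def span_zero)
  next
    case 2
    then show ?thesis using X_T_span assms by simp
  next
    case 3
    have "br (M a b k) (T A j) \<in> T_span (Suc r)" if A: "A \<subseteq> {..<n}" "card A = r" "j < n" for A j
    proof -
      obtain c where c: "T A j \<in> hom c" using T_hom A assms(1) by blast
      have T: "T A j \<in> T_span r" by (rule T_in_span) (use A in auto)
      have "br (M a b k) (T A j) = br (X a b) (br (E b k) (T A j)) - br (E b k) (br (X a b) (T A j))"
        using X_E[of a b k] br_br_even'[of "X a b" 1 "E b k" "T A j" c] c 3 assms by simp
      moreover have 1: "br (X a b) (br (E b k) (T A j)) \<in> T_span (Suc r)"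
        by (rule X_T_span[OF _ E_T_span]) (use T 3 assms in auto)
      moreover have 2: "br (E b k) (br (X a b) (T A j)) \<in> T_span (Suc r)"
        by (rule E_T_span[OF _ X_T_span]) (use T 3 assms in auto)
      ultimately show ?thesis using subspace_diff[OF subspace_T_span 1 2] by simp
    qed
    then show ?thesis using assms(2) unfolding T_span_def by (elim br_span[rotated]) (auto simp: T_span_def)
  qed
qed

lemma neg_T_span: "x \<in> neg (Suc k) \<Longrightarrow> x \<in> T_span (Suc (Suc k))"
proof (induction k arbitrary: x)
  case 0
  have "M_set \<subseteq> T_span 2" using M_in_T_span by (auto elim!: M_setE)
  then have "span M_set \<subseteq> T_span 2" unfolding T_span_def by (rule span_minimal) simp
  then show ?case using 0 by (auto simp: numeral_2_eq_2)
next
  case (Suc k)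
  have "{br x y | x y. x \<in> M_set \<and> y \<in> neg (Suc k)} \<subseteq> T_span (Suc (Suc (Suc k)))"
  proof clarify
    fix m y assume "m \<in> M_set" "y \<in> neg (Suc k)"
    moreover from this(1) obtain a b c where "m = M a b c" "a < n" "b < n" "c < n" by (rule M_setE)
    ultimately show "br m y \<in> T_span (Suc (Suc (Suc k)))"
      using M_T_span[of "Suc (Suc k)" y a b c] Suc.IH[of y] by simp
  qed
  then have "neg (Suc (Suc k)) \<subseteq> T_span (Suc (Suc (Suc k)))"
    unfolding T_span_def neg.simps by (rule span_minimal) simp
  then show ?case using Suc.prems by blast
qed

text \<open>This transitivity is the reason for maximality: brackets with the \<open>d l\<close> move an ideal element
  of degree below \<open>- 1\<close> up to the local part.\<close>

theorem comp_detect: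
  assumes "e 0 \<noteq> 0" "x \<in> comp (- int (Suc k))"
    and "\<And>ps. length ps = Suc (Suc k) \<Longrightarrow> set ps \<subseteq> {..<n} \<Longrightarrow> fold (\<lambda>l. br (d l)) ps x = 0"
  shows "x = 0"
proof (rule T_span_detect[OF assms(1)])
  have "comp (- int (Suc k)) = neg (Suc k)"
    by (simp only: comp_def minus_minus nat_int) simp
  then show "x \<in> T_span (Suc (Suc k))" using neg_T_span assms(2) by simp
  show "2 \<le> Suc (Suc k)" by simp
  fix ps :: "nat list" assume "length ps = Suc (Suc k)" "set ps \<subseteq> {..<n}"
  then show "fold (\<lambda>l. br (d l)) ps x = 0" by (rule assms(3))
qed

end


section \<open>Presented Lie superalgebras\<close>

primrec ev :: "('k \<Rightarrow> 'a \<Rightarrow> 'a) \<Rightarrow> ('a \<Rightarrow> 'a \<Rightarrow> 'a) \<Rightarrow> ('g \<Rightarrow> 'a) \<Rightarrow> ('g, 'k) lie_term \<Rightarrow> 'a::ab_group_add"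
  where
  "ev s b g (Gen x) = g x"
| "ev s b g Zero = 0"
| "ev s b g (Plus t u) = ev s b g t + ev s b g u"
| "ev s b g (Scale c t) = s c (ev s b g t)"
| "ev s b g (Br t u) = b (ev s b g t) (ev s b g u)"

lemma ev_funpow: "ev s b g ((Br t ^^ k) u) = (b (ev s b g t) ^^ k) (ev s b g u)"
  by (induction k) simp_all

lemma ev_elem_h:
  "ev s b g (elem_h a) = cartan b (\<lambda>a. g (E_gen a)) (\<lambda>a. g (F_gen a)) (\<lambda>a. g (F0_gen a)) a"
  by (simp add: elem_h_def cartan_def)

context lie_superalg
begin

lemma ev_hom:
  assumes "\<And>x. x \<in> X \<Longrightarrow> g x \<in> hom (par x)" "homogeneous par p t" "t \<in> lie_terms X"
  shows "ev sc br g t \<in> hom p"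
  using assms(2,3) by (induction) (auto simp: lie_terms_def intro: assms(1) hom_br)

text \<open>One statement for two purposes: K = {0} gives homomorphisms out of a presented algebra,
  and K the lift of an ideal shows that the ideal contains whatever additional relations force to
  vanish. Closure is asked against values of terms, because the ambient type may be larger than the
  algebra.\<close>

lemma ev_sound_mod:
  assumes g: "\<And>x. x \<in> X \<Longrightarrow> g x \<in> hom (par x)"
    and K: "subspace K"
    and ideal: "\<And>x t. x \<in> K \<Longrightarrow> t \<in> lie_terms X \<Longrightarrow> br (ev sc br g t) x \<in> K \<and> br x (ev sc br g t) \<in> K"
    and R: "\<And>l r. (l, r) \<in> R \<Longrightarrow> l \<in> lie_terms X \<Longrightarrow> r \<in> lie_terms X \<Longrightarrow>
      ev sc br g l - ev sc br g r \<in> K"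
  shows "lie_eq X par R s t \<Longrightarrow> ev sc br g s - ev sc br g t \<in> K"
proof (induction rule: lie_eq.induct)
  case (sym x y)
  then show ?case using subspace_neg[OF K] by fastforce
next
  case (trans x y z)
  then show ?case using subspace_add[OF K] by fastforce
next
  case (cong_Plus x x' y y')
  then show ?case using subspace_add[OF K cong_Plus.IH] by (simp add: algebra_simps)
next
  case (cong_Scale x x' c)
  then show ?case using subspace_scale[OF K cong_Scale.IH] by (simp add: scale_right_diff_distrib)
next
  case (cong_Br x x' y y')
  have "y \<in> lie_terms X" "x' \<in> lie_terms X"
    using cong_Br.hyps lie_eq_imp_lie_terms by blast+
  then have "br (ev sc br g x - ev sc br g x') (ev sc br g y) + br (ev sc br g x') (ev sc br g y - ev sc br g y') \<in> K"
    using ideal cong_Br.IH subspace_add[OF K] by blast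
  then show ?case by simp
next
  case (add_scale x c d)
  then show ?case using subspace_0[OF K] by (simp add: scale_left_distrib)
next
  case (scale_add x y c)
  then show ?case using subspace_0[OF K] by (simp add: scale_right_distrib)
next
  case (skew x y p q)
  show ?case
    using lie_superalg.skew[OF lie_superalg_axioms ev_hom[OF g skew(3,1)] ev_hom[OF g skew(4,2)]]
      subspace_0[OF K] by simp
next
  case (jacobi x y z p q r)
  show ?case
    using lie_superalg.jacobi[OF lie_superalg_axioms ev_hom[OF g jacobi(4,1)]
        ev_hom[OF g jacobi(5,2)] ev_hom[OF g jacobi(6,3)]] subspace_0[OF K] by simp
next
  case (relation x y)
  then show ?case using R by simp
qed (use subspace_0[OF K] in \<open>simp_all add: add_ac\<close>)

lemma ev_sound:
  assumes g: "\<And>x. x \<in> X \<Longrightarrow> g x \<in> hom (par x)"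
    and R: "\<And>l r. (l, r) \<in> R \<Longrightarrow> l \<in> lie_terms X \<Longrightarrow> r \<in> lie_terms X \<Longrightarrow> ev sc br g l = ev sc br g r"
    and "lie_eq X par R s t"
  shows "ev sc br g s = ev sc br g t"
  using ev_sound_mod[of X g par "{0}" R s t] assms by (simp add: subspace_single_0)

lemma w_algebra_ev:
  assumes n: "2 \<le> n" and g: "\<And>x. x \<in> w_gens n \<Longrightarrow> g x \<in> hom (w_parity x)"
    and R: "\<And>l r. (l, r) \<in> w_relations n \<Longrightarrow> ev sc br g l = ev sc br g r"
  shows "w_algebra sc br hom n (\<lambda>a. g (E_gen a)) (\<lambda>a. g (F_gen a)) (\<lambda>a. g (F0_gen a))"
proof (unfold_locales)
  note defs = w_gens_def e_index_def f_index_def f0_index_def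
  note evs = ev_funpow ev_elem_h
  show "2 \<le> n" by (rule n)
  show "g (E_gen 0) \<in> hom 1" using g[of "E_gen 0"] n by (auto simp: defs)
  fix a b
  show "g (E_gen a) \<in> hom 0" if "a \<in> {1..<n}" using g[of "E_gen a"] that by (auto simp: defs)
  show "g (F_gen a) \<in> hom 0" if "a \<in> {1..<n}" using g[of "F_gen a"] that by (auto simp: defs)
  show "g (F0_gen a) \<in> hom 1" if "a < n" "a \<noteq> 1" using g[of "F0_gen a"] that by (auto simp: defs)
  let ?h = "cartan br (\<lambda>a. g (E_gen a)) (\<lambda>a. g (F_gen a)) (\<lambda>a. g (F0_gen a))"
  show "br (?h a) (g (E_gen b)) = of_int (B_mat a b) *s g (E_gen b)" if "a < n" "b < n"
    using R[OF R1_he[of a n b]] that by (simp add: defs evs)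
  show "br (?h a) (g (F_gen b)) = (- of_int (B_mat a b)) *s g (F_gen b)" if "a < n" "b \<in> {1..<n}"
    using R[OF R1_hf[of a n b]] that by (simp add: defs evs)
  show "br (g (E_gen a)) (g (F_gen b)) = (if a = b then ?h b else 0)" if "a < n" "b \<in> {1..<n}"
    using R[OF R1_ef[of a n b]] that by (simp add: defs evs split: if_splits)
  show "(br (g (E_gen a)) ^^ nat (1 - B_mat a b)) (g (E_gen b)) = 0" if "a < n" "b < n" "a \<noteq> b"
    using R[OF R2_e[of a n b]] that by (simp add: defs evs)
  show "(br (g (F_gen a)) ^^ nat (1 - B_mat a b)) (g (F_gen b)) = 0"
    if "a \<in> {1..<n}" "b \<in> {1..<n}" "a \<noteq> b"
    using R[OF R2_f[of a n b]] that by (simp add: defs evs)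
  show "br (?h a) (g (F0_gen b)) = (- of_int (B_mat a 0)) *s g (F0_gen b)" if "a < n" "b < n" "b \<noteq> 1"
    using R[OF R4[of a n b]] that by (simp add: defs evs)
  show "br (g (E_gen 1)) (g (F0_gen a)) = 0" if "a < n" "a \<noteq> 1"
    using R[OF R5[of a n]] that by (simp add: defs evs)
  show "br (g (E_gen a)) (br (g (E_gen a)) (g (F0_gen b))) = 0" if "a < n" "b < n" "b \<noteq> 1"
    using R[OF R6_e[of a n b]] that by (simp add: defs evs)
  show "br (g (F_gen a)) (br (g (F_gen a)) (g (F0_gen b))) = 0" if "a \<in> {1..<n}" "b < n" "b \<noteq> 1"
    using R[OF R6_f[of a n b]] that by (simp add: defs evs)
  fix i j
  show "br (g (E_gen i)) (br (g (F_gen j)) (g (F0_gen a))) =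
      (if i = j then of_int (B_mat a j) *s g (F0_gen j) else 0)"
    if "i \<in> {2..<n}" "j \<in> {2..<n}" "a < n" "a \<noteq> 1"
    using R[OF R7[of i n j a]] that by (simp add: defs evs split: if_splits)
qed

lemma w_quotient_ev:
  assumes n: "2 \<le> n" and g: "\<And>x. x \<in> w_gens n \<Longrightarrow> g x \<in> hom (w_parity x)"
    and R: "\<And>l r. (l, r) \<in> w_relations n \<Longrightarrow> ev sc br g l = ev sc br g r"
    and J: "\<And>t. t \<in> J_generators n \<Longrightarrow> ev sc br g t = 0"
  shows "w_quotient sc br hom n (\<lambda>a. g (E_gen a)) (\<lambda>a. g (F_gen a)) (\<lambda>a. g (F0_gen a))"
proof -
  interpret w_algebra sc br hom n "\<lambda>a. g (E_gen a)" "\<lambda>a. g (F_gen a)" "\<lambda>a. g (F0_gen a)"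
    by (rule w_algebra_ev[OF n g R])
  show ?thesis
  proof unfold_locales
    fix a b
    show "br (g (F0_gen a)) (g (F0_gen b)) = 0" if "a < n" "a \<noteq> 1" "b < n" "b \<noteq> 1"
      using J[OF J_generators.intros(1)[of a n b]] that by (simp add: f0_index_def)
  next
    fix i j
    show "br (g (F0_gen i)) (br (g (F_gen 1)) (g (F0_gen j))) = 0" if "i \<in> {3..<n}" "j \<in> {3..<n}"
      using J[OF J_generators.intros(2)[of i n j]] that by simp
  next
    fix i
    show "br (g (F0_gen 2) - g (F0_gen 0)) (br (g (F_gen 1)) (g (F0_gen i))) = 0" if "i \<in> {3..<n}"
      using J[OF J_generators.intros(3)[of i n]] that by simp
  qed
qed

end

section \<open>One type containing all presented algebras\<close>

type_synonym ('g, 'k) presentation =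
  "'g set \<times> ('g \<Rightarrow> bit) \<times> (('g, 'k) lie_term \<times> ('g, 'k) lie_term) set"

definition pres_eq :: "('g, 'k::field) presentation \<Rightarrow> ('g, 'k) lie_term \<Rightarrow> ('g, 'k) lie_term \<Rightarrow> bool"
  where "pres_eq P = lie_eq (fst P) (fst (snd P)) (snd (snd P))"

definition family_eq ::
  "(('g, 'k::field) presentation \<Rightarrow> ('g, 'k) lie_term) \<Rightarrow> (('g, 'k) presentation \<Rightarrow> ('g, 'k) lie_term) \<Rightarrow> bool"
  where "family_eq F G \<longleftrightarrow> (\<forall>P. pres_eq P (F P) (G P))"

text \<open>A quotient type cannot depend on the presentation. The product of all presented Lie
  superalgebras with generators in a given type is a single type in which each of them embeds.\<close>

quotient_type (overloaded) ('g, 'k) family = "('g, 'k::field) presentation \<Rightarrow> ('g, 'k) lie_term" /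
  partial: family_eq
proof (rule part_equivpI)
  show "\<exists>F. family_eq F F"
    by (rule exI[of _ "\<lambda>_. Zero"]) (simp add: family_eq_def pres_eq_def lie_eq.refl lie_terms_def)
  show "symp family_eq"
    by (auto simp: symp_def family_eq_def pres_eq_def intro: lie_eq.sym)
  show "transp family_eq"
    unfolding transp_def family_eq_def pres_eq_def by (blast intro: lie_eq.trans)
qed

lemma Zero_lie_term: "Zero \<in> lie_terms X"
  by (simp add: lie_terms_def)

lemma lie_eq_terms: "lie_eq X par R x y \<Longrightarrow> x \<in> lie_terms X" "lie_eq X par R x y \<Longrightarrow> y \<in> lie_terms X"
  using lie_eq_imp_lie_terms by blast+

lemma lie_terms_simps [simp]:
  "Plus x y \<in> lie_terms X \<longleftrightarrow> x \<in> lie_terms X \<and> y \<in> lie_terms X"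
  "Scale c x \<in> lie_terms X \<longleftrightarrow> x \<in> lie_terms X"
  "Br x y \<in> lie_terms X \<longleftrightarrow> x \<in> lie_terms X \<and> y \<in> lie_terms X"
  "Gen g \<in> lie_terms X \<longleftrightarrow> g \<in> X"
  by (auto simp: lie_terms_def)

lemma pres_eq_refl: "t \<in> lie_terms (fst P) \<Longrightarrow> pres_eq P t t"
  unfolding pres_eq_def by (rule lie_eq.refl)

lemma family_eqI: "(\<And>P. pres_eq P (F P) (G P)) \<Longrightarrow> family_eq F G"
  by (simp add: family_eq_def)

lemma family_eq_term: "family_eq F F \<Longrightarrow> F P \<in> lie_terms (fst P)"
  unfolding family_eq_def pres_eq_def by (blast dest: lie_eq_terms(1))

instantiation family :: (type, field) ab_group_add
begin

lift_definition zero_family :: "('a, 'b) family" is "\<lambda>_. Zero"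
  by (simp add: family_eq_def pres_eq_refl Zero_lie_term)

lift_definition plus_family :: "('a, 'b) family \<Rightarrow> ('a, 'b) family \<Rightarrow> ('a, 'b) family"
  is "\<lambda>F G P. Plus (F P) (G P)"
  by (simp add: family_eq_def pres_eq_def lie_eq.cong_Plus)

lift_definition uminus_family :: "('a, 'b) family \<Rightarrow> ('a, 'b) family" is "\<lambda>F P. Scale (- 1) (F P)"
  by (simp add: family_eq_def pres_eq_def lie_eq.cong_Scale)

lift_definition minus_family :: "('a, 'b) family \<Rightarrow> ('a, 'b) family \<Rightarrow> ('a, 'b) family"
  is "\<lambda>F G P. Plus (F P) (Scale (- 1) (G P))"
  by (simp add: family_eq_def pres_eq_def lie_eq.cong_Plus lie_eq.cong_Scale)

instance
proof
  fix a b c :: "('a, 'b) family"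
  show "a + b + c = a + (b + c)"
    by transfer (rule family_eqI, unfold pres_eq_def, (rule lie_eq.add_assoc; erule family_eq_term))
  show comm: "a + b = b + a" for a b :: "('a, 'b) family"
    by transfer (rule family_eqI, unfold pres_eq_def, (rule lie_eq.add_commute; erule family_eq_term))
  have "a + 0 = a"
    by transfer (rule family_eqI, unfold pres_eq_def, (rule lie_eq.add_zero; erule family_eq_term))
  then show "0 + a = a" using comm[of 0 a] by simp
  have "a + - a = 0"
    by transfer (rule family_eqI, unfold pres_eq_def, (rule lie_eq.add_inverse; erule family_eq_term))
  then show "- a + a = 0" using comm[of "- a" a] by simp
  show "a - b = a + - b"
    by transfer (rule family_eqI, unfold pres_eq_def, rule lie_eq.refl, simp add: family_eq_term)
qed

end

lift_definition fscale :: "'k::field \<Rightarrow> ('g, 'k) family \<Rightarrow> ('g, 'k) family" is "\<lambda>c F P. Scale c (F P)"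
  by (simp add: family_eq_def pres_eq_def lie_eq.cong_Scale)

lift_definition fbr :: "('g, 'k::field) family \<Rightarrow> ('g, 'k) family \<Rightarrow> ('g, 'k) family"
  is "\<lambda>F G P. Br (F P) (G P)"
  by (simp add: family_eq_def pres_eq_def lie_eq.cong_Br)

lift_definition emb :: "('g, 'k::field) presentation \<Rightarrow> ('g, 'k) lie_term \<Rightarrow> ('g, 'k) family"
  is "\<lambda>P t Q. if Q = P \<and> t \<in> lie_terms (fst P) then t else Zero"
  by (auto simp: family_eq_def pres_eq_def Zero_lie_term intro: lie_eq.refl)

lemma family_linear:
  "fscale c (x + y) = fscale c x + fscale c y" "fscale (c + d) x = fscale c x + fscale d x"
  "fscale c (fscale d x) = fscale (c * d) x" "fscale 1 x = x"
  "fbr (x + y) z = fbr x z + fbr y z" "fbr x (y + z) = fbr x y + fbr x z"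
  "fbr (fscale c x) y = fscale c (fbr x y)" "fbr x (fscale c y) = fscale c (fbr x y)"
proof -
  show "fscale c (x + y) = fscale c x + fscale c y"
    by transfer (rule family_eqI, unfold pres_eq_def, (rule lie_eq.scale_add; erule family_eq_term))
  show "fscale (c + d) x = fscale c x + fscale d x"
    by transfer (rule family_eqI, unfold pres_eq_def, (rule lie_eq.add_scale; erule family_eq_term))
  show "fscale c (fscale d x) = fscale (c * d) x"
    by transfer (rule family_eqI, unfold pres_eq_def, (rule lie_eq.scale_scale; erule family_eq_term))
  show "fscale 1 x = x"
    by transfer (rule family_eqI, unfold pres_eq_def, (rule lie_eq.scale_one; erule family_eq_term))
  show "fbr (x + y) z = fbr x z + fbr y z"
    by transfer (rule family_eqI, unfold pres_eq_def, (rule lie_eq.Br_add_left; erule family_eq_term))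
  show "fbr x (y + z) = fbr x y + fbr x z"
    by transfer (rule family_eqI, unfold pres_eq_def, (rule lie_eq.Br_add_right; erule family_eq_term))
  show "fbr (fscale c x) y = fscale c (fbr x y)"
    by transfer (rule family_eqI, unfold pres_eq_def, (rule lie_eq.Br_scale_left; erule family_eq_term))
  show "fbr x (fscale c y) = fscale c (fbr x y)"
    by transfer (rule family_eqI, unfold pres_eq_def, (rule lie_eq.Br_scale_right; erule family_eq_term))
qed

interpretation family: vector_space "fscale :: 'k::field \<Rightarrow> ('g, 'k) family \<Rightarrow> _"
  by unfold_locales (rule family_linear)+

lemma emb_eq_iff:
  "s \<in> lie_terms (fst P) \<Longrightarrow> t \<in> lie_terms (fst P) \<Longrightarrow> emb P s = emb P t \<longleftrightarrow> pres_eq P s t"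
  by transfer (auto simp: family_eq_def pres_eq_def Zero_lie_term intro: lie_eq.refl)

text \<open>At presentations other than P the family \<open>emb P t\<close> is Zero, so
  \<open>emb P\<close> can respect the operations only if Zero is stable under each of them. That
  scaling by 0 gives Zero is derived from 1 + (- 1) = 0.\<close>

lemma lie_eq_Zero:
  "lie_eq X par R Zero (Plus Zero Zero)" "lie_eq X par R Zero (Scale c Zero)"
  "lie_eq X par R Zero (Br Zero Zero)"
proof -
  note [trans] = lie_eq.trans
  show "lie_eq X par R Zero (Plus Zero Zero)"
    by (rule lie_eq.sym[OF lie_eq.add_zero]) (rule Zero_lie_term)
  have z0: "lie_eq X par R (Scale 0 t) Zero" if t: "t \<in> lie_terms X" for t
  proof -
    have "lie_eq X par R (Scale (1 + (- 1)) t) (Plus (Scale 1 t) (Scale (- 1) t))"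
      by (rule lie_eq.add_scale[OF t])
    also have "lie_eq X par R (Plus (Scale 1 t) (Scale (- 1) t)) (Plus t (Scale (- 1) t))"
      by (intro lie_eq.cong_Plus lie_eq.scale_one lie_eq.refl) (simp_all add: t)
    also have "lie_eq X par R (Plus t (Scale (- 1) t)) Zero" by (rule lie_eq.add_inverse[OF t])
    finally show ?thesis by simp
  qed
  have zz: "lie_eq X par R (Scale 0 Zero) Zero" by (rule z0[OF Zero_lie_term])
  have "lie_eq X par R (Scale c Zero) (Scale c (Scale 0 Zero))"
    by (rule lie_eq.cong_Scale[OF lie_eq.sym[OF zz]])
  also have "lie_eq X par R (Scale c (Scale 0 Zero)) (Scale (c * 0) Zero)"
    by (rule lie_eq.scale_scale[OF Zero_lie_term])
  finally show "lie_eq X par R Zero (Scale c Zero)"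
    using zz by (auto intro: lie_eq.sym lie_eq.trans)
  have "lie_eq X par R (Br Zero Zero) (Br (Scale 0 Zero) Zero)"
    by (rule lie_eq.cong_Br[OF lie_eq.sym[OF zz] lie_eq.refl[OF Zero_lie_term]])
  also have "lie_eq X par R (Br (Scale 0 Zero) Zero) (Scale 0 (Br Zero Zero))"
    by (rule lie_eq.Br_scale_left[OF Zero_lie_term Zero_lie_term])
  also have "lie_eq X par R (Scale 0 (Br Zero Zero)) Zero" by (rule z0) (simp add: Zero_lie_term)
  finally show "lie_eq X par R Zero (Br Zero Zero)" by (rule lie_eq.sym)
qed

lemma emb_Zero: "emb P Zero = 0"
  by transfer (rule family_eqI, simp add: pres_eq_refl Zero_lie_term)

lemma emb_Plus: "s \<in> lie_terms (fst P) \<Longrightarrow> t \<in> lie_terms (fst P) \<Longrightarrow>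
    emb P (Plus s t) = emb P s + emb P t"
  by transfer (rule family_eqI, simp add: pres_eq_refl, simp add: pres_eq_def lie_eq_Zero)

lemma emb_Scale: "s \<in> lie_terms (fst P) \<Longrightarrow> emb P (Scale c s) = fscale c (emb P s)"
  by transfer (rule family_eqI, simp add: pres_eq_refl, simp add: pres_eq_def lie_eq_Zero)

lemma emb_Br: "s \<in> lie_terms (fst P) \<Longrightarrow> t \<in> lie_terms (fst P) \<Longrightarrow>
    emb P (Br s t) = fbr (emb P s) (emb P t)"
  by transfer (rule family_eqI, simp add: pres_eq_refl, simp add: pres_eq_def lie_eq_Zero)

lemmas emb_simps = emb_Zero emb_Plus emb_Scale emb_Br

text \<open>The parity components of one factor inside the product. They need not span the type,
  which is why \<open>lie_superalg\<close> states its sign rules for homogeneous elements and never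
  splits an arbitrary element.\<close>

definition fhom :: "('g, 'k::field) presentation \<Rightarrow> bit \<Rightarrow> ('g, 'k) family set" where
  "fhom P p = emb P ` {t \<in> lie_terms (fst P). homogeneous (fst (snd P)) p t}"

lemma family_superalg:
  "lie_superalg fscale fbr (fhom (P :: ('g, 'k::field_char_0) presentation))"
proof (unfold_locales)
  fix p q r :: bit and x y z :: "('g, 'k) family" and c :: 'k
  have zero: "0 \<in> fhom P p"
    unfolding fhom_def
    by (rule image_eqI[of _ _ Zero]) (auto simp: emb_Zero
        Zero_lie_term homogeneous.Zero)
  show "family.subspace (fhom P p)"
  proof (rule family.subspaceI[OF zero])
    show "a + b \<in> fhom P p" if ab: "a \<in> fhom P p" "b \<in> fhom P p" for a b
    proof -
      obtain s t where "a = emb P s" "b = emb P t" "s \<in> lie_terms (fst P)" "t \<in> lie_terms (fst P)"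
        "homogeneous (fst (snd P)) p s" "homogeneous (fst (snd P)) p t"
        using ab by (auto simp: fhom_def)
      then show ?thesis
        unfolding fhom_def by (intro image_eqI[of _ _ "Plus s t"])
          (auto simp: emb_simps homogeneous.Plus)
    qed
    show "fscale d a \<in> fhom P p" if a: "a \<in> fhom P p" for d a
    proof -
      obtain s where "a = emb P s" "s \<in> lie_terms (fst P)" "homogeneous (fst (snd P)) p s"
        using a by (auto simp: fhom_def)
      then show ?thesis
        unfolding fhom_def by (intro image_eqI[of _ _ "Scale d s"])
          (auto simp: emb_simps homogeneous.Scale)
    qed
  qed
  show "fbr x y \<in> fhom P (p + q)" if xy: "x \<in> fhom P p" "y \<in> fhom P q"
  proof -
    obtain s t where st: "x = emb P s" "y = emb P t" "s \<in> lie_terms (fst P)" "t \<in> lie_terms (fst P)"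
      "homogeneous (fst (snd P)) p s" "homogeneous (fst (snd P)) q t"
      using xy by (auto simp: fhom_def)
    then have "Br s t \<in> {t \<in> lie_terms (fst P). homogeneous (fst (snd P)) (p + q) t}"
      by (intro CollectI conjI homogeneous.Br) simp_all
    then show ?thesis
      unfolding fhom_def by (rule image_eqI[rotated]) (use st in \<open>simp add: emb_simps\<close>)
  qed
  show "fbr x y = fscale (- koszul_sign p q) (fbr y x)" if xy: "x \<in> fhom P p" "y \<in> fhom P q"
  proof -
    obtain s t where st: "x = emb P s" "y = emb P t" "s \<in> lie_terms (fst P)" "t \<in> lie_terms (fst P)"
      "homogeneous (fst (snd P)) p s" "homogeneous (fst (snd P)) q t"
      using xy by (auto simp: fhom_def)
    then have "pres_eq P (Br s t) (Scale (- koszul_sign p q) (Br t s))"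
      unfolding pres_eq_def by (intro lie_eq.skew)
    then have "emb P (Br s t) = emb P (Scale (- koszul_sign p q) (Br t s))"
      using st by (subst emb_eq_iff) auto
    then show ?thesis using st by (simp add: emb_simps)
  qed
  show "fbr x (fbr y z) = fbr (fbr x y) z + fscale (koszul_sign p q) (fbr y (fbr x z))"
    if xyz: "x \<in> fhom P p" "y \<in> fhom P q" "z \<in> fhom P r"
  proof -
    obtain s t u where st: "x = emb P s" "y = emb P t" "z = emb P u" "s \<in> lie_terms (fst P)"
      "t \<in> lie_terms (fst P)" "u \<in> lie_terms (fst P)" "homogeneous (fst (snd P)) p s"
      "homogeneous (fst (snd P)) q t" "homogeneous (fst (snd P)) r u"
      using xyz by (auto simp: fhom_def)
    then have "pres_eq P (Br s (Br t u))
        (Plus (Br (Br s t) u) (Scale (koszul_sign p q) (Br t (Br s u))))"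
      unfolding pres_eq_def by (intro lie_eq.jacobi)
    then have "emb P (Br s (Br t u)) =
        emb P (Plus (Br (Br s t) u) (Scale (koszul_sign p q) (Br t (Br s u))))"
      using st by (subst emb_eq_iff) auto
    then show ?thesis using st by (simp add: emb_simps)
  qed
qed (rule family_linear)+

lemma ev_emb: "t \<in> lie_terms (fst P) \<Longrightarrow> ev fscale fbr (\<lambda>x. emb P (Gen x)) t = emb P t"
  by (induction t) (auto simp: emb_simps emb_Zero)


section \<open>The Grassmann model\<close>

text \<open>A vector assigns a coefficient to every set of naturals, without a bound n and without
  finiteness, so that the type depends on the field alone. Multiplication and derivation still make
  sense because their sign counts only the indices below i.\<close>

typedef (overloaded) 'k endo = "{f :: (nat set \<Rightarrow> 'k::field) \<Rightarrow> nat set \<Rightarrow> 'k.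
    (\<forall>u v. f (\<lambda>A. u A + v A) = (\<lambda>A. f u A + f v A)) \<and> (\<forall>c u. f (\<lambda>A. c * u A) = (\<lambda>A. c * f u A))}"
  by (rule exI[of _ id]) auto

setup_lifting type_definition_endo

instantiation endo :: (field) ring_1
begin

lift_definition zero_endo :: "'a endo" is "\<lambda>u A. 0" by simp
lift_definition one_endo :: "'a endo" is "\<lambda>u. u" by simp
lift_definition plus_endo :: "'a endo \<Rightarrow> 'a endo \<Rightarrow> 'a endo" is "\<lambda>f g u A. f u A + g u A"
  by (simp add: algebra_simps)
lift_definition uminus_endo :: "'a endo \<Rightarrow> 'a endo" is "\<lambda>f u A. - f u A" by simp
lift_definition minus_endo :: "'a endo \<Rightarrow> 'a endo \<Rightarrow> 'a endo" is "\<lambda>f g u A. f u A - g u A"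
  by (simp add: algebra_simps)
lift_definition times_endo :: "'a endo \<Rightarrow> 'a endo \<Rightarrow> 'a endo" is "\<lambda>f g u. f (g u)" by simp

instance
proof
  show "(0::'a endo) \<noteq> 1"
    by transfer (metis zero_neq_one)
qed (transfer; simp add: algebra_simps)+

end

lift_definition esc :: "'k::field \<Rightarrow> 'k endo \<Rightarrow> 'k endo" is "\<lambda>c f u A. c * f u A"
  by (simp add: algebra_simps)

interpretation endo: vector_space "esc :: 'k::field \<Rightarrow> _"
  by unfold_locales (transfer; simp add: algebra_simps)+

lemma esc_mult [simp]: "esc c x * y = esc c (x * y)" "x * esc c y = esc c (x * y)"
  by (transfer; simp)+

declare endo.scale_zero_left [simp] endo.scale_zero_right [simp] endo.scale_one [simp]
  endo.scale_minus_left [simp] endo.scale_minus_right [simp] endo.scale_scale [simp]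

section \<open>The operators \<theta>_i and \<partial>_i and their signs\<close>

definition sg :: "nat \<Rightarrow> nat set \<Rightarrow> 'k::field" where "sg i A = (- 1) ^ card {a \<in> A. a < i}"

lemma sg_square [simp]: "sg i A * sg i A = 1" "sg i A * (sg i A * x) = x"
  by (simp_all add: sg_def flip: power_add mult.assoc)

lemma sg_other: "i \<le> j \<Longrightarrow> sg i (A - {j}) = sg i A" "i \<le> j \<Longrightarrow> sg i (insert j A) = sg i A"
  unfolding sg_def by (intro arg_cong[where f = "\<lambda>B. (- 1) ^ card B"]; auto)+

lemma sg_insert: "i < j \<Longrightarrow> i \<notin> A \<Longrightarrow> sg j (insert i A) = - (sg j A :: 'k::field)"
proof -
  assume "i < j" "i \<notin> A"
  then have "{a \<in> insert i A. a < j} = insert i {a \<in> A. a < j}" by auto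
  moreover have "finite {a \<in> A. a < j}" by simp
  ultimately show ?thesis using \<open>i \<notin> A\<close> by (simp add: sg_def)
qed

lemma sg_remove: "i < j \<Longrightarrow> i \<in> A \<Longrightarrow> sg j (A - {i}) = - (sg j A :: 'k::field)"
  using sg_insert[of i j "A - {i}", where 'k='k] by (simp add: insert_absorb)

text \<open>Multiplication by \<open>\<theta>\<^sub>i\<close> and the derivation \<open>\<partial>\<^sub>i\<close> on the Grassmann algebra, an element of
  which is given by its coefficients at the monomials \<open>\<theta>\<^sub>A\<close>.\<close>

lift_definition th :: "nat \<Rightarrow> 'k::field endo"
  is "\<lambda>i u A. if i \<in> A then sg i A * u (A - {i}) else 0"
  by (auto simp: algebra_simps)

lift_definition dd :: "nat \<Rightarrow> 'k::field endo"
  is "\<lambda>i u A. if i \<in> A then 0 else sg i A * u (insert i A)"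
  by (auto simp: algebra_simps)

lemma th_th: "th i * th j = - (th j * th i :: 'k::field endo)"
proof -
  have "th i * th j = - (th j * th i :: 'k endo)" if "i < j" for i j
    using that
    by transfer (auto simp: fun_eq_iff sg_other sg_remove Diff_insert2[symmetric] insert_commute)
  moreover have "th i * th i = (0 :: 'k endo)" by transfer (simp add: fun_eq_iff)
  ultimately show ?thesis by (cases i j rule: linorder_cases) auto
qed

lemma th_sq: "th i * th i = 0"
  by transfer (simp add: fun_eq_iff)

lemma dd_dd: "dd i * dd j = - (dd j * dd i :: 'k::field endo)"
proof -
  have "dd i * dd j = - (dd j * dd i :: 'k endo)" if "i < j" for i j
    using that by transfer (auto simp: fun_eq_iff sg_other sg_insert insert_commute)
  moreover have "dd i * dd i = (0 :: 'k endo)" by transfer (simp add: fun_eq_iff)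
  ultimately show ?thesis by (cases i j rule: linorder_cases) auto
qed

lemma dd_th: "dd i * th j = (if i = j then 1 else 0) - (th j * dd i :: 'k::field endo)"
proof -
  have "dd i * th j = - (th j * dd i :: 'k endo)" if "i < j" for i j
    using that
    by transfer (auto simp: fun_eq_iff sg_other sg_remove sg_insert insert_Diff_if)
  moreover have "dd i * th j = - (th j * dd i :: 'k endo)" if "j < i" for i j
    using that
    by transfer (auto simp: fun_eq_iff sg_other sg_remove sg_insert insert_Diff_if)
  moreover have "dd i * th i = 1 - (th i * dd i :: 'k endo)"
    by transfer (auto simp: fun_eq_iff sg_other insert_absorb)
  ultimately show ?thesis by (cases i j rule: linorder_cases) auto
qed

lemma dd_nonzero: "dd i \<noteq> (0 :: 'k::field endo)"
proof
  assume "dd i = (0 :: 'k endo)"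
  then have "Rep_endo (dd i) (\<lambda>A. 1) {} = Rep_endo (0 :: 'k endo) (\<lambda>A. 1) {}" by simp
  then show False by (simp add: dd.rep_eq zero_endo.rep_eq sg_def)
qed

definition com :: "'r::ring_1 \<Rightarrow> 'r \<Rightarrow> 'r" where "com x y = x * y - y * x"
definition acom :: "'r::ring_1 \<Rightarrow> 'r \<Rightarrow> 'r" where "acom x y = x * y + y * x"

lemma com_simps [simp]: "com 0 x = 0" "com x 0 = 0" "com (- x) y = - com x y" "com x (- y) = - com x y"
  "com x (y + z) = com x y + com x z" "com x (y - z) = com x y - com x z"
  "com (x + y) z = com x z + com y z" "com (x - y) z = com x z - com y z"
  "acom 0 x = 0" "acom x 0 = 0" "acom x (- y) = - acom x y"
  by (simp_all add: com_def acom_def algebra_simps)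

lemma com_esc [simp]: "com (esc c x) y = esc c (com x y)" "com x (esc c y) = esc c (com x y)"
  by (simp_all add: com_def endo.scale_right_diff_distrib)

lemma com_sum: "com (sum g A) y = (\<Sum>a\<in>A. com (g a) y)"
  by (simp add: com_def sum_distrib_left sum_distrib_right sum_subtractf)

lemma com_mult: "com x (y * z) = com x y * z + y * com x z"
  by (simp add: com_def algebra_simps)

text \<open>The endomorphism superalgebra of the Grassmann algebra, with an element written as the pair of
  its even and odd parts.\<close>

definition psc :: "'k::field \<Rightarrow> 'k endo \<times> 'k endo \<Rightarrow> 'k endo \<times> 'k endo" where
  "psc c x = (esc c (fst x), esc c (snd x))"

definition pbr :: "'k::field endo \<times> 'k endo \<Rightarrow> 'k endo \<times> 'k endo \<Rightarrow> 'k endo \<times> 'k endo" where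
  "pbr x y = (com (fst x) (fst y) + acom (snd x) (snd y), com (fst x) (snd y) - com (fst y) (snd x))"

definition phom :: "bit \<Rightarrow> ('k::field endo \<times> 'k endo) set" where
  "phom p = (if p = 0 then {x. snd x = 0} else {x. fst x = 0})"

lemma pbr_simps:
  "pbr (x, 0) (y, 0) = (com x y, 0)" "pbr (x, 0) (0, y) = (0, com x y)"
  "pbr (0, x) (y, 0) = (0, - com y x)" "pbr (0, x) (0, y) = (acom x y, 0)"
  by (simp_all add: pbr_def)

interpretation pair: lie_superalg "psc :: 'k::field_char_0 \<Rightarrow> _" pbr phom
proof unfold_locales
  fix p q r :: bit and x y z :: "'k endo \<times> 'k endo" and c d :: 'k
  show "psc c (x + y) = psc c x + psc c y" "psc (c + d) x = psc c x + psc d x"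
    "psc c (psc d x) = psc (c * d) x" "psc 1 x = x"
    by (simp_all add: psc_def endo.scale_right_distrib endo.scale_left_distrib)
  show "pbr (x + y) z = pbr x z + pbr y z" "pbr x (y + z) = pbr x y + pbr x z"
    by (simp_all add: pbr_def acom_def algebra_simps)
  show "pbr (psc c x) y = psc c (pbr x y)" "pbr x (psc c y) = psc c (pbr x y)"
    by (simp_all add: pbr_def psc_def acom_def endo.scale_right_distrib endo.scale_right_diff_distrib)
  have sub: "module.subspace psc (phom p :: ('k endo \<times> 'k endo) set)"
  proof -
    interpret module "psc :: 'k \<Rightarrow> _"
      by unfold_locales (simp_all add: psc_def endo.scale_right_distrib endo.scale_left_distrib)
    show ?thesis by (auto simp: subspace_def phom_def psc_def)
  qed
  then show "module.subspace psc (phom p :: ('k endo \<times> 'k endo) set)" .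
  have bits: "p = 0 \<or> p = 1" for p :: bit by (cases p) auto
  show "pbr x y \<in> phom (p + q)" if "x \<in> phom p" "y \<in> phom q"
    using that bits[of p] bits[of q] by (auto simp: phom_def pbr_def)
  show "pbr x y = psc (- koszul_sign p q) (pbr y x)" if "x \<in> phom p" "y \<in> phom q"
    using bits[of p] bits[of q] that
    by (elim disjE)
      (simp_all add: phom_def pbr_def psc_def koszul_sign_def com_def acom_def)
  show "pbr x (pbr y z) = pbr (pbr x y) z + psc (koszul_sign p q) (pbr y (pbr x z))"
    if "x \<in> phom p" "y \<in> phom q" "z \<in> phom r"
    using bits[of p] bits[of q] bits[of r] that
    by (elim disjE)
      (simp_all add: phom_def pbr_def psc_def koszul_sign_def com_def acom_def algebra_simps)
qed

section \<open>Fields of degree zero and their weights\<close>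

definition Eu :: "nat \<Rightarrow> nat \<Rightarrow> 'k::field endo" where "Eu i j = th i * dd j"

lemma com_Eu_th: "com (Eu i j) (th k) = (if j = k then th i else 0 :: 'k::field endo)"
proof -
  have "Eu i j * th k = (if j = k then th i else 0) - (th i * th k * dd j :: 'k endo)"
    by (simp add: Eu_def mult.assoc dd_th algebra_simps)
  moreover have "th i * th k * dd j = - (th k * Eu i j :: 'k endo)"
    by (simp add: Eu_def th_th[of i k] mult.assoc)
  ultimately show ?thesis by (simp add: com_def)
qed

lemma com_Eu_dd: "com (Eu i j) (dd k) = (if i = k then - dd j else 0 :: 'k::field endo)"
proof -
  have "dd k * Eu i j = (if i = k then dd j else 0) - (th i * (dd k * dd j) :: 'k endo)"
    by (simp add: Eu_def mult.assoc[symmetric] dd_th left_diff_distrib)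
  moreover have "th i * (dd k * dd j) = - (Eu i j * dd k :: 'k endo)"
    by (simp add: Eu_def dd_dd[of k j] mult.assoc)
  ultimately show ?thesis by (simp add: com_def)
qed

lemma com_Eu_Eu: "com (Eu i j) (Eu k l) = (if j = k then Eu i l else 0) - (if i = l then Eu k j else 0)"
  by (simp add: Eu_def[of k l] com_mult com_Eu_th com_Eu_dd) (simp add: Eu_def)

lemma th_Eu [simp]: "th i * Eu i j = 0"
  by (simp add: Eu_def mult.assoc[symmetric] th_sq)

definition Hw :: "nat \<Rightarrow> (nat \<Rightarrow> 'k::field) \<Rightarrow> 'k endo" where "Hw n w = (\<Sum>i<n. esc (w i) (Eu i i))"

lemma Hw_linear: "Hw n v - Hw n w = Hw n (\<lambda>i. v i - w i)"
  by (simp add: Hw_def endo.scale_left_diff_distrib sum_subtractf)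

lemma com_Hw:
  "j < n \<Longrightarrow> com (Hw n w) (th j) = esc (w j) (th j)"
  "j < n \<Longrightarrow> com (Hw n w) (dd j) = - esc (w j) (dd j)"
  "i < n \<Longrightarrow> j < n \<Longrightarrow> com (Hw n w) (Eu i j) = esc (w i - w j) (Eu i j)"
proof -
  show th: "com (Hw n w) (th j) = esc (w j) (th j)" if "j < n" for j
    using that by (simp add: Hw_def com_sum com_Eu_th if_distrib[of "esc _"] cong: if_cong)
  show dd: "com (Hw n w) (dd j) = - esc (w j) (dd j)" if "j < n" for j
    using that by (simp add: Hw_def com_sum com_Eu_dd if_distrib[of "esc _"] cong: if_cong)
  show "com (Hw n w) (Eu i j) = esc (w i - w j) (Eu i j)" if "i < n" "j < n"
    using that by (simp add: Eu_def com_mult th dd endo.scale_left_diff_distrib)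
qed

lemma com_skew: "com x y = - com y x"
  by (simp add: com_def)

lemma com_Hw_Hw: "com (Hw n v) (Hw n w) = 0"
proof -
  have "com (Hw n v) (Hw n w) = - com (Hw n w) (Hw n v)" by (rule com_skew)
  also have "com (Hw n w) (Hw n v) = (\<Sum>i<n. esc (w i) (com (Eu i i) (Hw n v)))"
    by (simp add: Hw_def[of n w] com_sum)
  also have "\<dots> = 0"
    by (rule sum.neutral) (simp add: com_skew[of "Eu _ _" "Hw n v"] com_Hw)
  finally show ?thesis by simp
qed

lemma com_Eu_th_Hw: "i < n \<Longrightarrow> j < n \<Longrightarrow> com (Eu i j) (th k * Hw n w) =
    (if j = k then th i * Hw n w else 0) + esc (w j - w i) (th k * Eu i j)"
  by (simp add: com_mult com_Eu_th com_skew[of "Eu i j" "Hw n w"] com_Hw)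
    (simp add: endo.scale_left_diff_distrib)

lemma com_Eu_th_Eu: "com (Eu i j) (th k * Eu r s) =
    (if j = k then th i * Eu r s else 0) +
    ((if j = r then th k * Eu i s else 0) - (if i = s then th k * Eu r j else 0))"
  by (simp add: com_mult com_Eu_th com_Eu_Eu right_diff_distrib)

text \<open>This becomes [e_0, f_0a] = h_a. The weight of h_a vanishes at 0 exactly if a \<noteq> 1,
  in accordance with the absence of a generator f_01.\<close>

lemma acom_dd_th_Hw:
  fixes w :: "nat \<Rightarrow> 'k::field"
  assumes n: "0 < n" and w: "w 0 = 0"
  shows "acom (dd 0) (th 0 * Hw n w) = Hw n w"
proof -
  have "Hw n w * dd 0 = dd 0 * Hw n w" using com_Hw(2)[OF n, of w] w by (simp add: com_def)
  then have "th 0 * Hw n w * dd 0 = th 0 * dd 0 * Hw n w" by (simp add: mult.assoc)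
  moreover have "dd 0 * (th 0 * Hw n w) = Hw n w - th 0 * dd 0 * Hw n w"
    by (simp add: mult.assoc[symmetric] dd_th left_diff_distrib)
  ultimately show ?thesis by (simp add: acom_def)
qed

text \<open>If both weights vanish at i and j, the diagonal factors move freely and \<theta>_i
  \<theta>_j cancels against \<theta>_j \<theta>_i. This is the source of the three families: the
  weights in all f_0a vanish at 0, those with a \<ge> 3 also at 1, and h_2 and h_0 both have weight
  1 at the index 1, so that their difference vanishes there too.\<close>

lemma acom_th_Hw:
  fixes v w :: "nat \<Rightarrow> 'k::field"
  assumes *: "i < n" "j < n" "v i = 0" "v j = 0" "w i = 0" "w j = 0"
  shows "acom (th i * Hw n v) (th j * Hw n w) = 0"
proof -
  have "Hw n v * th j = th j * Hw n v" "Hw n w * th i = th i * Hw n w"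
    using com_Hw(1)[of j n v] com_Hw(1)[of i n w] * by (simp_all add: com_def)
  then have "th i * Hw n v * (th j * Hw n w) = th i * th j * (Hw n v * Hw n w)"
    "th j * Hw n w * (th i * Hw n v) = th j * th i * (Hw n w * Hw n v)"
    by (metis mult.assoc)+
  moreover have "Hw n w * Hw n v = Hw n v * Hw n w" using com_Hw_Hw[of n v w] by (simp add: com_def)
  ultimately show ?thesis using th_th[of i j, where 'k='k] by (simp add: acom_def)
qed

lemma acom_dd: "acom (dd i) (dd j) = (0 :: 'k::field endo)"
  using dd_dd[of i j, where 'k='k] by (simp add: acom_def)

definition wt :: "nat \<Rightarrow> nat \<Rightarrow> 'k::field" where
  "wt a i = (if a = 0 then (if i = 0 then 0 else 1) else if Suc i = a then 1 else if i = a then - 1 else 0)"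

text \<open>B_ab is the eigenvalue of h_a = \<open>Hw n (wt a)\<close> on e_b, which is \<partial>_0
  for b = 0 and \<theta>_(b-1) \<partial>_b otherwise.\<close>

lemma wt_B: "of_int (B_mat a b) = (if b = 0 then - wt a 0 else wt a (b - 1) - wt a b)"
  by (cases b) (auto simp: B_mat_def wt_def)

lemma Hw_wt:
  assumes "0 < a" "a < n"
  shows "Hw n (wt a) = (Eu (a - 1) (a - 1) - Eu a a :: 'k::field endo)"
proof -
  have "Hw n (wt a) =
      (\<Sum>i<n. (if i = a - 1 then Eu i i else 0) - (if i = a then Eu i i else 0 :: 'k endo))"
    unfolding Hw_def by (rule sum.cong[OF HOL.refl]) (use assms in \<open>auto simp: wt_def\<close>)
  moreover have "a - 1 < n" using assms by simp
  ultimately show ?thesis using assms by (simp add: sum_subtractf)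
qed

section \<open>The generators as vector fields\<close>

definition gmodel :: "nat \<Rightarrow> w_gen \<Rightarrow> 'k::field endo \<times> 'k endo" where
  "gmodel n x = (case x of
     E_gen a \<Rightarrow> if a = 0 then (0, dd 0) else (Eu (a - 1) a, 0)
   | F_gen a \<Rightarrow> (Eu a (a - 1), 0)
   | F0_gen a \<Rightarrow> (0, th 0 * Hw n (wt a)))"

abbreviation pev :: "nat \<Rightarrow> (w_gen, 'k::field) lie_term \<Rightarrow> 'k endo \<times> 'k endo" where
  "pev n \<equiv> ev psc pbr (gmodel n)"

lemma gmodel_hom: "gmodel n x \<in> phom (w_parity x)"
  by (cases x) (auto simp: gmodel_def phom_def)

lemma wt_0: "a \<noteq> 1 \<Longrightarrow> wt a 0 = 0" and wt_1: "3 \<le> a \<Longrightarrow> wt a 1 = 0"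
  by (auto simp: wt_def)

lemma pev_h: "2 \<le> n \<Longrightarrow> a < n \<Longrightarrow> pev n (elem_h a) = (Hw n (wt a) :: 'k::field endo, 0)"
  using acom_dd_th_Hw[of n "wt a :: nat \<Rightarrow> 'k"] Hw_wt[of 1 n, where 'k='k] wt_0[of a, where 'a='k]
  by (simp add: elem_h_def gmodel_def pbr_simps com_Eu_Eu)

lemma psc_simps: "psc c (x, 0) = (esc c x, 0)" "psc c (0, x) = (0, esc c x)"
  by (simp_all add: psc_def)

lemma pev_w_relations:
  assumes "2 \<le> n" "(l, r) \<in> w_relations n"
  shows "pev n l = (pev n r :: 'k::field endo \<times> 'k endo)"
  using assms(2)
proof cases
  note defs = e_index_def f_index_def f0_index_def gmodel_def pbr_simps psc_simps
  have n: "0 < n" "1 < n" using assms(1) by auto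
  {
    case (R1_he a b)
    then show ?thesis
      using assms(1) pev_h[of n a, where 'k='k]
      by (cases b) (simp_all add: defs com_Hw wt_B)
  next
    case (R1_hf a b)
    then show ?thesis
      using assms(1) pev_h[of n a, where 'k='k] by (auto simp: defs com_Hw wt_B)
  next
    case (R1_ef a b)
    then show ?thesis
      using assms(1) pev_h[of n b, where 'k='k] Hw_wt[of b n, where 'k='k]
      by (cases a; cases b) (auto simp: defs com_Eu_Eu com_Eu_dd zero_prod_def)
  next
    case (R2_e a b)
    have adj: "\<bar>int a - int b\<bar> = 1 \<longleftrightarrow> b = Suc a \<or> a = Suc b" by linarith
    show ?thesis
      using R2_e
      by (cases a; cases b)
        (auto simp: defs ev_funpow B_mat_def adj numeral_2_eq_2 com_Eu_Eu com_Eu_dd acom_dd zero_prod_def)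
  next
    case (R2_f a b)
    have adj: "\<bar>int a - int b\<bar> = 1 \<longleftrightarrow> b = Suc a \<or> a = Suc b" by linarith
    show ?thesis
      using R2_f
      by (auto simp: defs ev_funpow B_mat_def adj numeral_2_eq_2 com_Eu_Eu zero_prod_def)
  next
    case (R3 a)
    then show ?thesis by (simp add: elem_h_def f0_index_def)
  next
    case (R4 a b)
    then show ?thesis
      using assms(1) pev_h[of n a, where 'k='k]
      by (simp add: defs com_mult com_Hw com_Hw_Hw wt_B)
  next
    case (R5 a)
    then show ?thesis using assms(1) by (simp add: defs com_Eu_th_Hw zero_prod_def)
  next
    case (R6_e a b)
    then show ?thesis
      using n acom_dd_th_Hw[of n "wt b :: nat \<Rightarrow> 'k"]
      by (cases a)
        (auto simp: defs com_Eu_th_Hw com_Eu_th_Eu com_Hw zero_prod_def wt_def)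
  next
    case (R6_f a b)
    then show ?thesis
      using n by (auto simp: defs com_Eu_th_Hw com_Eu_th_Eu com_Hw zero_prod_def)
  next
    case (R7 i j a)
    then show ?thesis
      using n Hw_wt[of j n, where 'k='k]
      by (auto simp: defs com_Eu_th_Hw com_Eu_th_Eu com_Hw zero_prod_def wt_B right_diff_distrib)
  }
qed

lemma pev_J:
  assumes "2 \<le> n" "t \<in> J_generators n"
  shows "pev n t = (0 :: 'k::field endo \<times> 'k endo)"
  using assms(2)
proof cases
  note defs = e_index_def f_index_def f0_index_def gmodel_def pbr_simps psc_simps
  {
    case (1 a b)
    then show ?thesis
      using acom_th_Hw[of 0 n 0 "wt a :: nat \<Rightarrow> 'k" "wt b"] by (auto simp: defs zero_prod_def wt_def)
  next
    case (2 i j)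
    then show ?thesis
      using acom_th_Hw[of 0 n 1 "wt i :: nat \<Rightarrow> 'k" "wt j"]
      by (auto simp: defs zero_prod_def wt_def com_Eu_th_Hw)
  next
    case (3 i)
    have w: "wt i 0 = (0 :: 'k)" "wt i (Suc 0) = (0 :: 'k)" using 3 by (auto simp: wt_def)
    have "acom (th 0 * Hw n (\<lambda>x. wt 2 x - wt 0 x)) (th 1 * Hw n (wt i)) = (0 :: 'k endo)"
      by (rule acom_th_Hw) (use assms 3 in \<open>auto simp: wt_def\<close>)
    then have "acom (th 0 * Hw n (wt 2) - th 0 * Hw n (wt 0)) (th 1 * Hw n (wt i)) = (0 :: 'k endo)"
      by (simp add: Hw_linear[symmetric] right_diff_distrib)
    then show ?thesis
      using 3 assms w by (simp add: defs zero_prod_def com_Eu_th_Hw)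
  }
qed


section \<open>The ideal of relations\<close>

text \<open>Terms denoting the \<open>d i\<close>: membership in an ideal of W and the degree are
  statements about classes of terms, so the brackets with \<open>d i\<close> must be available there
  too.\<close>

primrec dterm :: "nat \<Rightarrow> (w_gen, 'k::field) lie_term" where
  "dterm 0 = gen_e 0"
| "dterm (Suc i) = Scale (- 1) (Br (gen_e (Suc i)) (dterm i))"

lemma dterm_lie_term: "i < n \<Longrightarrow> dterm i \<in> lie_terms (w_gens n)"
  by (induction i) (auto simp: w_gens_def e_index_def)

lemma dterm_degree: "homogeneous w_degree 1 (dterm i)"
proof (induction i)
  case 0
  show ?case using homogeneous.Gen[of w_degree "E_gen 0"] by simp
next
  case (Suc i)
  have "homogeneous w_degree 0 (gen_e (Suc i))" using homogeneous.Gen[of w_degree "E_gen (Suc i)"] by simp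
  from homogeneous.Br[OF this Suc] show ?case by (auto intro: homogeneous.Scale)
qed

context w_algebra
begin

lemma ev_dterm: "(\<And>a. g (E_gen a) = e a) \<Longrightarrow> ev sc br g (dterm i) = d i"
  by (induction i) (simp_all add: d.simps)

lemma ev_comp:
  assumes g: "\<And>a. g (E_gen a) = e a" "\<And>a. g (F_gen a) = f a" "\<And>a. g (F0_gen a) = f0 a"
    and "homogeneous w_degree k t" "t \<in> lie_terms (w_gens n)"
  shows "ev sc br g t \<in> comp k"
  using assms(4,5)
proof (induction)
  case (Gen x)
  have index: "a \<in> e_index n \<Longrightarrow> a = 0 \<or> 1 \<le> a \<and> a < n" "a \<in> f_index n \<Longrightarrow> 1 \<le> a \<and> a < n"
    "a \<in> f0_index n \<Longrightarrow> a < n \<and> a \<noteq> 1" for a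
    by (auto simp: e_index_def f_index_def f0_index_def)
  show ?case
  proof (cases x)
    case (E_gen a)
    then show ?thesis using Gen index(1)[of a] gens_comp(1) gens_comp(2)[of a] by (auto simp: g w_gens_def)
  next
    case (F_gen a)
    then show ?thesis using Gen index(2)[of a] gens_comp(3)[of a] by (auto simp: g w_gens_def)
  next
    case (F0_gen a)
    then show ?thesis using Gen index(3)[of a] gens_comp(4)[of a] by (auto simp: g w_gens_def)
  qed
next
  case (Br k x l y)
  then show ?case by (auto intro: comp_br)
qed (auto simp: subspace_comp subspace_0 subspace_add subspace_scale)

end

section \<open>W and its quotient in the type of families\<close>

definition J_relations :: "nat \<Rightarrow> ((w_gen, 'k::field) lie_term \<times> (w_gen, 'k) lie_term) set" where
  "J_relations n = w_relations n \<union> (\<lambda>t. (t, Zero)) ` J_generators n"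

abbreviation PW :: "nat \<Rightarrow> (w_gen, 'k::field) presentation" where
  "PW n \<equiv> (w_gens n, w_parity, w_relations n)"

abbreviation PL :: "nat \<Rightarrow> (w_gen, 'k::field) presentation" where
  "PL n \<equiv> (w_gens n, w_parity, J_relations n)"

abbreviation J_eq :: "nat \<Rightarrow> (w_gen, 'k::field) lie_term \<Rightarrow> (w_gen, 'k) lie_term \<Rightarrow> bool" where
  "J_eq n \<equiv> lie_eq (w_gens n) w_parity (J_relations n)"

lemma J_generators_terms: "2 \<le> n \<Longrightarrow> t \<in> J_generators n \<Longrightarrow> t \<in> lie_terms (w_gens n)"
  by (erule J_generators.cases) (auto simp: w_gens_def f_index_def f0_index_def)

lemma J_generators_degree: "t \<in> J_generators n \<Longrightarrow> homogeneous w_degree (- 2) t"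
proof -
  have f0: "homogeneous w_degree (- 1) (gen_f0 a)" for a
    using homogeneous.Gen[of w_degree "F0_gen a"] by simp
  have f: "homogeneous w_degree 0 (gen_f 1)"
    using homogeneous.Gen[of w_degree "F_gen 1"] by simp
  have ff0: "homogeneous w_degree (- 1) (Br (gen_f 1) (gen_f0 a))" for a
    using homogeneous.Br[OF f f0[of a]] by simp
  have br: "homogeneous w_degree (- 1) x \<Longrightarrow> homogeneous w_degree (- 1) y \<Longrightarrow>
      homogeneous w_degree (- 2) (Br x y)" for x y :: "(w_gen, 'a) lie_term"
    using homogeneous.Br[of w_degree "- 1" x "- 1" y] by simp
  show "t \<in> J_generators n \<Longrightarrow> homogeneous w_degree (- 2) t"
    by (erule J_generators.cases) (auto intro!: br f0 ff0 homogeneous.Plus homogeneous.Scale simp del: One_nat_def)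
qed

lemma emb_relation:
  assumes "(l, r) \<in> R" "l \<in> lie_terms X" "r \<in> lie_terms X"
  shows "emb (X, par, R) l = emb (X, par, R) r"
  using assms emb_eq_iff[of l "(X, par, R)" r] by (simp add: pres_eq_def lie_eq.relation)

lemma emb_gen_hom: "x \<in> X \<Longrightarrow> emb (X, par, R) (Gen x) \<in> fhom (X, par, R) (par x)"
  by (auto simp: fhom_def intro!: imageI homogeneous.Gen)

lemma emb_w_relation:
  assumes "2 \<le> n" "w_relations n \<subseteq> R" "(l, r) \<in> w_relations n"
  shows "ev fscale fbr (\<lambda>x. emb (w_gens n, w_parity, R) (Gen x)) l =
    ev fscale fbr (\<lambda>x. emb (w_gens n, w_parity, R) (Gen x)) r"
proof -
  have "l \<in> lie_terms (w_gens n)" "r \<in> lie_terms (w_gens n)"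
    using w_relations_lie_terms[OF assms(1,3)] by auto
  then show ?thesis using assms(2,3) by (auto simp: ev_emb intro!: emb_relation)
qed

abbreviation eW :: "nat \<Rightarrow> (w_gen, 'k::field) lie_term \<Rightarrow> (w_gen, 'k) family" where "eW n \<equiv> emb (PW n)"
abbreviation eL :: "nat \<Rightarrow> (w_gen, 'k::field) lie_term \<Rightarrow> (w_gen, 'k) family" where "eL n \<equiv> emb (PL n)"

lemma w_algebra_W:
  assumes "2 \<le> n"
  shows "w_algebra fscale fbr (fhom (PW n :: (w_gen, 'k::field_char_0) presentation)) n
    (\<lambda>a. eW n (gen_e a)) (\<lambda>a. eW n (gen_f a)) (\<lambda>a. eW n (gen_f0 a))"
  by (rule lie_superalg.w_algebra_ev[OF family_superalg assms])
    (auto intro: emb_gen_hom emb_w_relation[OF assms])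

lemma w_quotient_L:
  assumes "2 \<le> n"
  shows "w_quotient fscale fbr (fhom (PL n :: (w_gen, 'k::field_char_0) presentation)) n
    (\<lambda>a. eL n (gen_e a)) (\<lambda>a. eL n (gen_f a)) (\<lambda>a. eL n (gen_f0 a))"
proof (rule lie_superalg.w_quotient_ev[OF family_superalg assms])
  fix t :: "(w_gen, 'k) lie_term" assume t: "t \<in> J_generators n"
  then have "t \<in> lie_terms (w_gens n)" using J_generators_terms assms by blast
  moreover have "emb (PL n) t = emb (PL n) Zero"
    by (rule emb_relation) (use t \<open>t \<in> lie_terms (w_gens n)\<close> in \<open>auto simp: J_relations_def Zero_lie_term\<close>)
  ultimately show "ev fscale fbr (\<lambda>x. eL n (Gen x)) t = 0" by (simp add: ev_emb emb_Zero)
qed (auto intro: emb_gen_hom emb_w_relation[OF assms] simp: J_relations_def)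

lemma J_eq_mono:
  fixes s t :: "(w_gen, 'k::field_char_0) lie_term"
  assumes "2 \<le> n" "lie_eq (w_gens n) w_parity (w_relations n) s t"
  shows "J_eq n s t"
proof -
  have st: "s \<in> lie_terms (w_gens n)" "t \<in> lie_terms (w_gens n)"
    using lie_eq_terms[OF assms(2)] by auto
  have "ev fscale fbr (\<lambda>x. eL n (Gen x)) s = ev fscale fbr (\<lambda>x. eL n (Gen x)) t"
    by (rule lie_superalg.ev_sound[OF family_superalg[of "PL n"] _ _ assms(2)])
      (auto intro: emb_gen_hom emb_w_relation[OF assms(1)] simp: J_relations_def)
  then have "eL n s = eL n t" using st by (simp add: ev_emb)
  then show ?thesis using st by (simp add: emb_eq_iff pres_eq_def)
qed

lemma e0_survives:
  assumes "2 \<le> n"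
  shows "\<not> J_eq n (gen_e 0 :: (w_gen, 'k::field_char_0) lie_term) Zero"
proof
  assume "J_eq n (gen_e 0 :: (w_gen, 'k) lie_term) Zero"
  then have "pev n (gen_e 0) = (pev n Zero :: 'k endo \<times> 'k endo)"
    by (rule pair.ev_sound[rotated -1])
      (auto simp: J_relations_def gmodel_hom pev_w_relations[OF assms] pev_J[OF assms])
  then show False by (simp add: gmodel_def zero_prod_def dd_nonzero)
qed

lemma eL_e0_nonzero:
  assumes "2 \<le> n"
  shows "eL n (gen_e 0) \<noteq> (0 :: (w_gen, 'k::field_char_0) family)"
proof
  assume "eL n (gen_e 0) = (0 :: (w_gen, 'k) family)"
  then have "eL n (gen_e 0) = (eL n Zero :: (w_gen, 'k) family)" by (simp add: emb_Zero)
  moreover have "gen_e 0 \<in> lie_terms (w_gens n)" using assms by (auto simp: w_gens_def e_index_def)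
  ultimately have "J_eq n (gen_e 0 :: (w_gen, 'k) lie_term) Zero"
    by (simp add: emb_eq_iff pres_eq_def Zero_lie_term)
  then show False using e0_survives[OF assms] by blast
qed

section \<open>Ideals of W and their lifts\<close>

lemma W_carrier: "A \<in> carrier (W n) \<longleftrightarrow> (\<exists>t\<in>lie_terms (w_gens n). A = W_class n t)"
  by (auto simp: W_def W_class_def presented_lie_superalgebra_def quotient_def lie_class_def)

lemma W_zero: "zero (W n) = W_class n Zero"
  by (simp add: W_def W_class_def presented_lie_superalgebra_def)

lemma W_operations:
  assumes "s \<in> lie_terms (w_gens n)" "t \<in> lie_terms (w_gens n)"
  shows "add (W n) (W_class n s) (W_class n t) = W_class n (Plus s t)"
    and "scale (W n) c (W_class n s) = W_class n (Scale c s)"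
    and "bracket (W n) (W_class n s) (W_class n t) = W_class n (Br s t)"
  unfolding W_def W_class_def using presented_operations[OF assms]
  by (simp_all add: presented_lie_superalgebra_def)

lemma W_class_eq_iff:
  assumes "s \<in> lie_terms (w_gens n)" "t \<in> lie_terms (w_gens n)"
  shows "W_class n s = W_class n t \<longleftrightarrow> eW n s = eW n t"
  using assms by (simp add: W_class_def lie_class_eq_iff emb_eq_iff pres_eq_def)

text \<open>The kernel of the map from W to the quotient. The properties of the maximal ideal are
  proved for this set, and \<open>ideal_generated_J\<close> identifies it with the generated
  ideal.\<close>

definition J_set :: "nat \<Rightarrow> (w_gen, 'k::field) lie_term set set" where
  "J_set n = W_class n ` {t \<in> lie_terms (w_gens n). J_eq n t Zero}"

text \<open>W consists of equivalence classes with an explicit carrier, whereas the formulas live in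
  the type of families; \<open>lift_set_iff\<close> lets membership pass between the two.\<close>

definition lift_set :: "nat \<Rightarrow> (w_gen, 'k::field) lie_term set set \<Rightarrow> (w_gen, 'k) family set" where
  "lift_set n I = eW n ` {t \<in> lie_terms (w_gens n). W_class n t \<in> I}"

lemma lift_set_iff:
  assumes "t \<in> lie_terms (w_gens n)"
  shows "eW n t \<in> lift_set n I \<longleftrightarrow> W_class n t \<in> I"
proof
  assume "eW n t \<in> lift_set n I"
  then obtain s where s: "eW n t = eW n s" "s \<in> lie_terms (w_gens n)" "W_class n s \<in> I"
    by (auto simp: lift_set_def)
  then have "W_class n t = W_class n s" using W_class_eq_iff[OF assms s(2)] by simp
  then show "W_class n t \<in> I" using s(3) by simp
qed (use assms in \<open>auto simp: lift_set_def\<close>)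

lemma lift_set_subspace:
  fixes I :: "(w_gen, 'k::field) lie_term set set"
  assumes "linear_subspace (W n) I"
  shows "family.subspace (lift_set n I)"
proof (rule family.subspaceI)
  have "W_class n Zero \<in> I"
    using assms by (simp add: linear_subspace_def W_zero)
  then show "0 \<in> lift_set n I"
    using lift_set_iff[OF Zero_lie_term, of n I] by (simp add: emb_Zero)
  show "x + y \<in> lift_set n I" if xy: "x \<in> lift_set n I" "y \<in> lift_set n I" for x y
  proof -
    obtain s t where st: "x = eW n s" "y = eW n t" "s \<in> lie_terms (w_gens n)" "t \<in> lie_terms (w_gens n)"
      "W_class n s \<in> I" "W_class n t \<in> I" using xy by (auto simp: lift_set_def)
    then have "W_class n (Plus s t) \<in> I"
      using assms W_operations(1)[OF st(3,4)] unfolding linear_subspace_def by metis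
    then show ?thesis using st lift_set_iff[of "Plus s t" n I] by (simp add: emb_Plus)
  qed
  show "fscale c x \<in> lift_set n I" if x: "x \<in> lift_set n I" for c x
  proof -
    obtain s where st: "x = eW n s" "s \<in> lie_terms (w_gens n)" "W_class n s \<in> I"
      using x by (auto simp: lift_set_def)
    then have "W_class n (Scale c s) \<in> I"
      using assms W_operations(2)[OF st(2,2), of c] unfolding linear_subspace_def by metis
    then show ?thesis using st lift_set_iff[of "Scale c s" n I] by (simp add: emb_Scale)
  qed
qed

lemma lift_set_ideal:
  fixes I :: "(w_gen, 'k::field) lie_term set set" and t :: "(w_gen, 'k) lie_term"
  assumes "lie_ideal (W n) I" "x \<in> lift_set n I" "t \<in> lie_terms (w_gens n)"
  shows "fbr (eW n t) x \<in> lift_set n I \<and> fbr x (eW n t) \<in> lift_set n I"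
proof -
  obtain s where s: "x = eW n s" "s \<in> lie_terms (w_gens n)" "W_class n s \<in> I"
    using assms(2) by (auto simp: lift_set_def)
  have "W_class n t \<in> carrier (W n)" using assms(3) W_carrier by blast
  then have "W_class n (Br t s) \<in> I" "W_class n (Br s t) \<in> I"
    using assms(1) s(3) W_operations(3)[OF s(2) assms(3)] W_operations(3)[OF assms(3) s(2)]
    unfolding lie_ideal_def by metis+
  then show ?thesis
    using s assms(3) lift_set_iff[of "Br t s" n I] lift_set_iff[of "Br s t" n I]
    by (simp add: emb_Br)
qed

lemma J_set_iff:
  fixes t :: "(w_gen, 'k::field_char_0) lie_term"
  assumes "2 \<le> n" "t \<in> lie_terms (w_gens n)"
  shows "W_class n t \<in> J_set n \<longleftrightarrow> eL n t = 0"
proof -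
  have "W_class n t \<in> J_set n \<longleftrightarrow> J_eq n t Zero"
  proof
    assume "W_class n t \<in> J_set n"
    then obtain s where s: "W_class n t = W_class n s" "s \<in> lie_terms (w_gens n)" "J_eq n s Zero"
      by (auto simp: J_set_def)
    then have "lie_eq (w_gens n) w_parity (w_relations n) t s"
      using assms(2) by (simp add: W_class_def lie_class_eq_iff)
    then show "J_eq n t Zero" using J_eq_mono[OF assms(1)] s(3) lie_eq.trans by blast
  qed (use assms in \<open>auto simp: J_set_def\<close>)
  also have "\<dots> \<longleftrightarrow> eL n t = eL n Zero"
    using assms(2) by (simp add: emb_eq_iff pres_eq_def Zero_lie_term)
  finally show ?thesis by (simp add: emb_Zero)
qed

lemma J_set_ideal:
  assumes n: "2 \<le> n"
  shows "lie_ideal (W n) (J_set n :: (w_gen, 'k::field_char_0) lie_term set set)"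
proof -
  let ?J = "J_set n :: (w_gen, 'k) lie_term set set"
  interpret L: lie_superalg fscale fbr "fhom (PL n :: (w_gen, 'k) presentation)" by (rule family_superalg)
  note iff = J_set_iff[OF n]
  have rep: "\<exists>t. t \<in> lie_terms (w_gens n) \<and> A = W_class n t \<and> eL n t = 0" if "A \<in> ?J" for A
    using that iff by (auto simp: J_set_def)
  have "linear_subspace (W n) ?J"
    unfolding linear_subspace_def
  proof (intro conjI ballI allI)
    show "?J \<subseteq> carrier (W n)" using W_carrier by (auto simp: J_set_def)
    show "zero (W n) \<in> ?J"
      using iff[OF Zero_lie_term] by (simp add: emb_Zero W_zero)
    fix A B c assume A: "A \<in> ?J"
    then obtain s where s: "s \<in> lie_terms (w_gens n)" "A = W_class n s" "eL n s = 0" using rep[OF A] by blast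
    show "scale (W n) c A \<in> ?J"
      using s iff[of "Scale c s"] W_operations(2)[OF s(1,1), of c] by (simp add: emb_Scale)
    assume B: "B \<in> ?J"
    then obtain t where t: "t \<in> lie_terms (w_gens n)" "B = W_class n t" "eL n t = 0" using rep[OF B] by blast
    show "add (W n) A B \<in> ?J"
      using s t iff[of "Plus s t"] W_operations(1)[OF s(1) t(1)] by (simp add: emb_Plus)
  qed
  moreover have "bracket (W n) A B \<in> ?J \<and> bracket (W n) B A \<in> ?J" if AB: "A \<in> carrier (W n)" "B \<in> ?J" for A B
  proof -
    obtain s where s: "s \<in> lie_terms (w_gens n)" "A = W_class n s" using AB(1)[unfolded W_carrier] by blast
    obtain t where t: "t \<in> lie_terms (w_gens n)" "B = W_class n t" "eL n t = 0" using rep[OF AB(2)] by blast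
    show ?thesis
      using s t iff[of "Br s t"] iff[of "Br t s"] W_operations(3)[OF s(1) t(1)] W_operations(3)[OF t(1) s(1)]
      by (simp add: emb_Br)
  qed
  ultimately show ?thesis by (simp add: lie_ideal_def)
qed

text \<open>The kernel is minimal: when a derivation from the larger set of relations is evaluated
  in W, each use of an added relation changes the value by an element of K.\<close>

lemma J_eq_mod:
  fixes K :: "(w_gen, 'k::field_char_0) family set"
  assumes n: "2 \<le> n" and K: "family.subspace K"
    and ideal: "\<And>x t. x \<in> K \<Longrightarrow> t \<in> lie_terms (w_gens n) \<Longrightarrow> fbr (eW n t) x \<in> K \<and> fbr x (eW n t) \<in> K"
    and gens: "\<And>t. t \<in> J_generators n \<Longrightarrow> eW n t \<in> K"
    and t: "J_eq n t Zero"
  shows "eW n t \<in> K"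
proof -
  interpret lie_superalg fscale fbr "fhom (PW n :: (w_gen, 'k) presentation)" by (rule family_superalg)
  let ?ev = "ev fscale fbr (\<lambda>x. eW n (Gen x) :: (w_gen, 'k) family)"
  have ev: "?ev s = eW n s" if "s \<in> lie_terms (w_gens n)" for s using that by (simp add: ev_emb)
  have "?ev t - ?ev Zero \<in> K"
  proof (rule ev_sound_mod[OF _ K _ _ t])
    show "eW n (Gen x) \<in> fhom (PW n) (w_parity x)" if "x \<in> w_gens n" for x
      using that by (rule emb_gen_hom)
    show "fbr (?ev s) x \<in> K \<and> fbr x (?ev s) \<in> K" if "x \<in> K" "s \<in> lie_terms (w_gens n)" for x s
      using ideal[OF that] by (simp add: ev[OF that(2)])
    fix l r :: "(w_gen, 'k) lie_term"
    assume lr: "(l, r) \<in> J_relations n" "l \<in> lie_terms (w_gens n)" "r \<in> lie_terms (w_gens n)"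
    show "?ev l - ?ev r \<in> K"
    proof (cases "(l, r) \<in> w_relations n")
      case True
      then have "?ev l = ?ev r" by (rule emb_w_relation[OF n order.refl])
      then show ?thesis using family.subspace_0[OF K] by simp
    next
      case False
      then have "l \<in> J_generators n" "r = Zero" using lr(1) by (auto simp: J_relations_def)
      then show ?thesis using gens ev lr by simp
    qed
  qed
  then show ?thesis using ev lie_eq_terms[OF t] by (simp add: emb_Zero)
qed

lemma ideal_generated_J:
  assumes n: "2 \<le> n"
  shows "ideal_generated (W n) (W_class n ` J_generators n) =
    (J_set n :: (w_gen, 'k::field_char_0) lie_term set set)"
proof
  have "W_class n t \<in> J_set n" if t: "t \<in> J_generators n" for t :: "(w_gen, 'k) lie_term"
  proof -
    have "t \<in> lie_terms (w_gens n)" using J_generators_terms n t by blast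
    moreover from this have "J_eq n t Zero"
      by (intro lie_eq.relation) (use t in \<open>auto simp: J_relations_def Zero_lie_term\<close>)
    ultimately show ?thesis by (auto simp: J_set_def)
  qed
  then show "ideal_generated (W n) (W_class n ` J_generators n) \<subseteq>
      (J_set n :: (w_gen, 'k) lie_term set set)"
    unfolding ideal_generated_def using J_set_ideal[OF n, where 'k='k] by blast
  show "(J_set n :: (w_gen, 'k) lie_term set set) \<subseteq> ideal_generated (W n) (W_class n ` J_generators n)"
    unfolding ideal_generated_def
  proof (intro subsetI InterI)
    fix A :: "(w_gen, 'k) lie_term set" and I :: "(w_gen, 'k) lie_term set set"
    assume A: "A \<in> J_set n" and "I \<in> {I. lie_ideal (W n) I \<and> W_class n ` J_generators n \<subseteq> I}"
    then have I: "lie_ideal (W n) I" "W_class n ` J_generators n \<subseteq> I" by auto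
    obtain t where t: "A = W_class n t" "t \<in> lie_terms (w_gens n)" "J_eq n t Zero"
      using A by (auto simp: J_set_def)
    have "eW n t \<in> lift_set n I"
    proof (rule J_eq_mod[OF n _ _ _ t(3)])
      show "family.subspace (lift_set n I)"
        using I(1) by (intro lift_set_subspace) (simp add: lie_ideal_def)
      show "eW n s \<in> lift_set n I" if "s \<in> J_generators n" for s
        using that I(2) lift_set_iff[OF J_generators_terms[OF n that], of I] by auto
    qed (rule lift_set_ideal[OF I(1)])
    then show "A \<in> I" using lift_set_iff[OF t(2), of I] t(1) by simp
  qed
qed

lemma W_grade_iff: "A \<in> W_grade n k \<longleftrightarrow>
    (\<exists>t. A = W_class n t \<and> t \<in> lie_terms (w_gens n) \<and> homogeneous w_degree k t)"
  by (auto simp: W_grade_def)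

lemma homogeneous_span:
  fixes t :: "(w_gen, 'k::field_char_0) lie_term"
  assumes "t \<in> lie_terms (w_gens n)"
  shows "eW n t \<in> family.span {eW n u | u k. u \<in> lie_terms (w_gens n) \<and> homogeneous w_degree k u}"
    (is "_ \<in> family.span ?H")
  using assms
proof (induction t)
  case (Gen x)
  then have "eW n (Gen x) \<in> ?H" using homogeneous.Gen[of w_degree x] by blast
  then show ?case by (rule family.span_base)
next
  case Zero
  then show ?case by (simp add: emb_Zero family.span_zero)
next
  case (Plus t u)
  then show ?case by (simp add: emb_Plus family.span_add)
next
  case (Scale c t)
  then show ?case by (simp add: emb_Scale family.span_scale)
next
  case (Br t u)
  interpret lie_superalg fscale fbr "fhom (PW n :: (w_gen, 'k) presentation)" by (rule family_superalg)
  have "fbr a b \<in> family.span ?H" if ab: "a \<in> ?H" "b \<in> ?H" for a b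
  proof -
    obtain u k v l where "a = eW n u" "u \<in> lie_terms (w_gens n)" "homogeneous w_degree k u"
      "b = eW n v" "v \<in> lie_terms (w_gens n)" "homogeneous w_degree l v" using ab by blast
    then have "fbr a b = eW n (Br u v)" "Br u v \<in> lie_terms (w_gens n)"
      "homogeneous w_degree (k + l) (Br u v)" by (auto simp: emb_Br intro: homogeneous.Br)
    then have "fbr a b \<in> ?H" by blast
    then show ?thesis by (rule family.span_base)
  qed
  then have "fbr (eW n t) (eW n u) \<in> family.span ?H"
    by (rule span_br2[OF _ family.subspace_span]) (use Br in auto)
  then show ?case using Br.prems by (simp add: emb_Br)
qed

text \<open>The span of the homogeneous elements of the kernel absorbs brackets with homogeneous
  elements, hence all brackets, and contains the generators, which have degree -2. So
  \<open>J_eq_mod\<close> puts the whole kernel into it.\<close>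

lemma J_set_homogeneous:
  assumes n: "2 \<le> n"
  shows "homogeneous_ideal (W n) (W_grade n) (J_set n :: (w_gen, 'k::field_char_0) lie_term set set)"
proof -
  let ?J = "J_set n :: (w_gen, 'k) lie_term set set"
  let ?U = "\<Union>k. ?J \<inter> W_grade n k"
  interpret lie_superalg fscale fbr "fhom (PW n :: (w_gen, 'k) presentation)" by (rule family_superalg)
  interpret L: lie_superalg fscale fbr "fhom (PL n :: (w_gen, 'k) presentation)" by (rule family_superalg)
  let ?H = "{eW n u | (u :: (w_gen, 'k) lie_term) k. u \<in> lie_terms (w_gens n) \<and> homogeneous w_degree k u}"
  let ?S = "{eW n u | (u :: (w_gen, 'k) lie_term) k. u \<in> lie_terms (w_gens n) \<and> homogeneous w_degree k u \<and> eL n u = 0}"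
  have br: "fbr a b \<in> family.span ?S \<and> fbr b a \<in> family.span ?S" if ab: "a \<in> ?H" "b \<in> ?S"
    for a b :: "(w_gen, 'k) family"
  proof -
    obtain u k v l where uv: "a = eW n u" "u \<in> lie_terms (w_gens n)" "homogeneous w_degree k u"
      "b = eW n v" "v \<in> lie_terms (w_gens n)" "homogeneous w_degree l v" "eL n v = 0" using ab by blast
    have "fbr a b = eW n (Br u v)" "Br u v \<in> lie_terms (w_gens n)"
      "homogeneous w_degree (k + l) (Br u v)" "eL n (Br u v) = 0"
      and "fbr b a = eW n (Br v u)" "Br v u \<in> lie_terms (w_gens n)"
      "homogeneous w_degree (l + k) (Br v u)" "eL n (Br v u) = 0"
      using uv homogeneous.Br[OF uv(3,6)] homogeneous.Br[OF uv(6,3)]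
        by (auto simp: emb_Br)
    then have "fbr a b \<in> ?S" "fbr b a \<in> ?S" by blast+
    then show ?thesis by (simp add: family.span_base)
  qed
  have span: "eW n t \<in> family.span ?S" if t: "J_eq n t Zero" for t :: "(w_gen, 'k) lie_term"
  proof (rule J_eq_mod[OF n family.subspace_span _ _ t])
    fix x and s :: "(w_gen, 'k) lie_term"
    assume x: "x \<in> family.span ?S" and s: "s \<in> lie_terms (w_gens n)"
    show "fbr (eW n s) x \<in> family.span ?S \<and> fbr x (eW n s) \<in> family.span ?S"
    proof
      show "fbr (eW n s) x \<in> family.span ?S"
        by (rule span_br2[OF conjunct1[OF br] family.subspace_span homogeneous_span[OF s] x])
      show "fbr x (eW n s) \<in> family.span ?S"
        by (rule span_br2[OF conjunct2[OF br] family.subspace_span x homogeneous_span[OF s]])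
    qed
  next
    fix t :: "(w_gen, 'k) lie_term" assume t: "t \<in> J_generators n"
    have "J_eq n t Zero"
      by (rule lie_eq.relation)
        (use t J_generators_terms[OF n t] in \<open>auto simp: J_relations_def Zero_lie_term\<close>)
    then have "eL n t = eL n Zero"
      using J_generators_terms[OF n t] by (simp add: emb_eq_iff pres_eq_def Zero_lie_term)
    then have "eL n t = 0" by (simp add: emb_Zero)
    then have "eW n t \<in> ?S" using J_generators_terms[OF n t] J_generators_degree[OF t] by blast
    then show "eW n t \<in> family.span ?S" by (rule family.span_base)
  qed
  have "?J = linear_span (W n) ?U"
  proof
    show "linear_span (W n) ?U \<subseteq> ?J"
      unfolding linear_span_def using J_set_ideal[OF n, where 'k='k] by (auto simp: lie_ideal_def)
    show "?J \<subseteq> linear_span (W n) ?U"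
      unfolding linear_span_def
    proof (intro subsetI InterI)
      fix A :: "(w_gen, 'k) lie_term set" and V assume A: "A \<in> ?J" and "V \<in> {V. linear_subspace (W n) V \<and> ?U \<subseteq> V}"
      then have V: "linear_subspace (W n) V" "?U \<subseteq> V" by auto
      obtain t where t: "A = W_class n t" "t \<in> lie_terms (w_gens n)" "J_eq n t Zero"
        using A by (auto simp: J_set_def)
      have "?S \<subseteq> lift_set n V"
      proof
        fix x assume "x \<in> ?S"
        then obtain u k where u: "x = eW n u" "u \<in> lie_terms (w_gens n)" "homogeneous w_degree k u" "eL n u = 0"
          by blast
        then have "W_class n u \<in> ?J \<inter> W_grade n k" using J_set_iff[OF n u(2)] W_grade_iff by blast
        then have "W_class n u \<in> V" using V(2) by blast
        then show "x \<in> lift_set n V" using lift_set_iff[OF u(2), of V] u(1) by simp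
      qed
      then have "family.span ?S \<subseteq> lift_set n V"
        using lift_set_subspace[OF V(1)] by (intro family.span_minimal)
      then have "eW n t \<in> lift_set n V" using span[OF t(3)] by blast
      then show "A \<in> V" using lift_set_iff[OF t(2), of V] t(1) by simp
    qed
  qed
  then show ?thesis using J_set_ideal[OF n, where 'k='k] by (simp add: homogeneous_ideal_def)
qed

section \<open>The local part and maximality\<close>

lemma W_add_zero:
  assumes "t \<in> lie_terms (w_gens n)"
  shows "add (W n) (add (W n) (W_class n t) (zero (W n))) (zero (W n)) = W_class n t"
    and "add (W n) (add (W n) (zero (W n)) (W_class n t)) (zero (W n)) = W_class n t"
    and "add (W n) (add (W n) (zero (W n)) (zero (W n))) (W_class n t) = W_class n t"
  using assms
  by (simp_all add: W_zero W_operations(1) Zero_lie_term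
      W_class_eq_iff emb_Plus emb_Zero)

lemma local_part_grade:
  assumes "A \<in> W_grade n k" "k \<in> {- 1, 0, 1}"
  shows "A \<in> local_part (W n) (W_grade n)"
proof -
  have z: "zero (W n) \<in> W_grade n l" for l
    using homogeneous.Zero Zero_lie_term unfolding W_grade_iff W_zero by blast
  obtain t where t: "A = W_class n t" "t \<in> lie_terms (w_gens n)" using assms(1) W_grade_iff by blast
  note add = W_add_zero[OF t(2), folded t(1)]
  show ?thesis
    using assms add[symmetric] z[of "- 1"] z[of 0] z[of 1] unfolding local_part_def by blast
qed

text \<open>The lift of the kernel is an ideal without e_0, so \<open>local_ideal_trivial\<close>
  can be applied in W itself to a sum of three local components.\<close>

lemma J_set_local:
  assumes n: "2 \<le> n"
  shows "(J_set n :: (w_gen, 'k::field_char_0) lie_term set set) \<inter> local_part (W n) (W_grade n) = {zero (W n)}"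
proof -
  let ?J = "J_set n :: (w_gen, 'k) lie_term set set"
  interpret w_algebra fscale fbr "fhom (PW n :: (w_gen, 'k) presentation)" n
    "\<lambda>a. eW n (gen_e a)" "\<lambda>a. eW n (gen_f a)" "\<lambda>a. eW n (gen_f0 a)" by (rule w_algebra_W[OF n])
  let ?K = "lift_set n ?J"
  have comp: "eW n t \<in> comp k" if "t \<in> lie_terms (w_gens n)" "homogeneous w_degree k t" for t k
    using ev_comp[of "\<lambda>x. eW n (Gen x)" k t] that by (simp add: ev_emb)
  have zero_J: "zero (W n) \<in> ?J" using J_set_ideal[OF n, where 'k='k] by (simp add: lie_ideal_def linear_subspace_def)
  have "A = zero (W n)" if A: "A \<in> ?J" "A \<in> local_part (W n) (W_grade n)" for A
  proof -
    obtain B C D where BCD: "A = add (W n) (add (W n) B C) D" "B \<in> W_grade n (- 1)"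
      "C \<in> W_grade n 0" "D \<in> W_grade n 1" using A(2) by (auto simp: local_part_def)
    obtain b where b: "B = W_class n b" "b \<in> lie_terms (w_gens n)" "homogeneous w_degree (- 1) b"
      using BCD(2) W_grade_iff by blast
    obtain c where c: "C = W_class n c" "c \<in> lie_terms (w_gens n)" "homogeneous w_degree 0 c"
      using BCD(3) W_grade_iff by blast
    obtain d where d: "D = W_class n d" "d \<in> lie_terms (w_gens n)" "homogeneous w_degree 1 d"
      using BCD(4) W_grade_iff by blast
    let ?t = "Plus (Plus b c) d"
    have t: "?t \<in> lie_terms (w_gens n)" and bc: "Plus b c \<in> lie_terms (w_gens n)" using b c d by auto
    have At: "A = W_class n ?t"
      unfolding BCD(1) b(1) c(1) d(1) W_operations(1)[OF b(2) c(2)] W_operations(1)[OF bc d(2)] ..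
    have et: "eW n ?t = eW n b + eW n c + eW n d" using b c d by (simp add: emb_Plus)
    have "eW n b + eW n c + eW n d = 0"
    proof (rule local_ideal_trivial)
      show "family.subspace ?K"
        using J_set_ideal[OF n, where 'k='k] by (intro lift_set_subspace) (simp add: lie_ideal_def)
      show "fbr y x \<in> ?K" if "y \<in> fhom (PW n) p" "x \<in> ?K" for p y x
        using that lift_set_ideal[OF J_set_ideal[OF n, where 'k='k]] by (auto simp: fhom_def)
      have "gen_e 0 \<in> lie_terms (w_gens n)" using n by (auto simp: w_gens_def e_index_def)
      moreover have "W_class n (gen_e 0) \<notin> ?J"
        using J_set_iff[OF n calculation] eL_e0_nonzero[OF n] by blast
      ultimately show "eW n (gen_e 0) \<notin> ?K" using lift_set_iff by blast
      show "eW n b + eW n c + eW n d \<in> ?K" using A(1) At t lift_set_iff et by metis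
    qed (use comp b c d in auto)
    then have "eW n ?t = eW n Zero" using et by (simp add: emb_Zero)
    then show ?thesis
      using At W_class_eq_iff[OF t Zero_lie_term] by (simp add: W_zero)
  qed
  moreover have "zero (W n) \<in> local_part (W n) (W_grade n)"
    using homogeneous.Zero Zero_lie_term unfolding W_zero
    by (intro local_part_grade[of _ _ 0]) (auto simp: W_grade_iff)
  ultimately show ?thesis using zero_J by blast
qed

text \<open>Two algebras run in parallel: brackets with the \<open>d l\<close> are formed in W,
  where I absorbs them, and their images are evaluated in the quotient, where
  \<open>comp_detect\<close> applies.\<close>

lemma J_set_greatest:
  fixes I :: "(w_gen, 'k::field_char_0) lie_term set set"
  assumes n: "2 \<le> n" and I: "homogeneous_ideal (W n) (W_grade n) I"
    and local: "I \<inter> local_part (W n) (W_grade n) = {zero (W n)}"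
  shows "I \<subseteq> J_set n"
proof -
  interpret W: w_algebra fscale fbr "fhom (PW n :: (w_gen, 'k) presentation)" n
    "\<lambda>a. eW n (gen_e a)" "\<lambda>a. eW n (gen_f a)" "\<lambda>a. eW n (gen_f0 a)" by (rule w_algebra_W[OF n])
  interpret L: w_quotient fscale fbr "fhom (PL n :: (w_gen, 'k) presentation)" n
    "\<lambda>a. eL n (gen_e a)" "\<lambda>a. eL n (gen_f a)" "\<lambda>a. eL n (gen_f0 a)" by (rule w_quotient_L[OF n])
  have ideal: "lie_ideal (W n) I" using I by (simp add: homogeneous_ideal_def)
  have zero_J: "zero (W n) \<in> (J_set n :: (w_gen, 'k) lie_term set set)"
    using J_set_ideal[OF n, where 'k='k] by (simp add: lie_ideal_def linear_subspace_def)
  have "A \<in> J_set n" if A: "A \<in> I" "A \<in> W_grade n k" for A k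
  proof -
    obtain t where t: "A = W_class n t" "t \<in> lie_terms (w_gens n)" "homogeneous w_degree k t"
      using A(2) W_grade_iff by blast
    consider "2 \<le> k" | "k \<in> {- 1, 0, 1}" | "k \<le> - 2" by fastforce
    then show ?thesis
    proof cases
      case 1
      then have "eW n t = eW n Zero"
        using W.ev_comp[of "\<lambda>x. eW n (Gen x)" k t] t by (simp add: ev_emb W.comp_def emb_Zero)
      then show ?thesis using W_class_eq_iff[OF t(2) Zero_lie_term] t(1) zero_J by (simp add: W_zero)
    next
      case 2
      then have "A \<in> I \<inter> local_part (W n) (W_grade n)" using local_part_grade[OF A(2)] A(1) by simp
      then show ?thesis using zero_J unfolding local by simp
    next
      case 3
      \<comment> \<open>An element of degree - (m + 1) reaches degree 1 after m + 2 brackets, the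
        length that \<open>comp_detect\<close> asks for.\<close>
      define m where "m = nat (- k) - 1"
      have k: "k = - int (Suc m)" using 3 by (simp add: m_def)
      have dL: "L.d l = eL n (dterm l)" if "l < n" for l
        using L.ev_dterm[of "\<lambda>x. eL n (Gen x)" l] by (simp add: ev_emb dterm_lie_term that)
      have iterate: "fold (\<lambda>l. Br (dterm l)) ps u \<in> lie_terms (w_gens n) \<and>
          homogeneous w_degree (j + int (length ps)) (fold (\<lambda>l. Br (dterm l)) ps u) \<and>
          W_class n (fold (\<lambda>l. Br (dterm l)) ps u) \<in> I \<and>
          fold (\<lambda>l. fbr (L.d l)) ps (eL n u) = eL n (fold (\<lambda>l. Br (dterm l)) ps u)"
        if "set ps \<subseteq> {..<n}" "u \<in> lie_terms (w_gens n)" "homogeneous w_degree j u" "W_class n u \<in> I"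
        for ps u j
        using that
      proof (induction ps arbitrary: u j)
        case (Cons l ps)
        have "l < n" using Cons.prems(1) by simp
        then have l: "(dterm l :: (w_gen, 'k) lie_term) \<in> lie_terms (w_gens n)" "l < n"
          by (simp_all add: dterm_lie_term)
        have 1: "Br (dterm l) u \<in> lie_terms (w_gens n)" using l Cons.prems by simp
        have 2: "homogeneous w_degree (1 + j) (Br (dterm l) u)"
          by (rule homogeneous.Br[OF dterm_degree Cons.prems(3)])
        have carrier: "W_class n (dterm l :: (w_gen, 'k) lie_term) \<in> carrier (W n)"
          unfolding W_carrier using l(1) by blast
        have "bracket (W n) (W_class n (dterm l)) (W_class n u) \<in> I"
          using bspec[OF bspec[OF conjunct2[OF ideal[unfolded lie_ideal_def]] carrier] Cons.prems(4)]
          by simp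
        then have 3: "W_class n (Br (dterm l) u) \<in> I"
          using W_operations(3)[OF l(1) Cons.prems(2)] by simp
        have "fbr (L.d l) (eL n u) = eL n (Br (dterm l) u)"
          using l Cons.prems by (simp add: dL emb_Br)
        then show ?case
          using Cons.IH[OF _ 1 2 3] Cons.prems(1) by (simp add: algebra_simps)
      qed (use that in simp)
      have "eL n t = 0"
      proof (rule L.comp_detect)
        show "eL n (gen_e 0) \<noteq> (0 :: (w_gen, 'k) family)" by (rule eL_e0_nonzero[OF n])
        show "eL n t \<in> L.comp (- int (Suc m))"
          using L.ev_comp[of "\<lambda>x. eL n (Gen x)" k t] t k by (simp add: ev_emb)
        fix ps :: "nat list" assume ps: "length ps = Suc (Suc m)" "set ps \<subseteq> {..<n}"
        let ?u = "fold (\<lambda>l. Br (dterm l)) ps t"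
        have "W_class n t \<in> I" using A(1) t(1) by simp
        from iterate[OF ps(2) t(2,3) this]
        have u: "?u \<in> lie_terms (w_gens n)" "homogeneous w_degree (k + int (length ps)) ?u"
          "W_class n ?u \<in> I" "fold (\<lambda>l. fbr (L.d l)) ps (eL n t) = eL n ?u" by auto
        have "k + int (length ps) = 1" using k ps(1) by simp
        then have "homogeneous w_degree 1 ?u" using u(2) by simp
        then have "W_class n ?u \<in> W_grade n 1" unfolding W_grade_iff using u(1) by blast
        then have "W_class n ?u \<in> I \<inter> local_part (W n) (W_grade n)"
          using local_part_grade[of _ n 1] u(3) by simp
        then have "W_class n ?u \<in> J_set n" using zero_J unfolding local by simp
        then show "fold (\<lambda>l. fbr (L.d l)) ps (eL n t) = 0" using J_set_iff[OF n u(1)] u(4) by simp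
      qed
      then show ?thesis using J_set_iff[OF n t(2)] t(1) by simp
    qed
  qed
  then have "(\<Union>k. I \<inter> W_grade n k) \<subseteq> J_set n" by blast
  then have "linear_span (W n) (\<Union>k. I \<inter> W_grade n k) \<subseteq> J_set n"
    unfolding linear_span_def using J_set_ideal[OF n, where 'k='k] by (auto simp: lie_ideal_def)
  then show ?thesis using I by (simp add: homogeneous_ideal_def)
qed

text \<open>The field enters only through its characteristic 0, so the real and the complex case are
  two instances.\<close>

lemma J_maximal:
  assumes "2 \<le> n"
  shows "is_maximal_homogeneous_ideal
    (W n :: ((w_gen, 'k::field_char_0) lie_term set, 'k) bracket_algebra)
    (W_grade n) (ideal_generated (W n) (W_class n ` J_generators n))"
  unfolding ideal_generated_J[OF assms] is_maximal_homogeneous_ideal_def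
  by (intro conjI allI impI J_set_homogeneous J_set_local assms) (elim conjE, rule J_set_greatest[OF assms])

theorem theorem4p4:
  fixes n :: nat
  assumes "n \<ge> 2"
  shows "is_maximal_homogeneous_ideal (W n :: ((w_gen, real) lie_term set, real) bracket_algebra)
           (W_grade n) (ideal_generated (W n) (W_class n ` J_generators n)) \<and>
         is_maximal_homogeneous_ideal (W n :: ((w_gen, complex) lie_term set, complex) bracket_algebra)
           (W_grade n) (ideal_generated (W n) (W_class n ` J_generators n))"
  by (intro conjI J_maximal assms)

end
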